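(* Let $X$ be a Banach space and let $\Gamma:[0,1]\to cwk(X)$ be a variationally Henstock integrable multifunction. If $\mathcal{S}_{vH}(\Gamma)\neq\emptyset$ (this is fulfilled in case $X$ possesses the Radon–Nikodým property), then for every $f\in\mathcal{S}_{vH}(\Gamma)$ the multifunction $G:[0,1]\to cwk(X)$ defined by $\Gamma(t)=G(t)+f(t)$ is Birkhoff integrable.
   Context: $[0,1]$ carries Lebesgue measure $\lambda$; $\mathcal{L}$ is the family of Lebesgue measurable subsets of $[0,1]$, $\mathcal{I}$ the family of all closed subintervals; $|\cdot|$ denotes length (Lebesgue measure). $cwk(X)$ is the family of all non-empty convex weakly compact subsets of $X$, with Minkowski addition, multiplication by scalars, and the Hausdorff distance $d_H$. A function $f:[0,1]\to X$ is a selection of $\Gamma$ if $f(t)\in\Gamma(t)$ for every $t$; it is scalarly measurable if $x^*f$ is measurable for every $x^*\in X^*$. A gauge is a function $\delta:[0,1]\to(0,\infty)$. A Perron partition of $[0,1]$ is a finite collection $\{(I_1,t_1),\dots,(I_p,t_p)\}$ of non-overlapping closed subintervals with union $[0,1]$ and points $t_i\in I_i$; it is $\delta$-fine if $I_i\subset(t_i-\delta(t_i),t_i+\delta(t_i))$ for all $i$. $\Gamma:[0,1]\to cwk(X)$ is variationally Henstock integrable if there is a finitely additive $\Phi_\Gamma:\mathcal{I}\to cwk(X)$ such that for every $\varepsilon>0$ there is a gauge $\delta$ with $\sum_{j=1}^p d_H(\Phi_\Gamma(I_j),\Gamma(t_j)|I_j|)<\varepsilon$ for every $\delta$-fine Perron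 partition of $[0,1]$. For functions $f:[0,1]\to X$ the same definition is used with $f$ identified with $t\mapsto\{f(t)\}$ and the primitive taking values in $X$. $\mathcal{S}_{vH}(\Gamma)$ is the family of all scalarly measurable selections of $\Gamma$ that are variationally Henstock integrable. $\Gamma:[0,1]\to cwk(X)$ is Birkhoff integrable if there is a set $\Phi\in cwk(X)$ such that for every $\varepsilon>0$ there is a countable partition $\Pi_0$ of $[0,1]$ into sets of $\mathcal{L}$ such that for every countable partition $\Pi=(A_n)_n$ of $[0,1]$ in $\mathcal{L}$ finer than $\Pi_0$ and any choice of points $t_n\in A_n$, the series $\sum_n|A_n|\Gamma(t_n)$ is unconditionally convergent (in $d_H$) and $d_H(\Phi,\sum_n|A_n|\Gamma(t_n))<\varepsilon$. *)

theory Defs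
  imports "HOL-Analysis.Analysis"
begin

section \<open>Convex weakly compact sets and the Hausdorff distance\<close>

text \<open>The coarsest topology making every continuous linear functional continuous.\<close>

definition weak_topology :: "'a::real_normed_vector topology" where
  "weak_topology =
     topology_generated_by {blinfun_apply h -` U | (h :: 'a \<Rightarrow>\<^sub>L real) U. open U}"

definition cwk :: "'a::real_normed_vector set set" where
  "cwk = {K. K \<noteq> {} \<and> convex K \<and> compactin weak_topology K}"

text \<open>Minkowski addition is the addition of sets from \<open>Set_Algebras\<close>, with neutral element
  the singleton of 0; the sums of sets below are taken with respect to it.\<close>

abbreviation scale_set :: "real \<Rightarrow> 'a::real_vector set \<Rightarrow> 'a set"  (infixr \<open>*\<^sub>S\<close> 75) where
  "c *\<^sub>S K \<equiv> (\<lambda>x. c *\<^sub>R x) ` K"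

text \<open>Only meaningful for non-empty bounded sets.\<close>

definition hausdorff_distance :: "'a::metric_space set \<Rightarrow> 'a set \<Rightarrow> real" where
  "hausdorff_distance A B = max (SUP x\<in>A. infdist x B) (SUP y\<in>B. infdist y A)"

text \<open>Unconditional convergence of a series of sets, formulated as for \<open>has_sum\<close>: the net of
  all finite partial sums converges, here in the Hausdorff distance.\<close>

definition hausdorff_has_sum ::
    "('i \<Rightarrow> 'a::real_normed_vector set) \<Rightarrow> 'i set \<Rightarrow> 'a set \<Rightarrow> bool" where
  "hausdorff_has_sum C N S \<longleftrightarrow>
     ((\<lambda>F. hausdorff_distance (\<Sum>n\<in>F. C n) S) \<longlongrightarrow> 0) (finite_subsets_at_top N)"

section \<open>The variational Henstock integral\<close>

text \<open>Degenerate intervals are included, as they are in \<open>tagged_division_of\<close>. This is harmless: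
  additivity forces a primitive to be the singleton of 0 on them.\<close>

definition subintervals :: "real set set" where
  "subintervals = {{a..b} | a b. 0 \<le> a \<and> a \<le> b \<and> b \<le> 1}"

definition finitely_additive :: "(real set \<Rightarrow> 'a::real_vector set) \<Rightarrow> bool" where
  "finitely_additive \<Phi> \<longleftrightarrow>
     (\<forall>I\<in>subintervals. \<forall>J\<in>subintervals.
        I \<union> J \<in> subintervals \<and> interior I \<inter> interior J = {} \<longrightarrow> \<Phi> (I \<union> J) = \<Phi> I + \<Phi> J)"

definition vH_primitive ::
    "(real set \<Rightarrow> 'a::real_normed_vector set) \<Rightarrow> (real \<Rightarrow> 'a set) \<Rightarrow> bool" where
  "vH_primitive \<Phi> \<Gamma> \<longleftrightarrow>
     finitely_additive \<Phi> \<and>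
     (\<forall>\<epsilon>>0. \<exists>\<delta>::real \<Rightarrow> real. (\<forall>t\<in>{0..1}. \<delta> t > 0) \<and>
        (\<forall>p. p tagged_division_of {0..1} \<and> (\<lambda>t. {t - \<delta> t<..<t + \<delta> t}) fine p \<longrightarrow>
           (\<Sum>(t, I)\<in>p. hausdorff_distance (\<Phi> I) (measure lebesgue I *\<^sub>S \<Gamma> t)) < \<epsilon>))"

definition vH_integrable :: "(real \<Rightarrow> 'a::real_normed_vector set) \<Rightarrow> bool" where
  "vH_integrable \<Gamma> \<longleftrightarrow> (\<exists>\<Phi>. (\<forall>I\<in>subintervals. \<Phi> I \<in> cwk) \<and> vH_primitive \<Phi> \<Gamma>)"

definition vH_integrable_fun :: "(real \<Rightarrow> 'a::real_normed_vector) \<Rightarrow> bool" where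
  "vH_integrable_fun f \<longleftrightarrow> (\<exists>\<phi>. vH_primitive (\<lambda>I. {\<phi> I}) (\<lambda>t. {f t}))"

definition scalarly_measurable :: "(real \<Rightarrow> 'a::real_normed_vector) \<Rightarrow> bool" where
  "scalarly_measurable f \<longleftrightarrow>
     (\<forall>h :: 'a \<Rightarrow>\<^sub>L real. (\<lambda>t. blinfun_apply h (f t)) \<in> borel_measurable (lebesgue_on {0..1}))"

text \<open>Functions on the unit interval are represented by functions on the reals whose values
  outside the interval are irrelevant.\<close>

definition S_vH :: "(real \<Rightarrow> 'a::real_normed_vector set) \<Rightarrow> (real \<Rightarrow> 'a) set" where
  "S_vH \<Gamma> = {f. (\<forall>t\<in>{0..1}. f t \<in> \<Gamma> t) \<and> scalarly_measurable f \<and> vH_integrable_fun f}"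

section \<open>The Birkhoff integral\<close>

definition countable_partition :: "real set set \<Rightarrow> bool" where
  "countable_partition P \<longleftrightarrow>
     countable P \<and> P \<subseteq> sets (lebesgue_on {0..1}) \<and> partition_on {0..1} P"

definition birkhoff_integrable :: "(real \<Rightarrow> 'a::real_normed_vector set) \<Rightarrow> bool" where
  "birkhoff_integrable \<Gamma> \<longleftrightarrow>
     (\<exists>\<Phi>\<in>cwk. \<forall>\<epsilon>>0. \<exists>P\<^sub>0. countable_partition P\<^sub>0 \<and>
        (\<forall>P t. countable_partition P \<and> refines {0..1} P P\<^sub>0 \<and> (\<forall>A\<in>P. t A \<in> A) \<longrightarrow>
           (\<exists>S\<in>cwk. hausdorff_has_sum (\<lambda>A. measure lebesgue A *\<^sub>S \<Gamma> (t A)) P S \<and>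
              hausdorff_distance \<Phi> S < \<epsilon>)))"

section \<open>The Radon-Nikodym property\<close>

text \<open>This is the library's \<open>has_bochner_integral\<close> without its restriction to second countable
  spaces; the approximating simple functions make the integrand essentially separably valued.\<close>

definition bochner_has_integral ::
    "'m measure \<Rightarrow> ('m \<Rightarrow> 'a::real_normed_vector) \<Rightarrow> 'a \<Rightarrow> bool" where
  "bochner_has_integral M g x \<longleftrightarrow>
     g \<in> borel_measurable M \<and>
     (\<exists>s. (\<forall>i::nat. Bochner_Integration.simple_bochner_integrable M (s i)) \<and>
          (\<lambda>i. \<integral>\<^sup>+ \<omega>. norm (g \<omega> - s i \<omega>) \<partial>M) \<longlonglongrightarrow> 0 \<and>
          (\<lambda>i. Bochner_Integration.simple_bochner_integral M (s i)) \<longlonglongrightarrow> x)"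

definition vector_measure :: "'m measure \<Rightarrow> ('m set \<Rightarrow> 'a::real_normed_vector) \<Rightarrow> bool" where
  "vector_measure M \<nu> \<longleftrightarrow>
     (\<forall>A::nat \<Rightarrow> 'm set. range A \<subseteq> sets M \<and> disjoint_family A \<longrightarrow>
        (\<lambda>n. \<nu> (A n)) sums \<nu> (\<Union>n. A n))"

definition finite_variation :: "'m measure \<Rightarrow> ('m set \<Rightarrow> 'a::real_normed_vector) \<Rightarrow> bool" where
  "finite_variation M \<nu> \<longleftrightarrow>
     (\<exists>B. \<forall>P. finite P \<and> P \<subseteq> sets M \<and> partition_on (space M) P \<longrightarrow> (\<Sum>A\<in>P. norm (\<nu> A)) \<le> B)"

definition continuous_wrt :: "'m measure \<Rightarrow> ('m set \<Rightarrow> 'a::real_normed_vector) \<Rightarrow> bool" where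
  "continuous_wrt M \<nu> \<longleftrightarrow>
     (\<forall>\<epsilon>>0. \<exists>\<delta>>0. \<forall>A\<in>sets M. measure M A < \<delta> \<longrightarrow> norm (\<nu> A) < \<epsilon>)"

text \<open>A definition cannot quantify over all types, so the finite measure spaces range over those
  whose points are real numbers. This includes Lebesgue measure on the unit interval, for which
  the property is known to imply the property for all finite measure spaces.\<close>

definition radon_nikodym_property :: "'a::banach itself \<Rightarrow> bool" where
  "radon_nikodym_property _ \<longleftrightarrow>
     (\<forall>(M :: real measure) (\<nu> :: real set \<Rightarrow> 'a).
        finite_measure M \<and> vector_measure M \<nu> \<and> finite_variation M \<nu> \<and> continuous_wrt M \<nu> \<longrightarrow>
        (\<exists>g. \<forall>A\<in>sets M. bochner_has_integral M (\<lambda>\<omega>. indicator A \<omega> *\<^sub>R g \<omega>) (\<nu> A)))"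

end

theory Submission
  imports Defs
begin

text \<open>Subtracting a selection \<open>f\<close> with primitive \<open>\<phi>\<close> turns \<open>\<Gamma>\<close> into a multifunction \<open>G\<close> which is
  variationally Henstock integrable, with primitive the translate of \<open>\<Phi>\<close> by the negative of \<open>\<phi>\<close>, and
  which satisfies \<open>0 \<in> G t\<close>. Bounded convex sets are handled through their support functions
  \<open>support h\<close>, where \<open>h\<close> runs over the functionals of norm at most 1: they are additive, and
  by separation the Hausdorff distance is the supremum of their differences
  (\<open>abs_support_diff_le_hausdorff\<close>, \<open>hausdorff_le_supportI\<close>). Since \<open>0 \<in> G t\<close>, the functions
  \<open>support h (G t)\<close> of \<open>t\<close> are non-negative. The Henstock integral makes them integrable, with integral
  the support function of the primitive (\<open>support_has_integral\<close>), and the sign makes the integral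
  a Lebesgue integral.

  Two facts that are uniform in \<open>h\<close> then yield the Birkhoff integral. The primitive is
  differentiable almost everywhere in the Hausdorff distance, with derivative \<open>G\<close>; hence, up to a null
  set, the unit interval is a countable union of measurable pieces on which \<open>G\<close> oscillates by at most
  \<open>\<epsilon>\<close> (\<open>vH_measurable_pieces\<close>). Moreover, a single tagged partition, chosen before \<open>h\<close>, meets
  only finitely many of these pieces, and comparing its Riemann sum with the integral shows that
  little integral is left outside of them; so the integrals of all the support functions are
  uniformly absolutely continuous (\<open>uniformly_absolutely_continuous\<close>). For a partition finer than
  the pieces, each term of the Birkhoff sum is close to the integral over its set, the tails of the
  sum are small in the Hausdorff distance, and the sum is the image of a product of weakly compact sets
  under a weakly continuous map (\<open>cwk_unconditional_sum\<close>).

  For the existence of a selection under the Radon--Nikodym property, a compactness argument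
  provides a curve \<open>u\<close> whose increments lie in the values of the primitive of \<open>\<Gamma>\<close>
  (\<open>additive_selection_exists\<close>). Wherever the primitive is differentiable, \<open>u\<close> is pointwise
  Lipschitz, so it is differentiable almost everywhere by a theorem of Stepanov (\<open>rnp_stepanov\<close>). That
  theorem is reduced to Lipschitz curves, whose increments extend to a vector measure with a
  Radon--Nikodym density (\<open>rnp_differentiable\<close>). The derivative of \<open>u\<close> belongs to the closed set
  \<open>\<Gamma> t\<close> for almost every \<open>t\<close>, and \<open>u\<close> is its variational primitive (\<open>vH_derivative_of_selection\<close>).\<close>

section \<open>Separation and uniform boundedness\<close>

definition sublinear :: "('a::real_vector \<Rightarrow> real) \<Rightarrow> bool" where
  "sublinear p \<longleftrightarrow> (\<forall>x y. p (x + y) \<le> p x + p y) \<and> (\<forall>c>0. \<forall>x. p (c *\<^sub>R x) = c * p x)"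

lemma sublinearD:
  assumes "sublinear p"
  shows "p (x + y) \<le> p x + p y" "c > 0 \<Longrightarrow> p (c *\<^sub>R x) = c * p x" "p 0 = 0" "- p (- x) \<le> p x"
proof -
  show *: "p (x + y) \<le> p x + p y" for x y
    using assms by (simp add: sublinear_def)
  show **: "c > 0 \<Longrightarrow> p (c *\<^sub>R x) = c * p x" for c x
    using assms by (simp add: sublinear_def)
  show z: "p 0 = 0"
    using **[of 2 0] by simp
  show "- p (- x) \<le> p x"
    using *[of x "- x"] z by simp
qed

text \<open>The chain condition gives subadditivity: members that are nearly optimal at \<open>x\<close> and at \<open>y\<close> may
  both be replaced by the smaller of the two. The bound \<open>b\<close> keeps the infima finite.\<close>

lemma sublinear_Inf_chain:
  assumes "C \<noteq> {}" and sub: "\<And>q. q \<in> C \<Longrightarrow> sublinear q"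
    and chain: "\<And>q r. q \<in> C \<Longrightarrow> r \<in> C \<Longrightarrow> q \<le> r \<or> r \<le> q"
    and lb: "\<And>q x. q \<in> C \<Longrightarrow> b x \<le> q x"
  shows "sublinear (\<lambda>x. INF q\<in>C. q x)"
proof -
  have bdd: "bdd_below ((\<lambda>q. q x) ` C)" for x
    using lb by (auto simp: bdd_below_def)
  have "(INF q\<in>C. q (x + y)) \<le> (INF q\<in>C. q x) + (INF q\<in>C. q y)" for x y
  proof (rule field_le_epsilon)
    fix e :: real assume "e > 0"
    obtain q where q: "q \<in> C" "q x < (INF q\<in>C. q x) + e/2"
      using cInf_lessD[of "(\<lambda>q. q x) ` C" "(INF q\<in>C. q x) + e/2"] \<open>C \<noteq> {}\<close> \<open>e > 0\<close> by auto
    obtain r where r: "r \<in> C" "r y < (INF q\<in>C. q y) + e/2"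
      using cInf_lessD[of "(\<lambda>q. q y) ` C" "(INF q\<in>C. q y) + e/2"] \<open>C \<noteq> {}\<close> \<open>e > 0\<close> by auto
    obtain s where s: "s \<in> C" "s \<le> q" "s \<le> r"
      using chain[OF q(1) r(1)] q(1) r(1) by auto
    have "(INF q\<in>C. q (x + y)) \<le> s (x + y)"
      by (rule cINF_lower[OF bdd s(1)])
    also have "\<dots> \<le> s x + s y"
      using sublinearD(1)[OF sub[OF s(1)]] .
    also have "\<dots> \<le> q x + r y"
      using s by (simp add: le_fun_def add_mono)
    finally show "(INF q\<in>C. q (x + y)) \<le> (INF q\<in>C. q x) + (INF q\<in>C. q y) + e"
      using q r by simp
  qed
  moreover have "(INF q\<in>C. q (c *\<^sub>R x)) = c * (INF q\<in>C. q x)" if "c > 0" for c x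
  proof -
    have "(INF q\<in>C. q (c *\<^sub>R x)) = (INF q\<in>C. c * q x)"
      using sublinearD(2)[OF sub that] by (intro INF_cong) auto
    also have "\<dots> = c * (INF q\<in>C. q x)"
    proof (rule antisym)
      show "c * (INF q\<in>C. q x) \<le> (INF q\<in>C. c * q x)"
        using that by (intro cINF_greatest \<open>C \<noteq> {}\<close> mult_left_mono cINF_lower[OF bdd]) auto
      have bdd': "bdd_below ((\<lambda>q. c * q x) ` C)"
        using lb that by (auto simp: bdd_below_def intro!: exI[of _ "c * b x"] mult_left_mono)
      have "(INF q\<in>C. c * q x) / c \<le> (INF q\<in>C. q x)"
        using that by (intro cINF_greatest \<open>C \<noteq> {}\<close>)
          (simp add: divide_le_eq mult.commute cINF_lower[OF bdd'])
      then show "(INF q\<in>C. c * q x) \<le> c * (INF q\<in>C. q x)"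
        using that by (simp add: divide_le_eq mult.commute)
    qed
    finally show ?thesis .
  qed
  ultimately show ?thesis
    unfolding sublinear_def by blast
qed

text \<open>Zorn's lemma, with the functionals ordered downwards. Every sublinear functional below \<open>p\<close> is at least
  \<open>- p (- x)\<close> at \<open>x\<close>, which is the bound needed for infima of chains.\<close>

lemma sublinear_minimal_exists:
  assumes "sublinear p"
  obtains m where "sublinear m" "m \<le> p" "\<And>q. sublinear q \<Longrightarrow> q \<le> m \<Longrightarrow> q = m"
proof -
  define S where "S = {q. sublinear q \<and> q \<le> p}"
  define R where "R = (\<lambda>q r :: 'a \<Rightarrow> real. r \<le> q)"
  have po: "partial_order_on S (relation_of R S)"
    by (rule partial_order_on_relation_ofI) (auto simp: R_def)
  have "\<exists>m\<in>S. \<forall>a\<in>S. R m a \<longrightarrow> a = m"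
  proof (rule predicate_Zorn[OF po])
    fix C assume C: "C \<in> Chains (relation_of R S)"
    show "\<exists>u\<in>S. \<forall>a\<in>C. R a u"
    proof (cases "C = {}")
      case True
      then show ?thesis using assms by (auto simp: S_def)
    next
      case False
      have CS: "C \<subseteq> S" and ch: "\<And>q r. q \<in> C \<Longrightarrow> r \<in> C \<Longrightarrow> q \<le> r \<or> r \<le> q"
        using C by (auto simp: Chains_def relation_of_def R_def)
      have lb: "- p (- x) \<le> q x" if "q \<in> C" for q x
      proof -
        have "sublinear q" "q \<le> p" using that CS by (auto simp: S_def)
        then show ?thesis
          using sublinearD(4)[of q x] le_funD[of q p "- x"] by linarith
      qed
      define u where "u = (\<lambda>x. INF q\<in>C. q x)"
      have sub: "sublinear u"
        unfolding u_def
        by (rule sublinear_Inf_chain[where b="\<lambda>x. - p (- x)"]) (use False ch lb CS in \<open>auto simp: S_def\<close>)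
      have le: "u \<le> q" if "q \<in> C" for q
        unfolding u_def le_fun_def
        using lb that by (auto intro!: cINF_lower bdd_belowI2)
      obtain q where "q \<in> C" using False by blast
      with le CS have "u \<le> p" by (fastforce simp: S_def)
      with sub le show ?thesis
        by (auto simp: S_def R_def intro!: bexI[of _ u])
    qed
  qed
  then obtain m where m: "m \<in> S" "\<And>a. a \<in> S \<Longrightarrow> a \<le> m \<Longrightarrow> a = m"
    by (auto simp: R_def)
  show ?thesis
  proof (rule that)
    show "sublinear m" "m \<le> p" using m by (auto simp: S_def)
    show "q = m" if "sublinear q" "q \<le> m" for q
      using that m \<open>m \<le> p\<close> by (auto simp: S_def)
  qed
qed

text \<open>Pulling \<open>m\<close> down along the ray of \<open>y\<close>, that is, taking the infimum over \<open>t \<ge> 0\<close> of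
  \<open>m (x + t *\<^sub>R y) - t * m y\<close>, gives a sublinear functional below \<open>m\<close>. By minimality it is \<open>m\<close>, and its
  value for \<open>t = 1\<close> supplies the missing inequality.\<close>

lemma sublinear_minimal_additive:
  assumes m: "sublinear m" and min: "\<And>q. sublinear q \<Longrightarrow> q \<le> m \<Longrightarrow> q = m"
  shows "m (x + y) = m x + m y"
proof -
  define A where "A = (\<lambda>x. (\<lambda>t. m (x + t *\<^sub>R y) - t * m y) ` {0..})"
  define q where "q = (\<lambda>x. Inf (A x))"
  have my: "m (t *\<^sub>R y) = t * m y" if "t \<ge> 0" for t
    using sublinearD(2)[OF m, of t y] sublinearD(3)[OF m] that by (cases "t = 0") auto
  have lb: "- m (- x) \<le> a" if "a \<in> A x" for a x
  proof -
    obtain t where t: "t \<ge> 0" "a = m (x + t *\<^sub>R y) - t * m y" using \<open>a \<in> A x\<close> by (auto simp: A_def)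
    have "m (t *\<^sub>R y) \<le> m (x + t *\<^sub>R y) + m (- x)"
      using sublinearD(1)[OF m, of "x + t *\<^sub>R y" "- x"] by simp
    with my[OF t(1)] t(2) show ?thesis by simp
  qed
  have bdd: "bdd_below (A x)" for x using lb by (auto simp: bdd_below_def)
  have ne: "A x \<noteq> {}" for x by (auto simp: A_def)
  have low: "q x \<le> m (x + t *\<^sub>R y) - t * m y" if "t \<ge> 0" for x t
    unfolding q_def by (rule cInf_lower[OF _ bdd]) (use that in \<open>auto simp: A_def\<close>)
  have approx: "\<exists>t\<ge>0. m (x + t *\<^sub>R y) - t * m y < q x + e" if "e > 0" for x e
    using cInf_lessD[OF ne[of x], of "q x + e"] that by (auto simp: A_def q_def)
  have "sublinear q"
    unfolding sublinear_def
  proof (intro conjI allI impI)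
    fix u v
    show "q (u + v) \<le> q u + q v"
    proof (rule field_le_epsilon)
      fix e :: real assume "e > 0"
      obtain s where s: "s \<ge> 0" "m (u + s *\<^sub>R y) - s * m y < q u + e/2"
        using approx[of "e/2" u] \<open>e > 0\<close> by auto
      obtain t where t: "t \<ge> 0" "m (v + t *\<^sub>R y) - t * m y < q v + e/2"
        using approx[of "e/2" v] \<open>e > 0\<close> by auto
      have "q (u + v) \<le> m ((u + s *\<^sub>R y) + (v + t *\<^sub>R y)) - (s + t) * m y"
        using low[of "s + t" "u + v"] s t by (simp add: algebra_simps)
      also have "\<dots> \<le> m (u + s *\<^sub>R y) + m (v + t *\<^sub>R y) - (s + t) * m y"
        using sublinearD(1)[OF m] by simp
      finally show "q (u + v) \<le> q u + q v + e"
        using s t by (simp add: algebra_simps)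
    qed
  next
    fix c :: real and x assume c: "c > 0"
    have le: "q (c *\<^sub>R x) \<le> c * q x" if c: "c > 0" for c x
    proof (rule field_le_epsilon)
      fix e :: real assume "e > 0"
      obtain t where t: "t \<ge> 0" "m (x + t *\<^sub>R y) - t * m y < q x + e/c"
        using approx[of "e/c" x] \<open>e > 0\<close> c by auto
      have "q (c *\<^sub>R x) \<le> m (c *\<^sub>R (x + t *\<^sub>R y)) - (c * t) * m y"
        using low[of "c * t" "c *\<^sub>R x"] c t by (simp add: algebra_simps)
      also have "\<dots> = c * (m (x + t *\<^sub>R y) - t * m y)"
        using sublinearD(2)[OF m c, of "x + t *\<^sub>R y"] by (simp add: algebra_simps)
      also have "\<dots> \<le> c * (q x + e/c)"
        using t c by simp
      finally show "q (c *\<^sub>R x) \<le> c * q x + e"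
        using c by (simp add: algebra_simps)
    qed
    have "q x \<le> (1/c) * q (c *\<^sub>R x)"
      using le[of "1/c" "c *\<^sub>R x"] c by simp
    then show "q (c *\<^sub>R x) = c * q x"
      using le[OF c, of x] c by (simp add: field_simps)
  qed
  moreover have "q \<le> m"
    using low[of 0] by (auto simp: le_fun_def)
  ultimately have "q = m" by (rule min)
  then have "m x \<le> m (x + y) - m y"
    using low[of 1 x] by simp
  then show ?thesis
    using sublinearD(1)[OF m, of x y] by linarith
qed

text \<open>A minimal sublinear functional is additive, hence odd, hence linear.\<close>

theorem Hahn_Banach_sublinear:
  assumes "sublinear p"
  obtains h where "linear h" "\<And>x. h x \<le> p x"
proof -
  obtain m where m: "sublinear m" "m \<le> p" "\<And>q. sublinear q \<Longrightarrow> q \<le> m \<Longrightarrow> q = m"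
    using sublinear_minimal_exists[OF assms] by blast
  have add: "m (x + y) = m x + m y" for x y
    using sublinear_minimal_additive[OF m(1,3)] .
  have neg: "m (- x) = - m x" for x
    using add[of x "- x"] sublinearD(3)[OF m(1)] by simp
  have "linear m"
  proof (rule linearI)
    fix c x
    show "m (c *\<^sub>R x) = c *\<^sub>R m x"
    proof (cases c "0::real" rule: linorder_cases)
      case less
      then show ?thesis
        using sublinearD(2)[OF m(1), of "- c" x] neg[of "c *\<^sub>R x"] by simp
    qed (use sublinearD(2,3)[OF m(1)] in auto)
  qed (use add in auto)
  with m(2) show ?thesis
    using that by (auto simp: le_fun_def)
qed

lemma linear_le_norm_blinfun:
  fixes h :: "'a::real_normed_vector \<Rightarrow> real"
  assumes "linear h" "\<And>x. h x \<le> norm x"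
  obtains k :: "'a \<Rightarrow>\<^sub>L real" where "norm k \<le> 1" "\<And>x. blinfun_apply k x = h x"
proof -
  have *: "\<bar>h x\<bar> \<le> norm x" for x
    using assms(2)[of x] assms(2)[of "- x"] linear_neg[OF assms(1), of x] by simp
  have bl: "bounded_linear h"
    using assms(1) * by (intro linear_conv_bounded_linear[THEN iffD1] bounded_linear_intro[where K=1])
      (auto simp: linear_add linear_scale)
  show ?thesis
  proof
    show "blinfun_apply (Blinfun h) x = h x" for x
      using bl by (simp add: bounded_linear_Blinfun_apply)
    then show "norm (Blinfun h) \<le> 1"
      using * by (intro norm_blinfun_bound) auto
  qed
qed

text \<open>With \<open>r = infdist a B\<close>, the infimum of \<open>norm (x + s *\<^sub>R (a - b)) - s * r\<close> over \<open>s \<ge> 0\<close> and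
  \<open>b \<in> B\<close> is the largest sublinear functional below the norm with value at most \<open>- r\<close> at every
  \<open>b - a\<close>. Any linear functional below it separates; convexity of \<open>B\<close> makes it subadditive.\<close>

theorem separation_point_convex:
  fixes B :: "'a::real_normed_vector set"
  assumes "convex B" "B \<noteq> {}"
  obtains h :: "'a \<Rightarrow>\<^sub>L real" where "norm h \<le> 1" "\<And>b. b \<in> B \<Longrightarrow> blinfun_apply h b + infdist a B \<le> blinfun_apply h a"
proof -
  define r where "r = infdist a B"
  define A where "A = (\<lambda>x. {norm (x + s *\<^sub>R (a - b)) - s * r | s b. s \<ge> 0 \<and> b \<in> B})"
  define p where "p = (\<lambda>x. Inf (A x))"
  have r: "r \<le> norm (a - b)" if "b \<in> B" for b
    using infdist_le[OF that, of a] by (simp add: r_def dist_norm)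
  have lb: "- norm x \<le> z" if "z \<in> A x" for x z
  proof -
    obtain s b where sb: "s \<ge> 0" "b \<in> B" "z = norm (x + s *\<^sub>R (a - b)) - s * r"
      using \<open>z \<in> A x\<close> by (auto simp: A_def)
    have "s * r \<le> s * norm (a - b)"
      using r sb by (simp add: mult_left_mono)
    moreover have "s * norm (a - b) \<le> norm (x + s *\<^sub>R (a - b)) + norm x"
      using norm_triangle_ineq4[of "x + s *\<^sub>R (a - b)" x] sb(1) by simp
    ultimately show ?thesis using sb(3) by linarith
  qed
  have bdd: "bdd_below (A x)" for x using lb by (auto simp: bdd_below_def)
  have ne: "A x \<noteq> {}" for x using \<open>B \<noteq> {}\<close> by (auto simp: A_def)
  have low: "p x \<le> norm (x + s *\<^sub>R (a - b)) - s * r" if "s \<ge> 0" "b \<in> B" for x s b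
    unfolding p_def by (rule cInf_lower[OF _ bdd]) (use that in \<open>auto simp: A_def\<close>)
  have approx: "\<exists>s\<ge>0. \<exists>b\<in>B. norm (x + s *\<^sub>R (a - b)) - s * r < p x + e" if "e > 0" for x e
    using cInf_lessD[OF ne[of x], of "p x + e"] that by (fastforce simp: A_def p_def)
  have "sublinear p"
    unfolding sublinear_def
  proof (intro conjI allI impI)
    fix u v
    show "p (u + v) \<le> p u + p v"
    proof (rule field_le_epsilon)
      fix e :: real assume "e > 0"
      obtain s b where s: "s \<ge> 0" "b \<in> B" "norm (u + s *\<^sub>R (a - b)) - s * r < p u + e/2"
        using approx[of "e/2" u] \<open>e > 0\<close> by auto
      obtain t c where t: "t \<ge> 0" "c \<in> B" "norm (v + t *\<^sub>R (a - c)) - t * r < p v + e/2"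
        using approx[of "e/2" v] \<open>e > 0\<close> by auto
      obtain d where d: "d \<in> B" "(s + t) *\<^sub>R d = s *\<^sub>R b + t *\<^sub>R c"
      proof (cases "s + t = 0")
        case True
        then have "s = 0" "t = 0" using s t by auto
        then show ?thesis using that[of b] s by simp
      next
        case False
        then have "s + t > 0" using s t by auto
        then have "(s / (s+t)) *\<^sub>R b + (t / (s+t)) *\<^sub>R c \<in> B"
          using s t assms(1) by (intro convexD) (auto simp flip: add_divide_distrib)
        moreover have "(s + t) *\<^sub>R ((s / (s+t)) *\<^sub>R b + (t / (s+t)) *\<^sub>R c) = s *\<^sub>R b + t *\<^sub>R c"
          using \<open>s + t > 0\<close> by (simp add: scaleR_add_right)
        ultimately show ?thesis using that by blast
      qed
      have eq: "(u + v) + (s + t) *\<^sub>R (a - d) = (u + s *\<^sub>R (a - b)) + (v + t *\<^sub>R (a - c))"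
        using d(2) by (simp add: algebra_simps)
      have "p (u + v) \<le> norm ((u + v) + (s + t) *\<^sub>R (a - d)) - (s + t) * r"
        using low[OF _ d(1), of "s + t" "u + v"] s t by simp
      also have "\<dots> \<le> norm (u + s *\<^sub>R (a - b)) + norm (v + t *\<^sub>R (a - c)) - (s + t) * r"
        unfolding eq using norm_triangle_ineq by (intro diff_right_mono) blast
      finally show "p (u + v) \<le> p u + p v + e"
        using s t by (simp add: algebra_simps)
    qed
  next
    fix c :: real and x assume c: "c > 0"
    have le: "p (c *\<^sub>R x) \<le> c * p x" if c: "c > 0" for c x
    proof (rule field_le_epsilon)
      fix e :: real assume "e > 0"
      obtain s b where s: "s \<ge> 0" "b \<in> B" "norm (x + s *\<^sub>R (a - b)) - s * r < p x + e/c"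
        using approx[of "e/c" x] \<open>e > 0\<close> c by auto
      have "p (c *\<^sub>R x) \<le> norm (c *\<^sub>R (x + s *\<^sub>R (a - b))) - (c * s) * r"
        using low[of "c * s" b "c *\<^sub>R x"] c s by (simp add: algebra_simps)
      also have "\<dots> = c * (norm (x + s *\<^sub>R (a - b)) - s * r)"
        using c by (simp add: right_diff_distrib)
      also have "\<dots> \<le> c * (p x + e/c)"
        using s c by simp
      finally show "p (c *\<^sub>R x) \<le> c * p x + e"
        using c by (simp add: algebra_simps)
    qed
    have "p x \<le> (1/c) * p (c *\<^sub>R x)"
      using le[of "1/c" "c *\<^sub>R x"] c by simp
    then show "p (c *\<^sub>R x) = c * p x"
      using le[OF c, of x] c by (simp add: field_simps)
  qed
  then obtain h where h: "linear h" "\<And>x. h x \<le> p x"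
    using Hahn_Banach_sublinear by blast
  obtain b0 where b0: "b0 \<in> B" using \<open>B \<noteq> {}\<close> by blast
  have "h x \<le> norm x" for x
    using h(2)[of x] low[of 0 b0 x] b0 by simp
  then obtain k :: "'a \<Rightarrow>\<^sub>L real" where k: "norm k \<le> 1" "\<And>x. blinfun_apply k x = h x"
    using linear_le_norm_blinfun[OF h(1)] by blast
  have "blinfun_apply k b + infdist a B \<le> blinfun_apply k a" if "b \<in> B" for b
  proof -
    have "h (- (a - b)) \<le> - r"
      using h(2)[of "- (a - b)"] low[of 1 b "- (a - b)"] that by simp
    then show ?thesis
      using k(2) by (simp add: r_def linear_diff[OF h(1)])
  qed
  with k(1) show ?thesis using that by blast
qed

corollary norming_functional:
  fixes x :: "'a::real_normed_vector"
  obtains h :: "'a \<Rightarrow>\<^sub>L real" where "norm h \<le> 1" "blinfun_apply h x = norm x"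
proof -
  obtain h :: "'a \<Rightarrow>\<^sub>L real" where h: "norm h \<le> 1" "\<And>b. b \<in> {0} \<Longrightarrow> blinfun_apply h b + infdist x {0} \<le> blinfun_apply h x"
    using separation_point_convex[of "{0}" x] by auto
  have "norm x \<le> blinfun_apply h x"
    using h(2)[of 0] by (simp add: blinfun.zero_right)
  moreover have "blinfun_apply h x \<le> norm x"
    using norm_blinfun[of h x] h(1) mult_right_mono[OF h(1) norm_ge_zero[of x]] by simp
  ultimately show ?thesis using that h(1) by fastforce
qed

lemma blinfun_le_norm:
  fixes h :: "'a::real_normed_vector \<Rightarrow>\<^sub>L real"
  assumes "norm h \<le> 1"
  shows "\<bar>blinfun_apply h x\<bar> \<le> norm x"
  using norm_blinfun[of h x] mult_right_mono[OF assms norm_ge_zero[of x]] by simp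

text \<open>Uniform boundedness by Sokal's gliding hump in the complete dual space. Take points of norm at least
  \<open>4 ^ n\<close>. At the \<open>n\<close>-th point one can change a functional by \<open>(1/3) ^ n\<close> in norm so that its value there
  becomes at least \<open>(1/3) ^ n\<close> times the norm of the point; all later changes together spoil at most half of
  this. The limit functional is unbounded on the points.\<close>

theorem weakly_bounded_imp_bounded:
  fixes K :: "'a::real_normed_vector set"
  assumes wb: "\<And>h :: 'a \<Rightarrow>\<^sub>L real. bounded (blinfun_apply h ` K)"
  shows "bounded K"
proof (rule ccontr)
  assume nb: "\<not> bounded K"
  have ex: "\<exists>x\<in>K. norm x \<ge> 4 ^ n" for n :: nat
    using nb by (auto simp: bounded_iff not_le) (meson less_imp_le)
  obtain x where x: "\<And>n. x n \<in> K" "\<And>n. norm (x n) \<ge> 4 ^ n"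
    using ex by metis
  have step: "\<exists>k. norm (k - h) \<le> (1/3) ^ n \<and> \<bar>blinfun_apply k (x n)\<bar> \<ge> (1/3) ^ n * norm (x n)"
    for h :: "'a \<Rightarrow>\<^sub>L real" and n
  proof -
    obtain g :: "'a \<Rightarrow>\<^sub>L real" where g: "norm g \<le> 1" "blinfun_apply g (x n) = norm (x n)"
      using norming_functional by blast
    \<comment> \<open>The sign prevents cancellation between the two functionals at \<open>x n\<close>.\<close>
    define c :: real where "c = (if blinfun_apply h (x n) \<ge> 0 then 1 else -1)"
    have "norm ((h + (c * (1/3) ^ n) *\<^sub>R g) - h) \<le> (1/3) ^ n"
      using g(1) by (auto simp: c_def power_abs intro: mult_left_le)
    moreover have "\<bar>blinfun_apply (h + (c * (1/3) ^ n) *\<^sub>R g) (x n)\<bar> \<ge> (1/3) ^ n * norm (x n)"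
      using g(2) by (auto simp: c_def blinfun.add_left blinfun.scaleR_left)
    ultimately show ?thesis by blast
  qed
  have "\<exists>h :: nat \<Rightarrow> 'a \<Rightarrow>\<^sub>L real. \<forall>n. norm (h (Suc n) - h n) \<le> (1/3) ^ n \<and>
      \<bar>blinfun_apply (h (Suc n)) (x n)\<bar> \<ge> (1/3) ^ n * norm (x n)"
    using step by (intro dependent_nat_choice[where P="\<lambda>_ _. True", simplified]) auto
  then obtain h :: "nat \<Rightarrow> 'a \<Rightarrow>\<^sub>L real" where
    h: "\<And>n. norm (h (Suc n) - h n) \<le> (1/3) ^ n"
       "\<And>n. \<bar>blinfun_apply (h (Suc n)) (x n)\<bar> \<ge> (1/3) ^ n * norm (x n)"
    by blast
  have summ: "summable (\<lambda>n. h (Suc n) - h n)"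
    by (rule summable_comparison_test'[where g="\<lambda>n. (1/3) ^ n" and N=0])
      (use h(1) in \<open>auto intro: summable_geometric\<close>)
  define g where "g = h 0 + (\<Sum>n. h (Suc n) - h n)"
  have tail: "norm (g - h (Suc n)) \<le> (1/2) * (1/3) ^ n" for n
  proof -
    have "h (Suc n) = h 0 + (\<Sum>i<Suc n. h (Suc i) - h i)"
      by (subst sum_lessThan_telescope) simp
    then have "g - h (Suc n) = (\<Sum>i. h (Suc (i + Suc n)) - h (i + Suc n))"
      unfolding g_def using suminf_split_initial_segment[OF summ, of "Suc n"] by simp
    also have "norm \<dots> \<le> (\<Sum>i. (1/3) ^ (i + Suc n))"
    proof (rule norm_suminf_le)
      show "summable (\<lambda>i. (1/3 :: real) ^ (i + Suc n))"
        using summable_ignore_initial_segment[OF summable_geometric[of "1/3 :: real"], of "Suc n"] by simp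
    qed (rule h(1))
    also have "\<dots> = (1/3) ^ Suc n * (\<Sum>i. (1/3) ^ i)"
      by (subst suminf_mult[symmetric]) (auto simp: power_add mult_ac intro: summable_geometric)
    also have "\<dots> = (1/2) * (1/3) ^ n"
      by (subst suminf_geometric) auto
    finally show ?thesis .
  qed
  have big: "\<bar>blinfun_apply g (x n)\<bar> \<ge> (1/2) * (4/3) ^ n" for n
  proof -
    have "\<bar>blinfun_apply (g - h (Suc n)) (x n)\<bar> \<le> (1/2) * (1/3) ^ n * norm (x n)"
      using norm_blinfun[of "g - h (Suc n)" "x n"] mult_right_mono[OF tail[of n] norm_ge_zero[of "x n"]]
      by simp
    then have "\<bar>blinfun_apply g (x n)\<bar> \<ge> (1/2) * ((1/3) ^ n * norm (x n))"
      using h(2)[of n] unfolding blinfun.diff_left by linarith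
    moreover have "(1/3) ^ n * norm (x n) \<ge> (4/3) ^ n"
      using mult_left_mono[OF x(2)[of n], of "(1/3) ^ n"] by (simp add: power_divide)
    ultimately show ?thesis by linarith
  qed
  obtain M where M: "\<And>y. y \<in> K \<Longrightarrow> \<bar>blinfun_apply g y\<bar> \<le> M"
    using wb[of g] by (auto simp: bounded_iff)
  obtain n where "2 * M < (4/3 :: real) ^ n"
    using real_arch_pow[of "4/3" "2 * M"] by auto
  then show False
    using big[of n] M[OF x(1)[of n]] by linarith
qed

section \<open>Convex weakly compact sets\<close>

lemma topspace_weak_topology [simp]: "topspace weak_topology = (UNIV :: 'a::real_normed_vector set)"
proof -
  have "(UNIV :: 'a set) \<in> {blinfun_apply h -` U | (h :: 'a \<Rightarrow>\<^sub>L real) U. open U}"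
    by (auto intro!: exI[of _ 0] exI[of _ UNIV])
  then show ?thesis
    unfolding weak_topology_def topology_generated_by_topspace by blast
qed

lemma continuous_map_weak_topology_iff:
  "continuous_map T weak_topology f \<longleftrightarrow>
     (\<forall>h :: 'a::real_normed_vector \<Rightarrow>\<^sub>L real. continuous_map T euclideanreal (\<lambda>x. blinfun_apply h (f x)))"
  (is "?L \<longleftrightarrow> ?R")
proof -
  have U: "\<Union>{blinfun_apply h -` U | (h :: 'a \<Rightarrow>\<^sub>L real) U. open U} = UNIV"
    using topspace_weak_topology unfolding weak_topology_def topology_generated_by_topspace .
  have eq: "f -` (blinfun_apply h -` U) \<inter> topspace T = {x \<in> topspace T. blinfun_apply h (f x) \<in> U}" for h :: "'a \<Rightarrow>\<^sub>L real" and U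
    by auto
  have "?L \<longleftrightarrow> (\<forall>W\<in>{blinfun_apply h -` U | (h :: 'a \<Rightarrow>\<^sub>L real) U. open U}. openin T (f -` W \<inter> topspace T))"
    unfolding weak_topology_def continuous_on_generated_topo_iff U by (simp add: Ball_def)
  also have "\<dots> \<longleftrightarrow> (\<forall>(h :: 'a \<Rightarrow>\<^sub>L real) U. open U \<longrightarrow> openin T {x \<in> topspace T. blinfun_apply h (f x) \<in> U})"
    unfolding eq[symmetric] by blast
  also have "\<dots> \<longleftrightarrow> ?R"
    by (auto simp: continuous_map_def)
  finally show ?thesis .
qed

lemma continuous_map_blinfun_weak_topology:
  "continuous_map weak_topology euclideanreal (blinfun_apply (h :: 'a::real_normed_vector \<Rightarrow>\<^sub>L real))"
  using continuous_map_weak_topology_iff[of weak_topology "\<lambda>x::'a. x"] by simp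

lemma Hausdorff_space_weak_topology: "Hausdorff_space (weak_topology :: 'a::real_normed_vector topology)"
  unfolding Hausdorff_space_def
proof (intro allI impI)
  fix x y :: 'a assume xy: "x \<in> topspace weak_topology \<and> y \<in> topspace weak_topology \<and> x \<noteq> y"
  obtain h :: "'a \<Rightarrow>\<^sub>L real" where h: "blinfun_apply h (x - y) = norm (x - y)"
    using norming_functional by blast
  then have "blinfun_apply h x \<noteq> blinfun_apply h y"
    using xy by (auto simp: blinfun.diff_right)
  from hausdorff[OF this] obtain U V where
    UV: "open U" "open V" "blinfun_apply h x \<in> U" "blinfun_apply h y \<in> V" "U \<inter> V = {}"
    by auto
  have op: "openin weak_topology {x \<in> topspace weak_topology. blinfun_apply h x \<in> W}" if "open W" for W
    using openin_continuous_map_preimage[OF continuous_map_blinfun_weak_topology[of h], of W] that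
    by simp
  show "\<exists>U V. openin weak_topology U \<and> openin weak_topology V \<and> x \<in> U \<and> y \<in> V \<and> disjnt U V"
    by (intro exI conjI) (rule op[OF UV(1)], rule op[OF UV(2)], use UV(3-5) in \<open>auto simp: disjnt_def\<close>)
qed

lemma openin_weak_topology_imp_open:
  assumes "openin weak_topology (U :: 'a::real_normed_vector set)"
  shows "open U"
proof -
  have "continuous_map euclidean weak_topology (\<lambda>x::'a. x)"
    unfolding continuous_map_weak_topology_iff
    by (auto intro!: continuous_intros blinfun.continuous_on)
  from openin_continuous_map_preimage[OF this assms] show ?thesis by simp
qed

lemma closedin_weak_topology_imp_closed:
  assumes "closedin weak_topology (K :: 'a::real_normed_vector set)"
  shows "closed K"
  using assms openin_weak_topology_imp_open[of "UNIV - K"]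
  unfolding closedin_def closed_def Compl_eq_Diff_UNIV by simp

lemma cwk_closedin_weak_topology:
  assumes "K \<in> cwk"
  shows "closedin weak_topology K"
  using assms compactin_imp_closedin[OF Hausdorff_space_weak_topology] by (auto simp: cwk_def)

lemma cwk_closed:
  assumes "K \<in> cwk"
  shows "closed K"
  using assms cwk_closedin_weak_topology closedin_weak_topology_imp_closed by blast

text \<open>Continuous functionals have compact, hence bounded, image.\<close>

lemma cwk_bounded:
  assumes "K \<in> cwk"
  shows "bounded K"
proof (rule weakly_bounded_imp_bounded)
  fix h :: "'a \<Rightarrow>\<^sub>L real"
  have "compactin euclideanreal (blinfun_apply h ` K)"
    using assms image_compactin[OF _ continuous_map_blinfun_weak_topology] by (auto simp: cwk_def)
  then show "bounded (blinfun_apply h ` K)"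
    by (simp add: compact_imp_bounded)
qed

lemma cwk_convex: "K \<in> cwk \<Longrightarrow> convex K" and cwk_nonempty: "K \<in> cwk \<Longrightarrow> K \<noteq> {}"
  by (auto simp: cwk_def)

lemma set_plus_singleton: "K + {x} = (\<lambda>y. y + x) ` (K :: 'a::plus set)"
  by (auto simp: set_plus_def)

lemma cwk_plus_singleton:
  fixes K :: "'a::real_normed_vector set"
  assumes "K \<in> cwk"
  shows "K + {x} \<in> cwk"
proof -
  have "continuous_map weak_topology weak_topology (\<lambda>y::'a. y + x)"
    unfolding continuous_map_weak_topology_iff
    by (auto simp: blinfun.add_right intro!: continuous_intros continuous_map_blinfun_weak_topology)
  moreover have "convex (K + {x})"
    using convex_set_plus[OF cwk_convex[OF assms], of "{x}"] by simp
  ultimately show ?thesis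
    using assms image_compactin[of weak_topology K weak_topology "\<lambda>y. y + x"]
    by (simp add: cwk_def set_plus_singleton)
qed

lemma cwk_scale:
  fixes K :: "'a::real_normed_vector set"
  assumes "K \<in> cwk"
  shows "c *\<^sub>S K \<in> cwk"
proof -
  have "continuous_map weak_topology weak_topology (\<lambda>y::'a. c *\<^sub>R y)"
    unfolding continuous_map_weak_topology_iff
    by (auto simp: blinfun.scaleR_right intro!: continuous_intros continuous_map_blinfun_weak_topology)
  then show ?thesis
    using assms image_compactin[of weak_topology K weak_topology "\<lambda>y. c *\<^sub>R y"]
    by (simp add: cwk_def convex_scaling)
qed

section \<open>Support functions and the Hausdorff distance\<close>

text \<open>On these sets support functions are finite, and by separation they determine the set up to closure.\<close>

definition convex_bounded :: "'a::real_normed_vector set set" where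
  "convex_bounded = {K. K \<noteq> {} \<and> convex K \<and> bounded K}"

definition support :: "('a::real_normed_vector \<Rightarrow>\<^sub>L real) \<Rightarrow> 'a set \<Rightarrow> real" where
  "support h K = (SUP x\<in>K. blinfun_apply h x)"

lemma cwk_convex_bounded: "K \<in> cwk \<Longrightarrow> K \<in> convex_bounded"
  by (simp add: convex_bounded_def cwk_convex cwk_bounded cwk_nonempty)

lemma convex_bounded_singleton [simp]: "{x} \<in> convex_bounded"
  by (simp add: convex_bounded_def)

lemma convex_bounded_plus:
  assumes "K \<in> convex_bounded" "L \<in> convex_bounded"
  shows "K + L \<in> convex_bounded"
proof -
  have "K + L = (\<Union>x\<in>K. \<Union>y\<in>L. {x + y})" by (auto simp: set_plus_def)
  then have "bounded (K + L)" "K + L \<noteq> {}" using assms bounded_sums by (auto simp: convex_bounded_def)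
  moreover have "convex (K + L)" using assms by (auto simp: convex_bounded_def intro: convex_set_plus)
  ultimately show ?thesis by (auto simp: convex_bounded_def)
qed

lemma convex_bounded_scale: "K \<in> convex_bounded \<Longrightarrow> c *\<^sub>S K \<in> convex_bounded"
  by (auto simp: convex_bounded_def intro: convex_scaling bounded_scaling)

lemma convex_bounded_sum: "(\<And>i. i \<in> F \<Longrightarrow> K i \<in> convex_bounded) \<Longrightarrow> (\<Sum>i\<in>F. K i) \<in> convex_bounded"
  by (induction F rule: infinite_finite_induct) (auto simp: convex_bounded_plus set_zero)

lemma support_bdd_above: "bounded K \<Longrightarrow> bdd_above (blinfun_apply (h :: _ \<Rightarrow>\<^sub>L real) ` K)"
  by (intro bounded_imp_bdd_above bounded_linear_image blinfun.bounded_linear_right)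

lemma le_support: "bounded K \<Longrightarrow> x \<in> K \<Longrightarrow> blinfun_apply h x \<le> support h K"
  unfolding support_def by (rule cSUP_upper[OF _ support_bdd_above])

lemma support_le: "K \<noteq> {} \<Longrightarrow> (\<And>x. x \<in> K \<Longrightarrow> blinfun_apply h x \<le> c) \<Longrightarrow> support h K \<le> c"
  unfolding support_def by (rule cSUP_least)

lemma support_singleton [simp]: "support h {x} = blinfun_apply h x"
  by (simp add: support_def)

lemma support_plus:
  assumes "K \<in> convex_bounded" "L \<in> convex_bounded"
  shows "support h (K + L) = support h K + support h L"
proof (rule antisym)
  have *: "K \<noteq> {}" "L \<noteq> {}" "bounded K" "bounded L" "bounded (K + L)" "K + L \<noteq> {}"
    using assms convex_bounded_plus[OF assms] by (auto simp: convex_bounded_def)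
  show "support h (K + L) \<le> support h K + support h L"
    using * by (intro support_le) (auto simp: blinfun.add_right elim!: set_plus_elim intro!: add_mono le_support)
  have "support h K \<le> support h (K + L) - support h L"
  proof (rule support_le)
    fix x assume x: "x \<in> K"
    have "support h L \<le> support h (K + L) - blinfun_apply h x"
    proof (rule support_le)
      fix y assume y: "y \<in> L"
      show "blinfun_apply h y \<le> support h (K + L) - blinfun_apply h x"
        using le_support[OF *(5) set_plus_intro[OF x y], of h] by (simp add: blinfun.add_right)
    qed (use * in auto)
    then show "blinfun_apply h x \<le> support h (K + L) - support h L" by simp
  qed (use * in auto)
  then show "support h K + support h L \<le> support h (K + L)" by simp
qed

lemma support_scale:
  assumes "K \<in> convex_bounded" "c \<ge> 0"
  shows "support h (c *\<^sub>S K) = c * support h K"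
proof -
  have ne: "K \<noteq> {}" and bd: "bounded K" "bounded (c *\<^sub>S K)"
    using assms(1) convex_bounded_scale[OF assms(1), of c] by (auto simp: convex_bounded_def)
  have le: "support h (c *\<^sub>S K) \<le> c * support h K"
    using ne by (intro support_le) (auto simp: blinfun.scaleR_right assms(2) le_support bd intro!: mult_left_mono)
  show ?thesis
  proof (cases "c = 0")
    case True
    then have "c *\<^sub>S K = {0}" using ne by auto
    then show ?thesis using True by (simp add: blinfun.zero_right)
  next
    case False
    then have "c > 0" using assms(2) by simp
    have "support h K \<le> support h (c *\<^sub>S K) / c"
    proof (rule support_le[OF ne])
      fix x assume "x \<in> K"
      then have "blinfun_apply h (c *\<^sub>R x) \<le> support h (c *\<^sub>S K)"
        by (intro le_support[OF bd(2)]) auto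
      then show "blinfun_apply h x \<le> support h (c *\<^sub>S K) / c"
        using \<open>c > 0\<close> by (simp add: blinfun.scaleR_right field_simps)
    qed
    with le show ?thesis using \<open>c > 0\<close> by (simp add: field_simps)
  qed
qed

lemma support_sum:
  assumes "\<And>i. i \<in> F \<Longrightarrow> K i \<in> convex_bounded"
  shows "support h (\<Sum>i\<in>F. K i) = (\<Sum>i\<in>F. support h (K i))"
  using assms by (induction F rule: infinite_finite_induct) (auto simp: support_plus convex_bounded_sum set_zero blinfun.zero_right)

lemma bdd_above_infdist:
  assumes "bounded K" "L \<noteq> {}"
  shows "bdd_above ((\<lambda>x. infdist x L) ` K)"
proof -
  obtain y where y: "y \<in> L" using assms by blast
  obtain M where "\<And>x. x \<in> K \<Longrightarrow> dist y x \<le> M" using assms(1) by (auto simp: bounded_any_center[where a=y])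
  then show ?thesis
    using infdist_le[OF y] by (auto simp: bdd_above_def dist_commute intro!: exI[of _ M] intro: order_trans)
qed

lemma infdist_le_hausdorff:
  assumes "bounded K" "L \<noteq> {}" "x \<in> K"
  shows "infdist x L \<le> hausdorff_distance K L"
  using cSUP_upper[OF assms(3) bdd_above_infdist[OF assms(1,2)]]
  by (simp add: hausdorff_distance_def)

lemma hausdorff_commute: "hausdorff_distance K L = hausdorff_distance L K"
  by (simp add: hausdorff_distance_def max.commute)

lemma hausdorff_le:
  assumes "K \<noteq> {}" "L \<noteq> {}"
    and "\<And>x. x \<in> K \<Longrightarrow> infdist x L \<le> c" "\<And>y. y \<in> L \<Longrightarrow> infdist y K \<le> c"
  shows "hausdorff_distance K L \<le> c"
  unfolding hausdorff_distance_def using assms by (auto intro!: cSUP_least)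

lemma hausdorff_nonneg:
  assumes "bounded K" "K \<noteq> {}" "L \<noteq> {}"
  shows "0 \<le> hausdorff_distance K L"
proof -
  obtain x where "x \<in> K" using assms by blast
  then show ?thesis
    using infdist_le_hausdorff[OF assms(1,3)] infdist_nonneg[of x L] by fastforce
qed

lemma support_le_support_plus_hausdorff:
  assumes "K \<in> convex_bounded" "L \<in> convex_bounded" "norm h \<le> 1"
  shows "support h K \<le> support h L + hausdorff_distance K L"
proof (rule support_le)
  fix x assume x: "x \<in> K"
  have ne: "K \<noteq> {}" "L \<noteq> {}" "bounded K" "bounded L" using assms by (auto simp: convex_bounded_def)
  have "blinfun_apply h x - support h L \<le> dist x y" if "y \<in> L" for y
    using blinfun_le_norm[OF assms(3), of "x - y"] le_support[OF ne(4) that, of h]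
    by (simp add: blinfun.diff_right dist_norm)
  then have "blinfun_apply h x - support h L \<le> infdist x L"
    using ne by (auto simp: infdist_def intro!: cINF_greatest)
  then show "blinfun_apply h x \<le> support h L + hausdorff_distance K L"
    using infdist_le_hausdorff[OF ne(3,2) x] by linarith
qed (use assms in \<open>auto simp: convex_bounded_def\<close>)

lemma abs_support_diff_le_hausdorff:
  assumes "K \<in> convex_bounded" "L \<in> convex_bounded" "norm h \<le> 1"
  shows "\<bar>support h K - support h L\<bar> \<le> hausdorff_distance K L"
  using support_le_support_plus_hausdorff[OF assms]
    support_le_support_plus_hausdorff[OF assms(2,1,3)] hausdorff_commute[of K L] by linarith

text \<open>The functional that separates \<open>x\<close> from \<open>L\<close> sees the full distance \<open>infdist x L\<close>. Together with
  \<open>abs_support_diff_le_hausdorff\<close> this identifies the Hausdorff distance with the uniform distance of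
  support functions, from which its behaviour under sums and multiples is read off.\<close>

lemma hausdorff_le_supportI:
  assumes KL: "K \<in> convex_bounded" "L \<in> convex_bounded"
    and le: "\<And>h. norm h \<le> 1 \<Longrightarrow> \<bar>support h K - support h L\<bar> \<le> c"
  shows "hausdorff_distance K L \<le> c"
proof (rule hausdorff_le)
  have *: "infdist x L \<le> c" if K: "K \<in> convex_bounded" and L: "L \<in> convex_bounded"
    and le: "\<And>h. norm h \<le> 1 \<Longrightarrow> \<bar>support h K - support h L\<bar> \<le> c" and "x \<in> K" for x and K L :: "'a set"
  proof -
    have "convex L" "L \<noteq> {}" using L by (auto simp: convex_bounded_def)
    then obtain h :: "'a \<Rightarrow>\<^sub>L real" where h: "norm h \<le> 1"
      "\<And>b. b \<in> L \<Longrightarrow> blinfun_apply h b + infdist x L \<le> blinfun_apply h x"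
      using separation_point_convex[of L x] by blast
    have "support h L \<le> blinfun_apply h x - infdist x L"
      using h(2) \<open>L \<noteq> {}\<close> by (intro support_le) (auto simp: algebra_simps)
    also have "\<dots> \<le> support h K - infdist x L"
      using le_support[of K x h] K \<open>x \<in> K\<close> by (simp add: convex_bounded_def)
    finally show ?thesis using le[OF h(1)] by linarith
  qed
  show "infdist x L \<le> c" if "x \<in> K" for x
    using *[OF KL le that] .
  show "infdist x K \<le> c" if "x \<in> L" for x
    using *[OF KL(2,1) _ that] le by (simp add: abs_minus_commute)
qed (use KL in \<open>auto simp: convex_bounded_def\<close>)

lemma hausdorff_triangle:
  assumes "A \<in> convex_bounded" "B \<in> convex_bounded" "C \<in> convex_bounded"
  shows "hausdorff_distance A C \<le> hausdorff_distance A B + hausdorff_distance B C"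
proof (rule hausdorff_le_supportI[OF assms(1,3)])
  fix h :: "'a \<Rightarrow>\<^sub>L real" assume h: "norm h \<le> 1"
  show "\<bar>support h A - support h C\<bar> \<le> hausdorff_distance A B + hausdorff_distance B C"
    using abs_support_diff_le_hausdorff[OF assms(1,2) h] abs_support_diff_le_hausdorff[OF assms(2,3) h]
    by linarith
qed

lemma hausdorff_plus_le:
  assumes "A \<in> convex_bounded" "B \<in> convex_bounded" "C \<in> convex_bounded" "D \<in> convex_bounded"
  shows "hausdorff_distance (A + B) (C + D) \<le> hausdorff_distance A C + hausdorff_distance B D"
proof (rule hausdorff_le_supportI)
  fix h :: "'a \<Rightarrow>\<^sub>L real" assume h: "norm h \<le> 1"
  show "\<bar>support h (A + B) - support h (C + D)\<bar> \<le> hausdorff_distance A C + hausdorff_distance B D"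
    using abs_support_diff_le_hausdorff[OF assms(1,3) h] abs_support_diff_le_hausdorff[OF assms(2,4) h]
    by (simp add: support_plus assms)
qed (use assms convex_bounded_plus in auto)

lemma hausdorff_scale_le:
  assumes "A \<in> convex_bounded" "B \<in> convex_bounded" "c \<ge> 0"
  shows "hausdorff_distance (c *\<^sub>S A) (c *\<^sub>S B) \<le> c * hausdorff_distance A B"
proof (rule hausdorff_le_supportI)
  fix h :: "'a \<Rightarrow>\<^sub>L real" assume h: "norm h \<le> 1"
  show "\<bar>support h (c *\<^sub>S A) - support h (c *\<^sub>S B)\<bar> \<le> c * hausdorff_distance A B"
    using mult_left_mono[OF abs_support_diff_le_hausdorff[OF assms(1,2) h] assms(3)] assms(3)
    by (simp add: support_scale assms abs_mult flip: right_diff_distrib)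
qed (use assms convex_bounded_scale in auto)

lemma hausdorff_singleton [simp]: "hausdorff_distance {x} {y} = dist x y"
  by (simp add: hausdorff_distance_def dist_commute)

lemma hausdorff_zero_le_supportI:
  assumes "K \<in> convex_bounded" "\<And>h. norm h \<le> 1 \<Longrightarrow> \<bar>support h K\<bar> \<le> c"
  shows "hausdorff_distance K {0} \<le> c"
  using assms by (intro hausdorff_le_supportI) auto

lemma norm_le_hausdorff_zero:
  assumes "bounded K" "x \<in> K"
  shows "norm x \<le> hausdorff_distance K {0}"
  using infdist_le_hausdorff[OF assms(1) _ assms(2), of "{0}"] by simp

section \<open>Unconditional sums of convex weakly compact sets\<close>

lemma summable_on_Cauchy_banach:
  fixes x :: "'i \<Rightarrow> 'a::banach"
  assumes "\<And>e. e > 0 \<Longrightarrow> \<exists>F0. finite F0 \<and> F0 \<subseteq> N \<and> (\<forall>F. finite F \<and> F \<subseteq> N - F0 \<longrightarrow> norm (\<Sum>i\<in>F. x i) \<le> e)"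
  shows "x summable_on N"
proof -
  have "\<exists>P. eventually P (finite_subsets_at_top N) \<and>
            (\<forall>F F'. P F \<and> P F' \<longrightarrow> dist (sum x F) (sum x F') < e)" if "e > 0" for e
  proof -
    obtain F0 where F0: "finite F0" "F0 \<subseteq> N" "\<And>F. finite F \<Longrightarrow> F \<subseteq> N - F0 \<Longrightarrow> norm (\<Sum>i\<in>F. x i) \<le> e/3"
      using assms[of "e/3"] \<open>e > 0\<close> by (metis divide_pos_pos zero_less_numeral)
    define P where "P = (\<lambda>F. finite F \<and> F0 \<subseteq> F \<and> F \<subseteq> N)"
    have ev: "eventually P (finite_subsets_at_top N)"
      unfolding P_def eventually_finite_subsets_at_top using F0(1,2) by blast
    have near: "dist (sum x F) (sum x F0) \<le> e/3" if "P F" for F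
    proof -
      have "sum x F - sum x F0 = sum x (F - F0)"
        using that by (subst sum_diff) (auto simp: P_def)
      then show ?thesis
        using F0(3)[of "F - F0"] that by (auto simp: P_def dist_norm)
    qed
    have "dist (sum x F) (sum x F') < e" if "P F" "P F'" for F F'
      using near[OF that(1)] near[OF that(2)] dist_triangle2[of "sum x F" "sum x F'" "sum x F0"] \<open>e > 0\<close>
      by linarith
    with ev show ?thesis by blast
  qed
  then have "cauchy_filter (filtermap (sum x) (finite_subsets_at_top N))"
    by (simp add: cauchy_filter_metric_filtermap)
  then obtain S where "filtermap (sum x) (finite_subsets_at_top N) \<le> nhds S"
    using cauchy_filter_complete_converges[of "filtermap (sum x) (finite_subsets_at_top N)" UNIV]
    by (auto simp: complete_UNIV filtermap_bot_iff)
  then have "(sum x \<longlongrightarrow> S) (finite_subsets_at_top N)"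
    by (simp add: filterlim_def)
  then show ?thesis
    by (auto simp: summable_on_def has_sum_def)
qed

lemma sum_in_set_sum:
  assumes "\<And>i. i \<in> F \<Longrightarrow> x i \<in> (K i :: 'a::comm_monoid_add set)"
  shows "(\<Sum>i\<in>F. x i) \<in> (\<Sum>i\<in>F. K i)"
  using assms by (induction F rule: infinite_finite_induct) (simp_all add: set_plus_intro)

lemma set_sum_witness:
  assumes "finite F" "y \<in> (\<Sum>i\<in>F. K i :: 'a::comm_monoid_add set)"
  obtains x where "\<And>i. i \<in> F \<Longrightarrow> x i \<in> K i" "y = (\<Sum>i\<in>F. x i)"
  using assms(2) unfolding set_sum_alt[OF assms(1)] by auto

text \<open>The sum is the image of the product of the sets under \<open>x \<mapsto> infsum x N\<close>. The tail
  condition makes the partial sums converge uniformly on the product, so the map is continuous into the weak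
  topology, and the product is compact by Tychonoff's theorem. As the sets contain 0, choices over a
  finite index set extend to the whole product, so every element of a partial sum is close to one of the sum.\<close>

theorem cwk_unconditional_sum:
  fixes K :: "'i \<Rightarrow> 'a::banach set"
  assumes K: "\<And>i. i \<in> N \<Longrightarrow> K i \<in> cwk" and zero: "\<And>i. i \<in> N \<Longrightarrow> 0 \<in> K i"
    and tail: "\<And>e. e > 0 \<Longrightarrow> \<exists>F0. finite F0 \<and> F0 \<subseteq> N \<and>
       (\<forall>F. finite F \<and> F \<subseteq> N - F0 \<longrightarrow> hausdorff_distance (\<Sum>i\<in>F. K i) {0} \<le> e)"
  obtains S where "S \<in> cwk" "hausdorff_has_sum K N S"
proof
  define X where "X = PiE N K"
  define \<sigma> where "\<sigma> = (\<lambda>x :: 'i \<Rightarrow> 'a. infsum x N)"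
  define T where "T = product_topology (\<lambda>_. weak_topology :: 'a topology) N"
  let ?S = "\<sigma> ` X"
  have convex_bounded: "(\<Sum>i\<in>F. K i) \<in> convex_bounded" if "F \<subseteq> N" for F
    by (rule convex_bounded_sum, rule cwk_convex_bounded, rule K) (use that in blast)
  have small: "\<exists>F0. finite F0 \<and> F0 \<subseteq> N \<and> (\<forall>F. finite F \<and> F \<subseteq> N - F0 \<longrightarrow>
      (\<forall>x\<in>X. norm (\<Sum>i\<in>F. x i) \<le> e))" if e: "e > 0" for e
  proof -
    obtain F0 where F0: "finite F0" "F0 \<subseteq> N" "\<And>F. finite F \<Longrightarrow> F \<subseteq> N - F0 \<Longrightarrow> hausdorff_distance (\<Sum>i\<in>F. K i) {0} \<le> e"
      using tail[OF e] by metis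
    have "norm (\<Sum>i\<in>F. x i) \<le> e" if F: "finite F" "F \<subseteq> N - F0" and x: "x \<in> X" for F x
    proof -
      have "(\<Sum>i\<in>F. x i) \<in> (\<Sum>i\<in>F. K i)"
        using x F by (intro sum_in_set_sum) (auto simp: X_def PiE_iff)
      moreover have "bounded (\<Sum>i\<in>F. K i)"
        using convex_bounded[of F] F by (auto simp: convex_bounded_def)
      ultimately have "norm (\<Sum>i\<in>F. x i) \<le> hausdorff_distance (\<Sum>i\<in>F. K i) {0}"
        by (intro norm_le_hausdorff_zero)
      then show ?thesis
        using F0(3)[OF F] by linarith
    qed
    with F0(1,2) show ?thesis by metis
  qed
  have summ: "x summable_on N" if "x \<in> X" for x
  proof (rule summable_on_Cauchy_banach)
    fix e :: real assume "e > 0"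
    from small[OF this] that
    show "\<exists>F0. finite F0 \<and> F0 \<subseteq> N \<and> (\<forall>F. finite F \<and> F \<subseteq> N - F0 \<longrightarrow> norm (\<Sum>i\<in>F. x i) \<le> e)"
      by metis
  qed
  have near: "\<exists>F0. finite F0 \<and> F0 \<subseteq> N \<and> (\<forall>F. finite F \<and> F0 \<subseteq> F \<and> F \<subseteq> N \<longrightarrow>
      (\<forall>x\<in>X. norm ((\<Sum>i\<in>F. x i) - \<sigma> x) \<le> e))" if e: "e > 0" for e
  proof -
    obtain F0 where F0: "finite F0" "F0 \<subseteq> N"
      "\<And>F x. finite F \<Longrightarrow> F \<subseteq> N - F0 \<Longrightarrow> x \<in> X \<Longrightarrow> norm (\<Sum>i\<in>F. x i) \<le> e"
      using small[OF e] by metis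
    have "norm ((\<Sum>i\<in>F. x i) - \<sigma> x) \<le> e" if F: "finite F" "F0 \<subseteq> F" "F \<subseteq> N" and x: "x \<in> X" for F x
    proof -
      have lim: "(sum x \<longlongrightarrow> \<sigma> x) (finite_subsets_at_top N)"
        using summ[OF x] by (simp add: \<sigma>_def has_sum_infsum flip: has_sum_def)
      have lim': "((\<lambda>F'. norm (sum x F - sum x F')) \<longlongrightarrow> norm (sum x F - \<sigma> x)) (finite_subsets_at_top N)"
        by (intro tendsto_intros lim)
      have "\<forall>\<^sub>F F' in finite_subsets_at_top N. norm (sum x F - sum x F') \<le> e"
        unfolding eventually_finite_subsets_at_top
      proof (intro exI conjI allI impI)
        fix F' assume F': "finite F' \<and> F \<subseteq> F' \<and> F' \<subseteq> N"
        have "sum x F' - sum x F = sum x (F' - F)"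
          using F' F by (subst sum_diff) auto
        then show "norm (sum x F - sum x F') \<le> e"
          using F0(3)[of "F' - F" x] F F' x by (subst norm_minus_commute) auto
      qed (use F in auto)
      then show ?thesis
        using tendsto_upperbound[OF lim'] by simp
    qed
    with F0(1,2) show ?thesis by metis
  qed
  show "hausdorff_has_sum K N ?S"
    unfolding hausdorff_has_sum_def
  proof (rule tendstoI)
    fix e :: real assume "e > 0"
    then obtain F0 where F0: "finite F0" "F0 \<subseteq> N"
      "\<And>F x. finite F \<Longrightarrow> F0 \<subseteq> F \<Longrightarrow> F \<subseteq> N \<Longrightarrow> x \<in> X \<Longrightarrow> norm ((\<Sum>i\<in>F. x i) - \<sigma> x) \<le> e/2"
      using near[of "e/2"] by (metis half_gt_zero)
    show "\<forall>\<^sub>F F in finite_subsets_at_top N. dist (hausdorff_distance (\<Sum>i\<in>F. K i) ?S) 0 < e"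
      unfolding eventually_finite_subsets_at_top
    proof (intro exI conjI allI impI)
      fix F assume F: "finite F \<and> F0 \<subseteq> F \<and> F \<subseteq> N"
      have ne: "(\<Sum>i\<in>F. K i) \<noteq> {}" "bounded (\<Sum>i\<in>F. K i)" using convex_bounded[of F] F by (auto simp: convex_bounded_def)
      have "(\<lambda>i\<in>N. 0) \<in> X" using zero by (auto simp: X_def)
      then have neS: "?S \<noteq> {}" by blast
      have "hausdorff_distance (\<Sum>i\<in>F. K i) ?S \<le> e/2"
      proof (rule hausdorff_le[OF ne(1) neS])
        fix y assume "y \<in> (\<Sum>i\<in>F. K i)"
        then obtain x where x: "\<And>i. i \<in> F \<Longrightarrow> x i \<in> K i" "y = (\<Sum>i\<in>F. x i)"
          using set_sum_witness F by metis
        define x' where "x' = (\<lambda>i\<in>N. if i \<in> F then x i else 0)"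
        have x': "x' \<in> X" using x(1) zero by (auto simp: X_def x'_def)
        have "y = (\<Sum>i\<in>F. x' i)"
          unfolding x(2) using F by (intro sum.cong) (auto simp: x'_def)
        then have "dist y (\<sigma> x') \<le> e/2"
          using F0(3)[of F x'] F x' by (simp add: dist_norm)
        then show "infdist y ?S \<le> e/2"
          by (rule infdist_le2[OF imageI[OF x']])
      next
        fix z assume "z \<in> ?S"
        then obtain x where x: "x \<in> X" "z = \<sigma> x" by blast
        have "(\<Sum>i\<in>F. x i) \<in> (\<Sum>i\<in>F. K i)"
          using x F by (intro sum_in_set_sum) (auto simp: X_def PiE_iff)
        moreover have "dist z (\<Sum>i\<in>F. x i) \<le> e/2"
          using F0(3)[of F x] F x by (simp add: dist_norm norm_minus_commute)
        ultimately show "infdist z (\<Sum>i\<in>F. K i) \<le> e/2"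
          by (rule infdist_le2)
      qed
      then show "dist (hausdorff_distance (\<Sum>i\<in>F. K i) ?S) 0 < e"
        using hausdorff_nonneg[OF ne(2,1) neS] \<open>e > 0\<close> by (simp add: dist_real_def)
    qed (use F0 in auto)
  qed
  have comp: "compactin T X"
    unfolding T_def X_def compactin_PiE using K by (auto simp: cwk_def)
  have cont: "continuous_map (subtopology T X) weak_topology \<sigma>"
    unfolding continuous_map_weak_topology_iff
  proof
    fix h :: "'a \<Rightarrow>\<^sub>L real"
    have ts: "topspace (subtopology T X) \<subseteq> X" by simp
    show "continuous_map (subtopology T X) euclideanreal (\<lambda>x. blinfun_apply h (\<sigma> x))"
      unfolding mtopology_is_euclidean[symmetric]
    proof (rule Met_TC.continuous_map_uniform_limit_alt[where F="finite_subsets_at_top N" and f="\<lambda>F x. \<Sum>i\<in>F. blinfun_apply h (x i)"])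
      have "continuous_map T euclideanreal (\<lambda>x. \<Sum>i\<in>F. blinfun_apply h (x i))" if "finite F" "F \<subseteq> N" for F
      proof (intro continuous_map_sum that)
        fix i assume "i \<in> F"
        then have "continuous_map T weak_topology (\<lambda>x. x i)"
          unfolding T_def using that by (intro continuous_map_product_projection) auto
        from continuous_map_compose[OF this continuous_map_blinfun_weak_topology[of h]]
        show "continuous_map T euclideanreal (\<lambda>x. blinfun_apply h (x i))"
          by (simp add: o_def)
      qed
      then show "\<forall>\<^sub>F F in finite_subsets_at_top N. continuous_map (subtopology T X) Met_TC.mtopology
          (\<lambda>x. \<Sum>i\<in>F. blinfun_apply h (x i))"
        unfolding eventually_finite_subsets_at_top
        by (auto intro!: exI[of _ "{}"] continuous_map_from_subtopology)
      show "\<forall>\<^sub>F F in finite_subsets_at_top N. \<forall>x\<in>topspace (subtopology T X).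
          dist (\<Sum>i\<in>F. blinfun_apply h (x i)) (blinfun_apply h (\<sigma> x)) < e" if "e > 0" for e
      proof -
        define c where "c = e / (2 * (norm h + 1))"
        have "c > 0" using that norm_ge_zero[of h] by (auto simp: c_def intro!: divide_pos_pos add_nonneg_pos)
        then obtain F0 where F0: "finite F0" "F0 \<subseteq> N"
          "\<And>F x. finite F \<Longrightarrow> F0 \<subseteq> F \<Longrightarrow> F \<subseteq> N \<Longrightarrow> x \<in> X \<Longrightarrow> norm ((\<Sum>i\<in>F. x i) - \<sigma> x) \<le> c"
          using near[of c] by metis
        have "dist (\<Sum>i\<in>F. blinfun_apply h (x i)) (blinfun_apply h (\<sigma> x)) < e"
          if F: "finite F" "F0 \<subseteq> F" "F \<subseteq> N" and x: "x \<in> X" for F x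
        proof -
          have "dist (\<Sum>i\<in>F. blinfun_apply h (x i)) (blinfun_apply h (\<sigma> x)) = norm (blinfun_apply h ((\<Sum>i\<in>F. x i) - \<sigma> x))"
            by (simp add: dist_norm blinfun.diff_right blinfun.sum_right)
          also have "\<dots> \<le> norm h * c"
            using norm_blinfun[of h "(\<Sum>i\<in>F. x i) - \<sigma> x"] mult_left_mono[OF F0(3)[OF F x], of "norm h"] by simp
          also have "\<dots> \<le> (norm h + 1) * c"
            using \<open>c > 0\<close> by (simp add: algebra_simps)
          also have "\<dots> = e / 2"
            using norm_ge_zero[of h] by (simp add: c_def add_nonneg_eq_0_iff field_simps)
          finally show ?thesis using \<open>e > 0\<close> by simp
        qed
        then show ?thesis
          unfolding eventually_finite_subsets_at_top
          using F0(1,2) ts by (intro exI[of _ F0]) auto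
      qed
    qed auto
  qed
  have "compactin (subtopology T X) X"
    using comp by (simp add: compactin_subtopology)
  then have "compactin weak_topology ?S"
    by (rule image_compactin[OF _ cont])
  moreover have "convex ?S"
  proof (rule convexI)
    fix y z :: 'a and u v :: real
    assume "y \<in> ?S" "z \<in> ?S" and uv: "0 \<le> u" "0 \<le> v" "u + v = 1"
    then obtain x x' where x: "x \<in> X" "x' \<in> X" "y = \<sigma> x" "z = \<sigma> x'" by blast
    define w where "w = (\<lambda>i\<in>N. u *\<^sub>R x i + v *\<^sub>R x' i)"
    have "w \<in> X"
      using x uv K by (auto simp: w_def X_def intro!: convexD[OF cwk_convex])
    have "\<sigma> w = (\<Sum>\<^sub>\<infinity>i\<in>N. u *\<^sub>R x i + v *\<^sub>R x' i)"
      unfolding \<sigma>_def w_def by (intro infsum_cong) simp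
    also have "\<dots> = u *\<^sub>R y + v *\<^sub>R z"
      unfolding x \<sigma>_def using summ x(1,2)
      by (subst infsum_add) (auto intro!: summable_on_scaleR_right simp: infsum_scaleR_right)
    finally show "u *\<^sub>R y + v *\<^sub>R z \<in> ?S"
      using \<open>w \<in> X\<close> by (metis imageI)
  qed
  moreover have "?S \<noteq> {}"
  proof -
    have "(\<lambda>i\<in>N. 0) \<in> X" using zero by (auto simp: X_def)
    then show ?thesis by blast
  qed
  ultimately show "?S \<in> cwk" by (simp add: cwk_def)
qed

section \<open>Variationally small interval functions\<close>

abbreviation around :: "(real \<Rightarrow> real) \<Rightarrow> real \<Rightarrow> real set" where
  "around \<delta> \<equiv> \<lambda>t. {t - \<delta> t<..<t + \<delta> t}"

text \<open>The condition on the primitive in the variational Henstock integral, for an arbitrary error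
  \<open>e t I\<close> of the tagged interval \<open>(t, I)\<close>. Errors of real integrals and errors that combine
  several primitives are instances as well.\<close>

definition variationally_small :: "(real \<Rightarrow> real set \<Rightarrow> real) \<Rightarrow> bool" where
  "variationally_small e \<longleftrightarrow>
     (\<forall>\<epsilon>>0. \<exists>\<delta>::real \<Rightarrow> real. (\<forall>t\<in>{0..1}. \<delta> t > 0) \<and>
        (\<forall>p. p tagged_division_of {0..1} \<and> around \<delta> fine p \<longrightarrow> (\<Sum>(t, I)\<in>p. e t I) < \<epsilon>))"

lemma variationally_smallE:
  assumes "variationally_small e" "\<epsilon> > 0"
  obtains \<delta> :: "real \<Rightarrow> real" where "\<forall>t\<in>{0..1}. \<delta> t > 0"
    "\<And>p. p tagged_division_of {0..1} \<Longrightarrow> around \<delta> fine p \<Longrightarrow> (\<Sum>(t, I)\<in>p. e t I) < \<epsilon>"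
  using assms unfolding variationally_small_def by metis

lemma tagged_division_interval:
  assumes "p tagged_division_of {0..1::real}" "(t, I) \<in> p"
  obtains a b where "I = {a..b}" "0 \<le> a" "a \<le> t" "t \<le> b" "b \<le> 1"
proof -
  obtain a b where ab: "I = cbox a b" using tagged_division_ofD(4)[OF assms] by blast
  have "t \<in> I" "I \<subseteq> {0..1}" using tagged_division_ofD(2,3)[OF assms] by blast+
  with ab that[of a b] show ?thesis by auto
qed

text \<open>The predicate \<open>gauge\<close> speaks of the whole line, whereas \<open>\<delta>\<close> is positive only on the unit
  interval.\<close>

lemma gauge_around:
  assumes "\<forall>t\<in>{0..1}. \<delta> t > 0"
  shows "gauge (\<lambda>t. if t \<in> {0..1} then around \<delta> t else UNIV)"
  using assms by (auto simp: gauge_def)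

lemma fine_around:
  assumes p: "p tagged_division_of S" and "S \<subseteq> {0..1}"
    and "(\<lambda>t. if t \<in> {0..1} then around \<delta> t else UNIV) fine p"
  shows "around \<delta> fine p"
proof (rule fineI)
  fix t I assume tI: "(t, I) \<in> p"
  have "t \<in> {0..1}" using tagged_division_ofD(2,3)[OF p tI] assms(2) by blast
  with fineD[OF assms(3) tI] show "I \<subseteq> around \<delta> t" by simp
qed

lemma fine_division_exists_around:
  assumes "\<forall>t\<in>{0..1}. \<delta> t > 0" "{a..b} \<subseteq> {0..1::real}"
  obtains p where "p tagged_division_of {a..b}" "around \<delta> fine p"
proof -
  obtain p where p: "p tagged_division_of {a..b}"
    "(\<lambda>t. if t \<in> {0..1} then around \<delta> t else UNIV) fine p"
    using fine_division_exists_real[OF gauge_around[OF assms(1)]] by blast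
  show ?thesis by (rule that[OF p(1) fine_around[OF p(1) assms(2) p(2)]])
qed

text \<open>Cousin's lemma fills the gaps between the given intervals.\<close>

lemma fine_tags_extend:
  assumes \<delta>: "\<forall>t\<in>{0..1}. \<delta> t > 0" and fin: "finite P"
    and iv: "\<And>I. I \<in> P \<Longrightarrow> \<exists>a b. I = {a..b::real}"
    and tag: "\<And>I. I \<in> P \<Longrightarrow> \<tau> I \<in> I \<and> I \<subseteq> {0..1} \<and> I \<subseteq> around \<delta> (\<tau> I)"
    and disj: "\<And>I J. I \<in> P \<Longrightarrow> J \<in> P \<Longrightarrow> I \<noteq> J \<Longrightarrow> interior I \<inter> interior J = {}"
  obtains q where "q tagged_division_of {0..1}" "around \<delta> fine q" "(\<lambda>I. (\<tau> I, I)) ` P \<subseteq> q"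
proof -
  have "P division_of \<Union>P"
  proof (rule division_ofI[OF fin])
    show "\<exists>a b. I = cbox a b" if "I \<in> P" for I using iv[OF that] by simp
    show "I \<noteq> {}" if "I \<in> P" for I using tag[OF that] by blast
  qed (use disj in auto)
  moreover have "\<Union>P \<subseteq> cbox 0 1" unfolding box_real(2) by (rule Union_least) (use tag in blast)
  ultimately obtain Q where Q: "P \<subseteq> Q" "Q division_of cbox 0 (1::real)"
    by (rule partial_division_extend_interval)
  have QD: "finite Q" "\<Union>Q = {0..1}" "\<And>I. I \<in> Q \<Longrightarrow> \<exists>a b. I = {a..b}" "\<And>I. I \<in> Q \<Longrightarrow> I \<subseteq> {0..1}"
    "\<And>I J. I \<in> Q \<Longrightarrow> J \<in> Q \<Longrightarrow> I \<noteq> J \<Longrightarrow> interior I \<inter> interior J = {}"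
    using division_ofD[OF Q(2)] by (simp_all)
  have "\<exists>r. r tagged_division_of I \<and> around \<delta> fine r \<and> (I \<in> P \<longrightarrow> (\<tau> I, I) \<in> r)" if I: "I \<in> Q" for I
  proof -
    obtain a b where ab: "I = {a..b}" using QD(3)[OF I] by blast
    show ?thesis
    proof (cases "I \<in> P")
      case True
      have "{(\<tau> I, I)} tagged_division_of I"
        using tagged_division_of_self_real[of "\<tau> I" a b] tag[OF True] ab by simp
      moreover have "around \<delta> fine {(\<tau> I, I)}"
        using tag[OF True] by (auto simp: fine_def)
      ultimately show ?thesis by blast
    next
      case False
      have "{a..b} \<subseteq> {0..1}" using QD(4)[OF I] ab by simp
      from fine_division_exists_around[OF \<delta> this] False ab show ?thesis by metis
    qed
  qed
  then obtain r where r: "\<And>I. I \<in> Q \<Longrightarrow> r I tagged_division_of I"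
    "\<And>I. I \<in> Q \<Longrightarrow> around \<delta> fine r I" "\<And>I. I \<in> P \<Longrightarrow> (\<tau> I, I) \<in> r I"
    using Q(1) by (metis subsetD)
  show ?thesis
  proof
    have "\<Union>(r ` Q) tagged_division_of \<Union>Q"
      by (rule tagged_division_Union[OF QD(1) r(1) QD(5)])
    then show "\<Union>(r ` Q) tagged_division_of {0..1}" using QD(2) by simp
    show "around \<delta> fine \<Union>(r ` Q)"
      using r(2) by (auto simp: fine_def)
    show "(\<lambda>I. (\<tau> I, I)) ` P \<subseteq> \<Union>(r ` Q)"
      using r(3) Q(1) by blast
  qed
qed

text \<open>Non-negative errors can be dropped from the sum over a full partition.\<close>

lemma fine_tags_sum_le:
  fixes e :: "real \<Rightarrow> real set \<Rightarrow> real"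
  assumes \<delta>: "\<forall>t\<in>{0..1}. \<delta> t > 0"
    and nonneg: "\<And>t a b. 0 \<le> a \<Longrightarrow> a \<le> t \<Longrightarrow> t \<le> b \<Longrightarrow> b \<le> 1 \<Longrightarrow> 0 \<le> e t {a..b}"
    and small: "\<And>p. p tagged_division_of {0..1} \<Longrightarrow> around \<delta> fine p \<Longrightarrow> (\<Sum>(t, I)\<in>p. e t I) < \<epsilon>"
    and fin: "finite P"
    and iv: "\<And>I. I \<in> P \<Longrightarrow> \<exists>a b. I = {a..b::real}"
    and tag: "\<And>I. I \<in> P \<Longrightarrow> \<tau> I \<in> I \<and> I \<subseteq> {0..1} \<and> I \<subseteq> around \<delta> (\<tau> I)"
    and disj: "\<And>I J. I \<in> P \<Longrightarrow> J \<in> P \<Longrightarrow> I \<noteq> J \<Longrightarrow> interior I \<inter> interior J = {}"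
  shows "(\<Sum>I\<in>P. e (\<tau> I) I) < \<epsilon>"
proof -
  obtain q where q: "q tagged_division_of {0..1}" "around \<delta> fine q" "(\<lambda>I. (\<tau> I, I)) ` P \<subseteq> q"
    by (rule fine_tags_extend[OF \<delta> fin iv tag disj])
  have "(\<Sum>I\<in>P. e (\<tau> I) I) = (\<Sum>(t, I)\<in>(\<lambda>I. (\<tau> I, I)) ` P. e t I)"
    by (subst sum.reindex) (auto simp: inj_on_def)
  also have "\<dots> \<le> (\<Sum>(t, I)\<in>q. e t I)"
  proof (rule sum_mono2[OF tagged_division_ofD(1)[OF q(1)] q(3)])
    fix z assume z: "z \<in> q - (\<lambda>I. (\<tau> I, I)) ` P"
    then obtain t I where tI: "z = (t, I)" "(t, I) \<in> q" by (cases z) auto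
    with nonneg show "0 \<le> (case z of (t, I) \<Rightarrow> e t I)"
      by (elim tagged_division_interval[OF q(1)]) auto
  qed
  also have "\<dots> < \<epsilon>" by (rule small[OF q(1,2)])
  finally show ?thesis .
qed

text \<open>A Vitali covering argument. The points that lie in arbitrarily short intervals with error
  larger than \<open>\<eta>\<close> times the length are covered by such intervals which are moreover fine. A disjoint
  subfamily of them, whose fivefold enlargements still cover, has total length at most
  1/\<open>\<eta>\<close> times the sum of its errors, and this sum is small.\<close>

theorem variationally_small_derivative:
  assumes vs: "variationally_small e"
    and nonneg: "\<And>t a b. 0 \<le> a \<Longrightarrow> a \<le> t \<Longrightarrow> t \<le> b \<Longrightarrow> b \<le> 1 \<Longrightarrow> 0 \<le> e t {a..b}"
  obtains N where "negligible N" "N \<subseteq> {0..1}"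
    "\<And>t \<epsilon>. t \<in> {0..1} - N \<Longrightarrow> \<epsilon> > 0 \<Longrightarrow>
       \<exists>d>0. \<forall>a b. 0 \<le> a \<and> a \<le> t \<and> t \<le> b \<and> b \<le> 1 \<and> a < b \<and> b - a < d \<longrightarrow> e t {a..b} \<le> \<epsilon> * (b - a)"
proof -
  define bad where "bad = (\<lambda>\<eta> t a b. 0 \<le> a \<and> a \<le> t \<and> t \<le> b \<and> b \<le> 1 \<and> a < b \<and> e t {a..b} > \<eta> * (b - a))"
  define Z where "Z = (\<lambda>\<eta>. {t\<in>{0..1}. \<forall>d>0. \<exists>a b. bad \<eta> t a b \<and> b - a < d})"
  have neg: "negligible (Z \<eta>)" if "\<eta> > 0" for \<eta>
    unfolding negligible_outer_le
  proof (intro allI impI)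
    fix \<epsilon> :: real assume "\<epsilon> > 0"
    \<comment> \<open>The 5 is the enlargement factor of the Vitali covering lemma.\<close>
    define \<epsilon>' where "\<epsilon>' = \<epsilon> * \<eta> / 5"
    have "\<epsilon>' > 0" using \<open>\<epsilon> > 0\<close> \<open>\<eta> > 0\<close> by (simp add: \<epsilon>'_def)
    obtain \<delta> where \<delta>: "\<forall>t\<in>{0..1}. \<delta> t > 0"
      "\<And>p. p tagged_division_of {0..1} \<Longrightarrow> around \<delta> fine p \<Longrightarrow> (\<Sum>(t, I)\<in>p. e t I) < \<epsilon>'"
      by (rule variationally_smallE[OF vs \<open>\<epsilon>' > 0\<close>]) (rule that, assumption, assumption)
    define K where "K = {(t, a, b). bad \<eta> t a b \<and> {a..b} \<subseteq> around \<delta> t}"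
    define c where "c = (\<lambda>(t :: real, a :: real, b :: real). (a + b) / 2)"
    define r where "r = (\<lambda>(t :: real, a :: real, b :: real). (b - a) / 2)"
    define J where "J = (\<lambda>(t :: real, a :: real, b :: real). {a..b})"
    have cball: "cball (c i) (r i) = J i" for i
      by (cases i) (auto simp: c_def r_def J_def cball_eq_atLeastAtMost field_simps)
    have cov: "Z \<eta> \<subseteq> (\<Union>i\<in>K. cball (c i) (r i))"
    proof
      fix t assume t: "t \<in> Z \<eta>"
      then have "\<delta> t > 0" using \<delta>(1) by (auto simp: Z_def)
      with t obtain a b where ab: "bad \<eta> t a b" "b - a < \<delta> t" unfolding Z_def by blast
      then have "(t, a, b) \<in> K" by (auto simp: K_def bad_def)
      moreover have "t \<in> J (t, a, b)" using ab by (auto simp: J_def bad_def)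
      ultimately show "t \<in> (\<Union>i\<in>K. cball (c i) (r i))" unfolding cball by blast
    qed
    have rb: "0 < r i \<and> r i \<le> 1" if "i \<in> K" for i
      using that by (auto simp: K_def r_def bad_def)
    obtain C where C: "countable C" "C \<subseteq> K"
      "pairwise (\<lambda>i j. disjnt (cball (c i) (r i)) (cball (c j) (r j))) C"
      "Z \<eta> \<subseteq> (\<Union>i\<in>C. cball (c i) (5 * r i))"
      by (rule Vitali_covering_lemma_cballs[OF cov rb])
    have dis: "J i \<inter> J j = {}" if "i \<in> C" "j \<in> C" "i \<noteq> j" for i j
      using C(3) that unfolding cball pairwise_def disjnt_def by blast
    have ne: "J i \<noteq> {}" if "i \<in> C" for i
      using that C(2) by (auto simp: K_def bad_def J_def)
    have inj: "inj_on J C"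
    proof (rule inj_onI, rule ccontr)
      fix i j assume "i \<in> C" "j \<in> C" "J i = J j" "i \<noteq> j"
      then show False using dis[of i j] ne[of i] by simp
    qed
    have bound: "(\<Sum>i\<in>C'. 2 * r i) \<le> \<epsilon> / 5" if C': "finite C'" "C' \<subseteq> C" for C'
    proof -
      define \<tau> where "\<tau> = (\<lambda>I. fst (inv_into C' J I))"
      have inj': "inj_on J C'" using inj C'(2) inj_on_subset by blast
      have \<tau>: "\<tau> (J i) = fst i" if "i \<in> C'" for i
        using inv_into_f_f[OF inj' that] by (simp add: \<tau>_def)
      have "(\<Sum>I\<in>J ` C'. e (\<tau> I) I) < \<epsilon>'"
      proof (rule fine_tags_sum_le[OF \<delta>(1) nonneg \<delta>(2)])
        show "\<exists>a b. I = {a..b}" if "I \<in> J ` C'" for I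
          using that by (auto simp: J_def split: prod.splits)
        show "\<tau> I \<in> I \<and> I \<subseteq> {0..1} \<and> I \<subseteq> around \<delta> (\<tau> I)" if "I \<in> J ` C'" for I
        proof -
          obtain i where i: "i \<in> C'" "I = J i" using \<open>I \<in> J ` C'\<close> by blast
          obtain t a b where tab: "i = (t, a, b)" by (cases i)
          have "i \<in> K" using i C' C(2) by blast
          then have "bad \<eta> t a b" "{a..b} \<subseteq> around \<delta> t" by (auto simp: K_def tab)
          then show ?thesis
            unfolding i(2) \<tau>[OF i(1)] by (auto simp: tab J_def bad_def)
        qed
        show "interior I \<inter> interior I' = {}" if "I \<in> J ` C'" "I' \<in> J ` C'" "I \<noteq> I'" for I I'
        proof -
          obtain i j where "i \<in> C'" "I = J i" "j \<in> C'" "I' = J j" using \<open>I \<in> J ` C'\<close> \<open>I' \<in> J ` C'\<close> by blast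
          then have "I \<inter> I' = {}" using dis[of i j] C'(2) \<open>I \<noteq> I'\<close> by blast
          then show ?thesis using interior_subset by blast
        qed
      qed (use C'(1) in auto)
      moreover have "(\<Sum>I\<in>J ` C'. e (\<tau> I) I) = (\<Sum>i\<in>C'. e (fst i) (J i))"
        by (subst sum.reindex[OF inj']) (auto simp: \<tau>)
      moreover have "(\<Sum>i\<in>C'. \<eta> * (2 * r i)) \<le> (\<Sum>i\<in>C'. e (fst i) (J i))"
      proof (rule sum_mono)
        fix i assume "i \<in> C'"
        then have "i \<in> K" using C' C(2) by blast
        then show "\<eta> * (2 * r i) \<le> e (fst i) (J i)"
          by (cases i) (auto simp: K_def bad_def r_def J_def algebra_simps)
      qed
      ultimately have "\<eta> * (\<Sum>i\<in>C'. 2 * r i) \<le> \<epsilon>'"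
        by (simp add: sum_distrib_left)
      then show ?thesis
        using \<open>\<eta> > 0\<close> by (simp add: \<epsilon>'_def field_simps)
    qed
    define T where "T = (\<Union>i\<in>C. cball (c i) (5 * r i))"
    have B: "measure lebesgue (\<Union>i\<in>C'. cball (c i) (5 * r i)) \<le> \<epsilon>" if "C' \<subseteq> C" "finite C'" for C'
    proof -
      have "measure lebesgue (\<Union>i\<in>C'. cball (c i) (5 * r i)) \<le> (\<Sum>i\<in>C'. measure lebesgue (cball (c i) (5 * r i)))"
        using that by (intro measure_UNION_le) auto
      also have "\<dots> = (\<Sum>i\<in>C'. 5 * (2 * r i))"
      proof (rule sum.cong[OF refl])
        fix i assume "i \<in> C'"
        then have "i \<in> K" using that C(2) by blast
        then have "r i > 0" by (auto simp: K_def bad_def r_def)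
        then show "measure lebesgue (cball (c i) (5 * r i)) = 5 * (2 * r i)"
          by (simp add: cball_eq_atLeastAtMost)
      qed
      also have "\<dots> = 5 * (\<Sum>i\<in>C'. 2 * r i)" by (rule sum_distrib_left[symmetric])
      also have "\<dots> \<le> \<epsilon>" using bound[OF that(2,1)] by simp
      finally show ?thesis .
    qed
    have "T \<in> lmeasurable" "measure lebesgue T \<le> \<epsilon>"
      unfolding T_def by (rule fmeasurable_UN_bound[OF C(1) _ B] measure_UN_bound[OF C(1) _ B]; auto)+
    then show "\<exists>T. Z \<eta> \<subseteq> T \<and> T \<in> lmeasurable \<and> measure lebesgue T \<le> \<epsilon>"
      using C(4) T_def by blast
  qed
  show ?thesis
  proof
    show "negligible (\<Union>n::nat. Z (1 / Suc n))"
      by (rule negligible_Union_nat) (use neg in simp)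
    show "(\<Union>n::nat. Z (1 / Suc n)) \<subseteq> {0..1}" by (auto simp: Z_def)
    fix t \<epsilon> :: real assume t: "t \<in> {0..1} - (\<Union>n::nat. Z (1 / Suc n))" and "\<epsilon> > 0"
    obtain n where n: "1 / Suc n < \<epsilon>" using nat_approx_posE[OF \<open>\<epsilon> > 0\<close>] .
    have "t \<notin> Z (1 / Suc n)" "t \<in> {0..1}" using t by auto
    then obtain d where d: "d > 0" "\<And>a b. bad (1 / Suc n) t a b \<Longrightarrow> \<not> b - a < d" unfolding Z_def by blast
    have "e t {a..b} \<le> \<epsilon> * (b - a)"
      if "0 \<le> a" "a \<le> t" "t \<le> b" "b \<le> 1" "a < b" "b - a < d" for a b
    proof -
      have "e t {a..b} \<le> 1 / Suc n * (b - a)"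
        using d(2)[of a b] that unfolding bad_def by fastforce
      also have "\<dots> \<le> \<epsilon> * (b - a)"
        using n that by (intro mult_right_mono) auto
      finally show ?thesis .
    qed
    with d(1) show "\<exists>d>0. \<forall>a b. 0 \<le> a \<and> a \<le> t \<and> t \<le> b \<and> b \<le> 1 \<and> a < b \<and> b - a < d \<longrightarrow> e t {a..b} \<le> \<epsilon> * (b - a)"
      by blast
  qed
qed

section \<open>Gauges adapted to measurable sets\<close>

lemma negligible_Int_nonoverlapping:
  fixes a b c d :: real
  assumes "interior {a..b} \<inter> interior {c..d} = {}"
  shows "negligible ({a..b} \<inter> {c..d})"
proof (rule negligible_subset)
  show "negligible {a, b, c, d}" by simp
  have "{a<..<b} \<inter> {c<..<d} = {}" using assms by simp
  moreover have "x \<in> {a<..<b} \<inter> {c<..<d}" if "x \<in> {a..b} \<inter> {c..d}" "x \<notin> {a, b, c, d}" for x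
    using that by auto
  ultimately show "{a..b} \<inter> {c..d} \<subseteq> {a, b, c, d}" by blast
qed

lemma tagged_division_measure_sum_le:
  assumes p: "p tagged_division_of {0..1::real}" and "r \<subseteq> p" and V: "V \<in> lmeasurable" and A: "A \<in> sets lebesgue"
    and sub: "\<And>t I. (t, I) \<in> r \<Longrightarrow> I - A \<subseteq> V"
  shows "(\<Sum>(t, I)\<in>r. measure lebesgue (I - A)) \<le> measure lebesgue V"
proof -
  have fin: "finite r" using tagged_division_ofD(1)[OF p] \<open>r \<subseteq> p\<close> finite_subset by blast
  have iv: "\<exists>a b. I = {a..b}" if "(t, I) \<in> r" for t I
    using tagged_division_ofD(4)[OF p, of t I] that \<open>r \<subseteq> p\<close> by auto
  have meas: "snd z - A \<in> lmeasurable" if "z \<in> r" for z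
    using iv[of "fst z" "snd z"] that A by (auto intro!: fmeasurable_Diff)
  have "measure lebesgue (\<Union>z\<in>r. snd z - A) = (\<Sum>z\<in>r. measure lebesgue (snd z - A))"
  proof (rule measure_negligible_finite_Union_image[OF fin meas])
    show "pairwise (\<lambda>z w. negligible ((snd z - A) \<inter> (snd w - A))) r"
    proof (rule pairwiseI)
      fix z w assume zw: "z \<in> r" "w \<in> r" "z \<noteq> w"
      obtain a b where ab: "snd z = {a..b}" using iv[of "fst z" "snd z"] zw by auto
      obtain c d where cd: "snd w = {c..d}" using iv[of "fst w" "snd w"] zw by auto
      have "interior (snd z) \<inter> interior (snd w) = {}"
        using tagged_division_ofD(5)[OF p, of "fst z" "snd z" "fst w" "snd w"] zw \<open>r \<subseteq> p\<close>
        by (auto simp: prod_eq_iff)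
      then have "negligible (snd z \<inter> snd w)"
        using negligible_Int_nonoverlapping unfolding ab cd by blast
      then show "negligible ((snd z - A) \<inter> (snd w - A))"
        by (rule negligible_subset) auto
    qed
  qed
  moreover have "measure lebesgue (\<Union>z\<in>r. snd z - A) \<le> measure lebesgue V"
  proof (rule measure_mono_fmeasurable[OF _ _ V])
    show "(\<Union>z\<in>r. snd z - A) \<subseteq> V" using sub by fastforce
    show "(\<Union>z\<in>r. snd z - A) \<in> sets lebesgue"
      using fin meas by (intro sets.finite_UN) (auto dest: fmeasurableD)
  qed
  ultimately show ?thesis by (simp add: case_prod_beta)
qed

text \<open>The tags are split into classes by \<open>\<kappa>\<close>, and the \<open>i\<close>-th class is contained in \<open>A i\<close> up to a null set.
  Let the intervals with a tag in class \<open>i\<close> stay in an open set \<open>U i\<close> around \<open>A i\<close>. As they do not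
  overlap, their parts outside \<open>A i\<close> have total measure at most that of \<open>U i - A i\<close>, which can be made small
  against the weight \<open>w i\<close>.\<close>

theorem gauge_for_approximately_covering_sets:
  fixes \<kappa> :: "real \<Rightarrow> nat" and A :: "nat \<Rightarrow> real set" and w :: "nat \<Rightarrow> real"
  assumes A: "\<And>i. A i \<in> sets lebesgue" and w: "\<And>i. w i \<ge> 0"
    and neg: "\<And>i. negligible ({t\<in>S. \<kappa> t = i} - A i)" and "\<epsilon> > 0"
  obtains \<delta> :: "real \<Rightarrow> real" where "\<And>t. \<delta> t > 0"
    "\<And>p. p tagged_division_of {0..1} \<Longrightarrow> around \<delta> fine p \<Longrightarrow>
       (\<Sum>(t, I)\<in>{z\<in>p. fst z \<in> S}. w (\<kappa> t) * measure lebesgue (I - A (\<kappa> t))) < \<epsilon>"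
proof -
  define T where "T = (\<lambda>i. {t\<in>S. \<kappa> t = i})"
  \<comment> \<open>The geometric factor makes the classes contribute at most \<open>\<epsilon> / 2\<close> in total.\<close>
  define \<eta> where "\<eta> = (\<lambda>i. \<epsilon> / 4 * (1/2) ^ i / (w i + 1))"
  have \<eta>: "\<eta> i > 0" for i using \<open>\<epsilon> > 0\<close> w[of i] by (simp add: \<eta>_def add_nonneg_pos)
  have "\<exists>U. open U \<and> A i \<union> T i \<subseteq> U \<and> U - A i \<in> lmeasurable \<and> measure lebesgue (U - A i) \<le> \<eta> i" for i
  proof -
    have TA: "negligible (T i - A i)" using neg by (simp add: T_def)
    have eq: "A i \<union> T i = A i \<union> (T i - A i)" by blast
    have "A i \<union> T i \<in> sets lebesgue"
      unfolding eq using A negligible_imp_sets[OF TA] by (rule sets.Un)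
    then obtain U where U: "open U" "A i \<union> T i \<subseteq> U" "U - (A i \<union> T i) \<in> lmeasurable"
      "emeasure lebesgue (U - (A i \<union> T i)) < ennreal (\<eta> i)"
      by (rule sets_lebesgue_outer_open[OF _ \<eta>])
    have eq2: "U - A i = (U - (A i \<union> T i)) \<union> (T i - A i)" using U(2) by blast
    have "T i - A i \<in> lmeasurable" using TA negligible_imp_measurable by blast
    then have lm: "U - A i \<in> lmeasurable" unfolding eq2 using U(3) by (rule fmeasurable.Un[rotated])
    have "measure lebesgue (U - A i) \<le> measure lebesgue (U - (A i \<union> T i)) + measure lebesgue (T i - A i)"
      unfolding eq2 using U(3) negligible_imp_sets[OF TA] by (intro measure_Un_le) auto
    also have "\<dots> = measure lebesgue (U - (A i \<union> T i))"
      using negligible_imp_measure0[OF TA] by simp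
    also have "\<dots> \<le> \<eta> i"
      using U(3,4) \<eta>[of i] by (simp add: emeasure_eq_measure2 ennreal_less_iff)
    finally show ?thesis using U lm by blast
  qed
  then obtain U where U: "\<And>i. open (U i)" "\<And>i. A i \<union> T i \<subseteq> U i" "\<And>i. U i - A i \<in> lmeasurable"
    "\<And>i. measure lebesgue (U i - A i) \<le> \<eta> i" by metis
  have "\<exists>d>0. t \<in> S \<longrightarrow> {t - d<..<t + d} \<subseteq> U (\<kappa> t)" for t
  proof (cases "t \<in> S")
    case True
    then have "t \<in> U (\<kappa> t)" using U(2)[of "\<kappa> t"] by (auto simp: T_def)
    then obtain d where "d > 0" "ball t d \<subseteq> U (\<kappa> t)" using U(1) open_contains_ball by blast
    then show ?thesis by (auto simp: ball_eq_greaterThanLessThan)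
  qed (auto intro: exI[of _ 1])
  then obtain \<delta> where \<delta>: "\<And>t. \<delta> t > 0" "\<And>t. t \<in> S \<Longrightarrow> around \<delta> t \<subseteq> U (\<kappa> t)" by metis
  have "(\<Sum>(t, I)\<in>{z\<in>p. fst z \<in> S}. w (\<kappa> t) * measure lebesgue (I - A (\<kappa> t))) < \<epsilon>"
    if p: "p tagged_division_of {0..1}" "around \<delta> fine p" for p
  proof -
    define r where "r = {z\<in>p. fst z \<in> S}"
    have fin: "finite r" using tagged_division_ofD(1)[OF p(1)] by (simp add: r_def)
    define J where "J = (\<lambda>z. \<kappa> (fst z)) ` r"
    have "(\<Sum>(t, I)\<in>r. w (\<kappa> t) * measure lebesgue (I - A (\<kappa> t))) =
        (\<Sum>i\<in>J. \<Sum>(t, I)\<in>{z\<in>r. \<kappa> (fst z) = i}. w (\<kappa> t) * measure lebesgue (I - A (\<kappa> t)))"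
      unfolding J_def by (rule sum.image_gen[OF fin])
    also have "\<dots> \<le> (\<Sum>i\<in>J. \<epsilon> / 4 * (1/2) ^ i)"
    proof (rule sum_mono)
      fix i assume "i \<in> J"
      have "(\<Sum>(t, I)\<in>{z\<in>r. \<kappa> (fst z) = i}. w (\<kappa> t) * measure lebesgue (I - A (\<kappa> t))) =
          w i * (\<Sum>(t, I)\<in>{z\<in>r. \<kappa> (fst z) = i}. measure lebesgue (I - A i))"
        unfolding sum_distrib_left by (intro sum.cong) auto
      also have "\<dots> \<le> w i * measure lebesgue (U i - A i)"
      proof (intro mult_left_mono w tagged_division_measure_sum_le[OF p(1) _ U(3) A])
        show "I - A i \<subseteq> U i - A i" if "(t, I) \<in> {z \<in> r. \<kappa> (fst z) = i}" for t I
          using fineD[OF p(2), of t I] \<delta>(2)[of t] that by (auto simp: r_def)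
      qed (auto simp: r_def)
      also have "\<dots> \<le> (w i + 1) * \<eta> i"
        using U(4)[of i] w[of i] \<eta>[of i] by (intro mult_mono) auto
      also have "\<dots> = \<epsilon> / 4 * (1/2) ^ i"
      proof -
        have "w i + 1 \<noteq> 0" using w[of i] by linarith
        then show ?thesis
          unfolding \<eta>_def by (simp only: times_divide_eq_right nonzero_mult_div_cancel_left not_False_eq_True)
      qed
      finally show "(\<Sum>(t, I)\<in>{z\<in>r. \<kappa> (fst z) = i}. w (\<kappa> t) * measure lebesgue (I - A (\<kappa> t))) \<le> \<epsilon> / 4 * (1/2) ^ i" .
    qed
    also have "\<dots> \<le> (\<Sum>i. \<epsilon> / 4 * (1/2) ^ i)"
      using \<open>\<epsilon> > 0\<close> fin by (intro sum_le_suminf summable_mult summable_geometric) (auto simp: J_def)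
    also have "\<dots> = \<epsilon> / 2"
      by (subst suminf_mult) (auto simp: suminf_geometric intro: summable_geometric)
    also have "\<dots> < \<epsilon>" using \<open>\<epsilon> > 0\<close> by simp
    finally show ?thesis by (simp add: r_def)
  qed
  with \<delta>(1) show ?thesis by (rule that)
qed

text \<open>The classes are the level sets of the weight rounded up, and every \<open>A i\<close> is empty.\<close>

corollary gauge_for_negligible_tags:
  fixes c :: "real \<Rightarrow> real"
  assumes "negligible N" "\<epsilon> > 0"
  obtains \<delta> :: "real \<Rightarrow> real" where "\<And>t. \<delta> t > 0"
    "\<And>p. p tagged_division_of {0..1} \<Longrightarrow> around \<delta> fine p \<Longrightarrow>
       (\<Sum>(t, I)\<in>{z\<in>p. fst z \<in> N}. c t * measure lebesgue I) < \<epsilon>"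
proof -
  define \<kappa> where "\<kappa> = (\<lambda>t. nat \<lceil>c t\<rceil>)"
  obtain \<delta> :: "real \<Rightarrow> real" where \<delta>: "\<And>t. \<delta> t > 0"
    "\<And>p. p tagged_division_of {0..1} \<Longrightarrow> around \<delta> fine p \<Longrightarrow>
       (\<Sum>(t, I)\<in>{z\<in>p. fst z \<in> N}. real (\<kappa> t) * measure lebesgue (I - {})) < \<epsilon>"
    by (rule gauge_for_approximately_covering_sets[of "\<lambda>_. {}" real N \<kappa> \<epsilon>])
      (use assms in \<open>auto intro: negligible_subset\<close>)
  have "(\<Sum>(t, I)\<in>{z\<in>p. fst z \<in> N}. c t * measure lebesgue I) < \<epsilon>"
    if "p tagged_division_of {0..1}" "around \<delta> fine p" for p
  proof -
    have "(\<Sum>(t, I)\<in>{z\<in>p. fst z \<in> N}. c t * measure lebesgue I) \<le>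
        (\<Sum>(t, I)\<in>{z\<in>p. fst z \<in> N}. real (\<kappa> t) * measure lebesgue (I - {}))"
      unfolding case_prod_beta Diff_empty \<kappa>_def
      by (intro sum_mono mult_right_mono real_nat_ceiling_ge) simp
    also have "\<dots> < \<epsilon>" by (rule \<delta>(2)[OF that])
    finally show ?thesis .
  qed
  with \<delta>(1) show ?thesis by (rule that)
qed

section \<open>Measurable pieces of small oscillation\<close>

lemma subintervalsI: "0 \<le> a \<Longrightarrow> a \<le> b \<Longrightarrow> b \<le> 1 \<Longrightarrow> {a..b} \<in> subintervals"
  by (auto simp: subintervals_def)

lemma hausdorff_primitive_nonneg:
  assumes "\<And>I. I \<in> subintervals \<Longrightarrow> \<Phi> I \<in> convex_bounded" "\<And>t. t \<in> {0..1} \<Longrightarrow> \<Gamma> t \<in> convex_bounded"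
    and "0 \<le> a" "a \<le> t" "t \<le> b" "b \<le> (1::real)"
  shows "0 \<le> hausdorff_distance (\<Phi> {a..b}) (measure lebesgue {a..b} *\<^sub>S \<Gamma> t)"
proof -
  have "\<Phi> {a..b} \<in> convex_bounded" "measure lebesgue {a..b} *\<^sub>S \<Gamma> t \<in> convex_bounded"
    using assms by (auto intro!: assms(1) subintervalsI convex_bounded_scale)
  then show ?thesis by (intro hausdorff_nonneg) (auto simp: convex_bounded_def)
qed

text \<open>The number of the cell that contains \<open>t\<close>; the point 1 gets the number \<open>Suc n\<close>, which is not a
  cell of the unit interval.\<close>

definition cell_index :: "nat \<Rightarrow> real \<Rightarrow> nat" where
  "cell_index n t = nat \<lfloor>real (Suc n) * t\<rfloor>"

definition cell :: "nat \<Rightarrow> nat \<Rightarrow> real set" where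
  "cell n i = {real i / real (Suc n)..real (Suc i) / real (Suc n)}"

lemma cell_index_bounds:
  assumes "0 \<le> t" "t < 1"
  shows "cell_index n t \<le> n" "real (cell_index n t) / real (Suc n) \<le> t"
    "t \<le> real (Suc (cell_index n t)) / real (Suc n)"
proof -
  have k: "real (cell_index n t) = of_int \<lfloor>real (Suc n) * t\<rfloor>"
    using assms(1) by (simp add: cell_index_def)
  have 1: "real (cell_index n t) \<le> real (Suc n) * t" "real (Suc n) * t < real (cell_index n t) + 1"
    unfolding k by linarith+
  have "real (cell_index n t) < real (Suc n)"
  proof -
    have "real (Suc n) * t < real (Suc n) * 1"
      using assms(2) by (intro mult_strict_left_mono) auto
    with 1(1) show ?thesis by (metis le_less_trans mult.right_neutral)
  qed
  then show "cell_index n t \<le> n" by simp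
  show "real (cell_index n t) / real (Suc n) \<le> t" "t \<le> real (Suc (cell_index n t)) / real (Suc n)"
    using 1 by (simp_all add: field_simps)
qed

lemma measurable_cell_index [measurable]: "cell_index n \<in> measurable borel (count_space UNIV)"
  unfolding cell_index_def[abs_def] by measurable

text \<open>Any predicate is allowed because the indices have only countably many values.\<close>

lemma cell_index_rel_sets_borel: "{t. Q (cell_index k t) (cell_index m t)} \<in> sets borel"
proof -
  have "{t. Q (cell_index k t) (cell_index m t)} =
      (\<Union>i. \<Union>j\<in>{j. Q i j}. (cell_index k -` {i} \<inter> space borel) \<inter> (cell_index m -` {j} \<inter> space borel))"
    by auto
  also have "\<dots> \<in> sets borel"
  proof -
    have s: "cell_index n -` {i} \<inter> space borel \<in> sets borel" for n i
      by (rule measurable_sets[OF measurable_cell_index]) simp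
    have "(\<Union>j\<in>{j. Q i j}. (cell_index k -` {i} \<inter> space borel) \<inter> (cell_index m -` {j} \<inter> space borel)) \<in> sets borel" for i
      by (rule sets.countable_UN') (use s sets.Int in blast)+
    then show ?thesis by (intro sets.countable_UN'[of UNIV]) auto
  qed
  finally show ?thesis .
qed

text \<open>By \<open>variationally_small_derivative\<close>, the values of the primitive on the grid cells around \<open>t\<close>,
  divided by the length of the cells, converge to \<open>\<Gamma> t\<close> for almost every \<open>t\<close>. These averages are step
  functions of \<open>t\<close>, so the set where all of them after the \<open>m\<close>-th stay within \<open>\<eta>\<close> of the \<open>m\<close>-th is a
  Borel set, whatever \<open>\<Gamma>\<close> is. Its intersection with one cell of the \<open>m\<close>-th grid, less a null set, is a piece: there
  \<open>\<Gamma> t\<close> is within \<open>\<eta>\<close> of one fixed average.\<close>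

theorem vH_measurable_pieces:
  fixes \<Gamma> :: "real \<Rightarrow> 'a::real_normed_vector set" and \<Phi> :: "real set \<Rightarrow> 'a set"
  assumes \<Phi>: "\<And>I. I \<in> subintervals \<Longrightarrow> \<Phi> I \<in> convex_bounded" and \<Gamma>: "\<And>t. t \<in> {0..1} \<Longrightarrow> \<Gamma> t \<in> convex_bounded"
    and vs: "variationally_small (\<lambda>t I. hausdorff_distance (\<Phi> I) (measure lebesgue I *\<^sub>S \<Gamma> t))"
    and "\<epsilon> > 0"
  obtains E :: "nat \<Rightarrow> real set" where "disjoint_family E" "\<And>i. E i \<in> sets lebesgue" "\<And>i. E i \<subseteq> {0..1}"
    "negligible ({0..1} - (\<Union>i. E i))"
    "\<And>i s t. s \<in> E i \<Longrightarrow> t \<in> E i \<Longrightarrow> hausdorff_distance (\<Gamma> s) (\<Gamma> t) \<le> \<epsilon>"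
proof -
  obtain N where N: "negligible N" "N \<subseteq> {0..1}"
    "\<And>t \<epsilon>. t \<in> {0..1} - N \<Longrightarrow> \<epsilon> > 0 \<Longrightarrow>
       \<exists>d>0. \<forall>a b. 0 \<le> a \<and> a \<le> t \<and> t \<le> b \<and> b \<le> 1 \<and> a < b \<and> b - a < d \<longrightarrow>
          hausdorff_distance (\<Phi> {a..b}) (measure lebesgue {a..b} *\<^sub>S \<Gamma> t) \<le> \<epsilon> * (b - a)"
    by (rule variationally_small_derivative[OF vs hausdorff_primitive_nonneg[of \<Phi> \<Gamma>, OF \<Phi> \<Gamma>]]) auto
  define K where "K = (\<lambda>n i. real (Suc n) *\<^sub>S \<Phi> (cell n i))"
  define k where "k = (\<lambda>n t. K n (cell_index n t))"
  have K: "K n i \<in> convex_bounded" if "i \<le> n" for n i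
    unfolding K_def cell_def using that by (intro convex_bounded_scale \<Phi> subintervalsI) (auto simp: divide_simps)
  have kb: "k n t \<in> convex_bounded" if "t \<in> {0..<1}" for n t
    unfolding k_def using cell_index_bounds(1)[of t n] that by (intro K) auto
  have conv: "\<exists>m. \<forall>n\<ge>m. hausdorff_distance (k n t) (\<Gamma> t) \<le> \<eta>" if t: "t \<in> {0..<1} - N" and \<eta>: "\<eta> > 0" for t \<eta>
  proof -
    have t': "t \<in> {0..1} - N" using t by auto
    obtain d where d: "d > 0" "\<And>a b. 0 \<le> a \<Longrightarrow> a \<le> t \<Longrightarrow> t \<le> b \<Longrightarrow> b \<le> 1 \<Longrightarrow> a < b \<Longrightarrow> b - a < d \<Longrightarrow>
          hausdorff_distance (\<Phi> {a..b}) (measure lebesgue {a..b} *\<^sub>S \<Gamma> t) \<le> \<eta> * (b - a)"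
      using N(3)[OF t' \<eta>] by metis
    obtain m where m: "1 / real (Suc m) < d" using nat_approx_posE[OF d(1)] .
    show ?thesis
    proof (intro exI allI impI)
      fix n assume "m \<le> n"
      define a where "a = real (cell_index n t) / real (Suc n)"
      define b where "b = real (Suc (cell_index n t)) / real (Suc n)"
      have len: "b - a = 1 / real (Suc n)" by (simp add: a_def b_def diff_divide_distrib[symmetric])
      have ab: "0 \<le> a" "a \<le> t" "t \<le> b" "b \<le> 1"
        using cell_index_bounds[of t n] t by (auto simp: a_def b_def)
      have "a < b" using len by (smt (verit) of_nat_0_less_iff zero_less_Suc divide_pos_pos)
      have "b - a < d"
        using m \<open>m \<le> n\<close> unfolding len by (smt (verit) frac_le of_nat_0_less_iff of_nat_mono Suc_le_mono zero_less_Suc)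
      have eq: "real (Suc n) *\<^sub>S (measure lebesgue {a..b} *\<^sub>S \<Gamma> t) = \<Gamma> t"
        using \<open>a < b\<close> len by (simp add: image_image)
      have "k n t = real (Suc n) *\<^sub>S \<Phi> {a..b}"
        by (simp add: k_def K_def cell_def a_def b_def)
      then have "hausdorff_distance (k n t) (\<Gamma> t) =
          hausdorff_distance (real (Suc n) *\<^sub>S \<Phi> {a..b}) (real (Suc n) *\<^sub>S (measure lebesgue {a..b} *\<^sub>S \<Gamma> t))"
        by (simp only: eq)
      also have "\<dots> \<le> real (Suc n) * hausdorff_distance (\<Phi> {a..b}) (measure lebesgue {a..b} *\<^sub>S \<Gamma> t)"
        using ab \<open>a < b\<close> t by (intro hausdorff_scale_le \<Phi> subintervalsI convex_bounded_scale \<Gamma>) auto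
      also have "\<dots> \<le> real (Suc n) * (\<eta> * (b - a))"
        using ab \<open>a < b\<close> \<open>b - a < d\<close> by (intro mult_left_mono d(2)) auto
      also have "\<dots> = \<eta>" by (simp add: len)
      finally show "hausdorff_distance (k n t) (\<Gamma> t) \<le> \<eta>" .
    qed
  qed
  define \<eta> where "\<eta> = \<epsilon> / 2"
  have \<eta>: "\<eta> > 0" using \<open>\<epsilon> > 0\<close> by (simp add: \<eta>_def)
  define Good where "Good = (\<lambda>m. {t \<in> {0..<1}. \<forall>n\<ge>m. hausdorff_distance (k n t) (k m t) \<le> \<eta>})"
  define P where "P = (\<lambda>j. case prod_decode j of (m, i) \<Rightarrow> (Good m \<inter> {t. cell_index m t = i}) - N)"
  define E where "E = disjointed P"
  have Good: "Good m \<in> sets borel" for m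
  proof -
    have "Good m = {0..<1} \<inter> (\<Inter>n\<in>{m..}. {t. hausdorff_distance (K n (cell_index n t)) (K m (cell_index m t)) \<le> \<eta>})"
      by (auto simp: Good_def k_def)
    also have "\<dots> \<in> sets borel"
      by (intro sets.Int sets.countable_INT' cell_index_rel_sets_borel) auto
    finally show ?thesis .
  qed
  have Psets: "P j \<in> sets lebesgue" for j
  proof -
    obtain m i where mi: "prod_decode j = (m, i)" by force
    have "Good m \<inter> {t. cell_index m t = i} \<in> sets borel"
      by (intro sets.Int Good cell_index_rel_sets_borel[of "\<lambda>a b. a = i" m m])
    then have "Good m \<inter> {t. cell_index m t = i} \<in> sets lebesgue"
      by (simp add: sets_completionI_sets)
    then show ?thesis
      unfolding P_def mi prod.case by (rule sets.Diff) (rule negligible_imp_sets[OF N(1)])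
  qed
  have Psub: "P j \<subseteq> {0..<1} - N" for j
    by (auto simp: P_def Good_def split: prod.splits)
  have cover: "{0..1} - (\<Union>j. P j) \<subseteq> N \<union> {1}"
  proof
    fix t assume t: "t \<in> {0..1} - (\<Union>j. P j)"
    show "t \<in> N \<union> {1}"
    proof (rule ccontr)
      assume "t \<notin> N \<union> {1}"
      then have t': "t \<in> {0..<1} - N" using t by auto
      obtain m where m: "\<And>n. n \<ge> m \<Longrightarrow> hausdorff_distance (k n t) (\<Gamma> t) \<le> \<eta> / 2"
        using conv[OF t', of "\<eta> / 2"] \<eta> by auto
      have "hausdorff_distance (k n t) (k m t) \<le> \<eta>" if "n \<ge> m" for n
      proof -
        have "hausdorff_distance (k n t) (k m t) \<le> hausdorff_distance (k n t) (\<Gamma> t) + hausdorff_distance (\<Gamma> t) (k m t)"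
          using t' by (intro hausdorff_triangle kb \<Gamma>) auto
        then show ?thesis
          using m[OF that] m[of m] hausdorff_commute[of "\<Gamma> t" "k m t"] by simp
      qed
      then have "t \<in> P (prod_encode (m, cell_index m t))"
        using t' by (auto simp: P_def Good_def)
      then show False using t by blast
    qed
  qed
  \<comment> \<open>Both sets are compared with the average over their common cell.\<close>
  have osc: "hausdorff_distance (\<Gamma> s) (\<Gamma> t) \<le> \<epsilon>" if "s \<in> P j" "t \<in> P j" for j s t
  proof -
    obtain m i where mi: "prod_decode j = (m, i)" by force
    have near: "hausdorff_distance (k m u) (\<Gamma> u) \<le> \<eta>" if "u \<in> P j" for u
    proof (rule field_le_epsilon)
      fix e :: real assume "e > 0"
      have u: "u \<in> {0..<1} - N" "u \<in> Good m" using \<open>u \<in> P j\<close> Psub[of j] by (blast, simp add: P_def mi)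
      obtain n where n: "\<And>l. l \<ge> n \<Longrightarrow> hausdorff_distance (k l u) (\<Gamma> u) \<le> e"
        using conv[OF u(1) \<open>e > 0\<close>] by auto
      define l where "l = max n m"
      have "hausdorff_distance (k m u) (\<Gamma> u) \<le> hausdorff_distance (k m u) (k l u) + hausdorff_distance (k l u) (\<Gamma> u)"
        using u by (intro hausdorff_triangle kb \<Gamma>) auto
      moreover have "hausdorff_distance (k l u) (k m u) \<le> \<eta>"
        using u(2) by (simp add: Good_def l_def)
      ultimately show "hausdorff_distance (k m u) (\<Gamma> u) \<le> \<eta> + e"
        using n[of l] hausdorff_commute[of "k m u" "k l u"] by (simp add: l_def)
    qed
    have "k m s = k m t" using that by (simp add: P_def mi k_def)
    moreover have "hausdorff_distance (\<Gamma> s) (\<Gamma> t) \<le> hausdorff_distance (\<Gamma> s) (k m s) + hausdorff_distance (k m s) (\<Gamma> t)"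
      using that Psub[of j] by (intro hausdorff_triangle kb \<Gamma>) auto
    ultimately show ?thesis
      using near[OF that(1)] near[OF that(2)] hausdorff_commute[of "\<Gamma> s" "k m s"] by (simp add: \<eta>_def)
  qed
  have EP: "E j \<subseteq> P j" for j by (simp add: E_def disjointed_subset)
  show ?thesis
  proof
    show "disjoint_family E" unfolding E_def by (rule disjoint_family_disjointed)
    show "E i \<in> sets lebesgue" for i
      using sets.range_disjointed_sets[of P lebesgue] Psets by (auto simp: E_def)
    show "E i \<subseteq> {0..1}" for i using EP[of i] Psub[of i] by auto
    have "(\<Union>i. E i) = (\<Union>i. P i)" unfolding E_def by (rule UN_disjointed_eq)
    then show "negligible ({0..1} - (\<Union>i. E i))"
      using cover N(1) by (auto intro: negligible_subset[of "N \<union> {1}"])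
    show "hausdorff_distance (\<Gamma> s) (\<Gamma> t) \<le> \<epsilon>" if "s \<in> E i" "t \<in> E i" for i s t
      using osc that EP by blast
  qed
qed

section \<open>Integrals of support functions\<close>

lemma finitely_additiveD:
  assumes "finitely_additive \<Phi>" "0 \<le> a" "a \<le> b" "b \<le> c" "c \<le> 1"
  shows "\<Phi> {a..c} = \<Phi> {a..b} + \<Phi> {b..c}"
proof -
  have "{a..b} \<in> subintervals" "{b..c} \<in> subintervals" "{a..b} \<union> {b..c} \<in> subintervals"
    using assms by (auto intro: subintervalsI simp: ivl_disj_un_two_touch)
  moreover have "interior {a..b} \<inter> interior {b..c} = {}" by auto
  ultimately have "\<Phi> ({a..b} \<union> {b..c}) = \<Phi> {a..b} + \<Phi> {b..c}"
    using assms(1) unfolding finitely_additive_def by blast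
  moreover have "{a..b} \<union> {b..c} = {a..c}" using assms by auto
  ultimately show ?thesis by simp
qed

lemma support_additive_increment:
  fixes \<Phi> :: "real set \<Rightarrow> 'a::real_normed_vector set"
  assumes add: "finitely_additive \<Phi>" and \<Phi>: "\<And>I. I \<in> subintervals \<Longrightarrow> \<Phi> I \<in> convex_bounded"
    and "0 \<le> a" "a \<le> b" "b \<le> 1"
  shows "support h (\<Phi> {a..b}) = support h (\<Phi> {0..b}) - support h (\<Phi> {0..a})"
proof -
  have iv: "{0..a} \<in> subintervals" "{a..b} \<in> subintervals"
    using assms by (auto intro: subintervalsI)
  have "\<Phi> {0..b} = \<Phi> {0..a} + \<Phi> {a..b}"
    by (rule finitely_additiveD[OF add order_refl assms(3-5)])
  then show ?thesis
    using support_plus[OF \<Phi>[OF iv(1)] \<Phi>[OF iv(2)], of h] by simp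
qed

lemma support_additive_sum:
  fixes \<Phi> :: "real set \<Rightarrow> 'a::real_normed_vector set"
  assumes add: "finitely_additive \<Phi>" and \<Phi>: "\<And>I. I \<in> subintervals \<Longrightarrow> \<Phi> I \<in> convex_bounded"
    and p: "p tagged_division_of {0..1}"
  shows "(\<Sum>(t, I)\<in>p. support h (\<Phi> I)) = support h (\<Phi> {0..1})"
proof -
  define U where "U = (\<lambda>x. support h (\<Phi> {0..x}))"
  have "(\<Sum>(t, I)\<in>p. support h (\<Phi> I)) = (\<Sum>(t, I)\<in>p. U (Sup I) - U (Inf I))"
  proof (rule sum.cong[OF refl], clarify)
    fix t I assume "(t, I) \<in> p"
    then obtain a b where ab: "I = {a..b}" "0 \<le> a" "a \<le> t" "t \<le> b" "b \<le> 1"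
      by (rule tagged_division_interval[OF p])
    then show "support h (\<Phi> I) = U (Sup I) - U (Inf I)"
      using support_additive_increment[OF add \<Phi>, of a b h] by (simp add: U_def)
  qed
  also have "\<dots> = U 1 - U 0"
    by (rule additive_tagged_division_1[OF _ p]) simp
  also have "\<dots> = support h (\<Phi> {0..1})"
    using support_additive_increment[OF add \<Phi>, of 0 1 h] by (simp add: U_def)
  finally show ?thesis .
qed

text \<open>Support functions are additive, so the Riemann sum minus the claimed integral is a sum of
  differences of support functions, each at most the Hausdorff distance in the variational estimate.\<close>

theorem support_has_integral:
  fixes G :: "real \<Rightarrow> 'a::real_normed_vector set"
  assumes \<Phi>: "\<And>I. I \<in> subintervals \<Longrightarrow> \<Phi> I \<in> convex_bounded" and G: "\<And>t. t \<in> {0..1} \<Longrightarrow> G t \<in> convex_bounded"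
    and add: "finitely_additive \<Phi>"
    and vs: "variationally_small (\<lambda>t I. hausdorff_distance (\<Phi> I) (measure lebesgue I *\<^sub>S G t))"
    and h: "norm h \<le> 1"
  shows "((\<lambda>t. support h (G t)) has_integral support h (\<Phi> {0..1})) {0..1}"
  unfolding has_integral_real
proof (intro allI impI)
  fix e :: real assume "e > 0"
  obtain \<delta> where \<delta>: "\<forall>t\<in>{0..1}. \<delta> t > 0"
    "\<And>p. p tagged_division_of {0..1} \<Longrightarrow> around \<delta> fine p \<Longrightarrow>
       (\<Sum>(t, I)\<in>p. hausdorff_distance (\<Phi> I) (measure lebesgue I *\<^sub>S G t)) < e"
    by (rule variationally_smallE[OF vs \<open>e > 0\<close>]) (rule that, assumption, assumption)
  define g where "g = (\<lambda>t. if t \<in> {0..1} then around \<delta> t else UNIV)"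
  have "norm ((\<Sum>(t, I)\<in>p. measure lborel I *\<^sub>R support h (G t)) - support h (\<Phi> {0..1})) < e"
    if p: "p tagged_division_of {0..1}" "g fine p" for p
  proof -
    have "(\<Sum>(t, I)\<in>p. measure lborel I *\<^sub>R support h (G t)) - support h (\<Phi> {0..1}) =
        (\<Sum>(t, I)\<in>p. measure lborel I *\<^sub>R support h (G t) - support h (\<Phi> I))"
      using support_additive_sum[OF add \<Phi> p(1), of h] by (simp add: case_prod_beta sum_subtractf)
    also have "norm \<dots> \<le> (\<Sum>(t, I)\<in>p. hausdorff_distance (\<Phi> I) (measure lebesgue I *\<^sub>S G t))"
    proof (rule sum_norm_le, clarify)
      fix t I assume "(t, I) \<in> p"
      then obtain a b where ab: "I = {a..b}" "0 \<le> a" "a \<le> t" "t \<le> b" "b \<le> 1"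
        by (rule tagged_division_interval[OF p(1)])
      have I: "I \<in> subintervals" and t: "t \<in> {0..1}"
        using ab by (auto intro: subintervalsI)
      have "measure lborel I *\<^sub>R support h (G t) = support h (measure lebesgue I *\<^sub>S G t)"
        using ab G[OF t] by (simp add: support_scale)
      then show "norm (measure lborel I *\<^sub>R support h (G t) - support h (\<Phi> I)) \<le>
          hausdorff_distance (\<Phi> I) (measure lebesgue I *\<^sub>S G t)"
        using abs_support_diff_le_hausdorff[OF \<Phi>[OF I] convex_bounded_scale[OF G[OF t]] h, of "measure lebesgue I"]
        by simp
    qed
    also have "\<dots> < e" by (rule \<delta>(2)[OF p(1)]) (use fine_around[OF p(1) order_refl] p(2) in \<open>simp add: g_def\<close>)
    finally show ?thesis .
  qed
  moreover have "gauge g" unfolding g_def by (rule gauge_around[OF \<delta>(1)])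
  ultimately show "\<exists>\<gamma>. gauge \<gamma> \<and> (\<forall>\<D>. \<D> tagged_division_of {0..1} \<and> \<gamma> fine \<D> \<longrightarrow>
      norm ((\<Sum>(x, k)\<in>\<D>. measure lborel k *\<^sub>R support h (G x)) - support h (\<Phi> {0..1})) < e)"
    by blast
qed

text \<open>The setting obtained from \<open>\<Gamma>\<close> by subtracting a selection. Since the values contain 0, support
  functions are non-negative.\<close>

locale nonneg_vH_multifunction =
  fixes G :: "real \<Rightarrow> 'a::real_normed_vector set" and \<Phi> :: "real set \<Rightarrow> 'a set"
  assumes \<Phi>: "\<And>I. I \<in> subintervals \<Longrightarrow> \<Phi> I \<in> convex_bounded" and G: "\<And>t. t \<in> {0..1} \<Longrightarrow> G t \<in> convex_bounded"
    and zero: "\<And>t. t \<in> {0..1} \<Longrightarrow> 0 \<in> G t"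
    and additive: "finitely_additive \<Phi>"
    and small: "variationally_small (\<lambda>t I. hausdorff_distance (\<Phi> I) (measure lebesgue I *\<^sub>S G t))"
begin

lemma support_nonneg: "t \<in> {0..1} \<Longrightarrow> 0 \<le> support h (G t)"
  using le_support[of "G t" 0 h] G[of t] zero[of t] by (simp add: convex_bounded_def blinfun.zero_right)

lemma support_absolutely_integrable:
  assumes "norm h \<le> 1" "A \<in> sets lebesgue" "A \<subseteq> {0..1}"
  shows "(\<lambda>t. support h (G t)) absolutely_integrable_on A"
proof -
  have "(\<lambda>t. support h (G t)) absolutely_integrable_on {0..1}"
    using support_has_integral[OF \<Phi> G additive small assms(1)] support_nonneg
    by (intro nonnegative_absolutely_integrable_1) auto
  then show ?thesis
    using assms(2,3) by (rule set_integrable_subset)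
qed

lemma support_integrable:
  assumes "norm h \<le> 1" "A \<in> sets lebesgue" "A \<subseteq> {0..1}"
  shows "(\<lambda>t. support h (G t)) integrable_on A"
  using support_absolutely_integrable[OF assms] by (simp add: absolutely_integrable_on_def)

lemma support_le_norm:
  assumes "norm h \<le> 1" "t \<in> {0..1}"
  shows "support h (G t) \<le> hausdorff_distance (G t) {0}"
  using abs_support_diff_le_hausdorff[OF G[OF assms(2)] convex_bounded_singleton assms(1), of 0]
  by (simp add: blinfun.zero_right)

text \<open>A fixed tagged partition serves all functionals. It is fine for three gauges: for the variational
  error, for the parts of its intervals outside the piece of their tag, and for the tags in no piece. \<open>B\<close> is
  the union of the finitely many pieces that contain a tag. On an interval tagged in the piece \<open>A\<close>, the
  integrand is within \<open>\<eta>\<close> of its value at the tag on \<open>A\<close> and non-negative elsewhere, so the integral over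
  \<open>B\<close> nearly reaches the Riemann sum, which nearly equals the full integral.\<close>

theorem uniformly_small_remainder:
  assumes "\<epsilon> > 0"
  obtains B M where "B \<in> sets lebesgue" "B \<subseteq> {0..1}" "M \<ge> 0"
    "\<And>t h. t \<in> B \<Longrightarrow> norm h \<le> 1 \<Longrightarrow> support h (G t) \<le> M"
    "\<And>h. norm h \<le> 1 \<Longrightarrow> integral ({0..1} - B) (\<lambda>t. support h (G t)) \<le> \<epsilon>"
proof -
  define \<eta> where "\<eta> = \<epsilon> / 4"
  have \<eta>: "\<eta> > 0" using assms by (simp add: \<eta>_def)
  obtain E :: "nat \<Rightarrow> real set" where E: "disjoint_family E" "\<And>i. E i \<in> sets lebesgue" "\<And>i. E i \<subseteq> {0..1}"
    "negligible ({0..1} - (\<Union>i. E i))"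
    "\<And>i s t. s \<in> E i \<Longrightarrow> t \<in> E i \<Longrightarrow> hausdorff_distance (G s) (G t) \<le> \<eta>"
    using vH_measurable_pieces[OF \<Phi> G small \<eta>] by metis
  define nrm where "nrm = (\<lambda>t. hausdorff_distance (G t) {0})"
  have nrm_nonneg: "0 \<le> nrm t" if "t \<in> {0..1}" for t
    using G[OF that] unfolding nrm_def by (intro hausdorff_nonneg) (auto simp: convex_bounded_def)
  define M where "M = (\<lambda>i. if E i = {} then 0 else nrm (SOME t. t \<in> E i) + \<eta>)"
  have nrm_le: "nrm t \<le> M i" if "t \<in> E i" for t i
  proof -
    define s where "s = (SOME t. t \<in> E i)"
    have s: "s \<in> E i" unfolding s_def using that by (rule someI)
    have "nrm t \<le> hausdorff_distance (G t) (G s) + nrm s"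
      unfolding nrm_def using that s E(3)[of i] by (intro hausdorff_triangle G convex_bounded_singleton) auto
    also have "\<dots> \<le> \<eta> + nrm s" using E(5)[OF that s] by simp
    finally show ?thesis using that by (auto simp: M_def s_def)
  qed
  have M_nonneg: "0 \<le> M i" for i
  proof (cases "E i = {}")
    case False
    then obtain t where "t \<in> E i" by blast
    then show ?thesis using nrm_le[of t i] nrm_nonneg[of t] E(3)[of i] by force
  qed (simp add: M_def)
  define S where "S = (\<Union>i. E i)"
  define \<kappa> where "\<kappa> = (\<lambda>t. SOME i. t \<in> E i)"
  have \<kappa>: "t \<in> E (\<kappa> t)" if "t \<in> S" for t
    unfolding \<kappa>_def by (rule someI_ex) (use that in \<open>auto simp: S_def\<close>)
  have negE: "negligible ({t\<in>S. \<kappa> t = i} - E i)" for i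
  proof -
    have "{t\<in>S. \<kappa> t = i} - E i = {}" using \<kappa> by auto
    then show ?thesis by (simp only: negligible_empty)
  qed
  obtain \<delta>1 where \<delta>1: "\<forall>t\<in>{0..1}. \<delta>1 t > 0"
    "\<And>p. p tagged_division_of {0..1} \<Longrightarrow> around \<delta>1 fine p \<Longrightarrow>
       (\<Sum>(t, I)\<in>p. hausdorff_distance (\<Phi> I) (measure lebesgue I *\<^sub>S G t)) < \<eta>"
    by (rule variationally_smallE[OF small \<eta>]) (rule that, assumption, assumption)
  obtain \<delta>2 :: "real \<Rightarrow> real" where \<delta>2: "\<And>t. \<delta>2 t > 0"
    "\<And>p. p tagged_division_of {0..1} \<Longrightarrow> around \<delta>2 fine p \<Longrightarrow>
       (\<Sum>(t, I)\<in>{z\<in>p. fst z \<in> S}. M (\<kappa> t) * measure lebesgue (I - E (\<kappa> t))) < \<eta>"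
    by (rule gauge_for_approximately_covering_sets[OF E(2) M_nonneg negE \<eta>]) (rule that, assumption, assumption)
  obtain \<delta>3 :: "real \<Rightarrow> real" where \<delta>3: "\<And>t. \<delta>3 t > 0"
    "\<And>p. p tagged_division_of {0..1} \<Longrightarrow> around \<delta>3 fine p \<Longrightarrow>
       (\<Sum>(t, I)\<in>{z\<in>p. fst z \<in> {0..1} - S}. nrm t * measure lebesgue I) < \<eta>"
    by (rule gauge_for_negligible_tags[OF E(4)[folded S_def] \<eta>, of nrm]) (rule that, assumption, assumption)
  define \<delta> where "\<delta> = (\<lambda>t. min (\<delta>1 t) (min (\<delta>2 t) (\<delta>3 t)))"
  have "\<forall>t\<in>{0..1}. \<delta> t > 0" using \<delta>1(1) \<delta>2(1) \<delta>3(1) by (simp add: \<delta>_def)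
  then obtain p where p: "p tagged_division_of {0..1}" "around \<delta> fine p"
    by (rule fine_division_exists_around[of \<delta> 0 1]) auto
  have fine: "around \<delta>1 fine p" "around \<delta>2 fine p" "around \<delta>3 fine p"
    using p(2) by (force simp: fine_def \<delta>_def)+
  have finp: "finite p" using tagged_division_ofD(1)[OF p(1)] .
  define r where "r = {z\<in>p. fst z \<in> S}"
  have p_minus_r: "p - r = {z\<in>p. fst z \<in> {0..1} - S}"
  proof -
    have "fst z \<in> {0..1}" if "z \<in> p" for z
      using tagged_division_ofD(2,3)[OF p(1), of "fst z" "snd z"] that by auto
    then show ?thesis by (auto simp: r_def)
  qed
  define J where "J = (\<lambda>z. \<kappa> (fst z)) ` r"
  have finJ: "finite J" using finp by (simp add: J_def r_def)
  define B where "B = (\<Union>i\<in>J. E i)"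
  have B: "B \<in> sets lebesgue" "B \<subseteq> {0..1}"
    using finJ E(2,3) by (auto simp: B_def)
  have main: "integral ({0..1} - B) (\<lambda>t. support h (G t)) \<le> \<epsilon>" if h: "norm h \<le> 1" for h
  proof -
    define q where "q = (\<lambda>t. support h (G t))"
    define qB where "qB = (\<lambda>t. if t \<in> B then q t else 0)"
    define e where "e = (\<lambda>t I. hausdorff_distance (\<Phi> I) (measure lebesgue I *\<^sub>S G t))"
    have q0: "0 \<le> q t" if "t \<in> {0..1}" for t using support_nonneg[OF that] by (simp add: q_def)
    have qint: "q integrable_on A" if "A \<in> sets lebesgue" "A \<subseteq> {0..1}" for A
      unfolding q_def by (rule support_integrable[OF h that])
    have qBint: "qB integrable_on A" if "A \<in> sets lebesgue" "A \<subseteq> {0..1}" for A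
      unfolding qB_def integrable_restrict_Int using that B by (intro qint) auto
    have "integral {0..1} q = integral B q + integral ({0..1} - B) q"
      using B by (subst integral_Un[symmetric]) (auto simp: Un_absorb1 intro!: qint sets.Diff)
    also have "integral B q = integral {0..1} qB"
      unfolding qB_def integral_restrict_Int using B(2) by (simp add: Int_absorb2)
    also have "integral {0..1} qB = (\<Sum>(t, I)\<in>p. integral I qB)"
      using integral_combine_tagged_division_topdown[of qB 0 1 p] qBint[of "{0..1}"] p(1) by simp
    finally have "integral ({0..1} - B) q = integral {0..1} q - (\<Sum>(t, I)\<in>p. integral I qB)" by simp
    also have "integral {0..1} q = (\<Sum>(t, I)\<in>p. support h (\<Phi> I))"
      using support_has_integral[OF \<Phi> G additive small h] support_additive_sum[OF additive \<Phi> p(1), of h]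
      by (simp add: q_def integral_unique)
    also have "(\<Sum>(t, I)\<in>p. support h (\<Phi> I)) - (\<Sum>(t, I)\<in>p. integral I qB) =
        (\<Sum>(t, I)\<in>p. support h (\<Phi> I) - integral I qB)"
      by (simp add: case_prod_beta sum_subtractf)
    also have "\<dots> \<le> (\<Sum>(t, I)\<in>p. e t I + \<eta> * measure lborel I +
        (if t \<in> S then M (\<kappa> t) * measure lebesgue (I - E (\<kappa> t)) else nrm t * measure lebesgue I))"
    proof (rule sum_mono, clarify)
      fix t I assume tI: "(t, I) \<in> p"
      then obtain a b where ab: "I = {a..b}" "0 \<le> a" "a \<le> t" "t \<le> b" "b \<le> 1"
        by (rule tagged_division_interval[OF p(1)])
      have I: "I \<in> subintervals" "I \<in> lmeasurable" "I \<subseteq> {0..1}" and t: "t \<in> {0..1}"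
        using ab by (auto intro: subintervalsI)
      define L where "L = measure lebesgue I"
      have L: "L \<ge> 0" "measure lborel I = L" using ab by (simp_all add: L_def)
      have up: "support h (\<Phi> I) \<le> L * q t + e t I"
      proof -
        have "support h (measure lebesgue I *\<^sub>S G t) = L * q t"
          unfolding L_def q_def by (rule support_scale[OF G[OF t]]) simp
        then show ?thesis
          using abs_support_diff_le_hausdorff[OF \<Phi>[OF I(1)] convex_bounded_scale[OF G[OF t]] h, of "measure lebesgue I"]
          by (simp add: e_def)
      qed
      have qn: "q t \<le> nrm t" using support_le_norm[OF h t] by (simp add: q_def nrm_def)
      show "support h (\<Phi> I) - integral I qB \<le> e t I + \<eta> * measure lborel I +
        (if t \<in> S then M (\<kappa> t) * measure lebesgue (I - E (\<kappa> t)) else nrm t * measure lebesgue I)"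
      proof (cases "t \<in> S")
        case False
        have "0 \<le> integral I qB"
          using I q0 B by (intro integral_nonneg qBint) (auto simp: qB_def)
        moreover have "L * q t \<le> nrm t * L" using qn L by (simp add: mult.commute mult_left_mono)
        ultimately show ?thesis using up False \<eta> L
          by (simp add: L_def[symmetric]) (smt (verit) mult_nonneg_nonneg)
      next
        case True
        define A where "A = E (\<kappa> t)"
        have tA: "t \<in> A" using \<kappa>[OF True] by (simp add: A_def)
        have A: "A \<in> sets lebesgue" using E(2) by (simp add: A_def)
        have "(t, I) \<in> r" using tI True by (simp add: r_def)
        then have AB: "A \<subseteq> B" by (auto simp: B_def J_def A_def)
        have IA: "I \<inter> A \<in> lmeasurable" "I - A \<in> lmeasurable"
          using I(2) A by (auto intro: fmeasurable_Int_fmeasurable fmeasurable_Diff)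
        define L1 where "L1 = measure lebesgue (I \<inter> A)"
        define L2 where "L2 = measure lebesgue (I - A)"
        have "measure lebesgue ((I \<inter> A) \<union> (I - A)) = L1 + L2"
        proof -
          have dis: "(I \<inter> A) \<inter> (I - A) = {}" by blast
          show ?thesis unfolding L1_def L2_def measure_Un3[OF IA] dis by simp
        qed
        then have LL: "L = L1 + L2" by (simp add: L_def Un_Diff_Int Int_Diff_Un)
        have L12: "L1 \<ge> 0" "L2 \<ge> 0" by (simp_all add: L1_def L2_def)
        \<comment> \<open>On the piece the integrand of the left side lies below \<open>qB\<close>; off the piece it is 0.\<close>
        have low: "(q t - \<eta>) * L1 \<le> integral I qB"
        proof -
          have 1: "((\<lambda>s. (q t - \<eta>) * indicat_real A s) has_integral (q t - \<eta>) * L1) I"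
          proof -
            have "(indicat_real A has_integral L1) I"
            proof -
              have "integral I (indicat_real A) = L1"
                unfolding L1_def using integral_indicator[of A I] IA(1) by (simp add: Int_commute)
              moreover have "(\<lambda>x. if x \<in> A then 1 else 0 :: real) integrable_on I"
                unfolding integrable_restrict_Int using IA(1) lmeasurable_iff_integrable_on[of "A \<inter> I"] by (simp add: Int_commute)
              then have "indicat_real A integrable_on I"
                by (simp add: indicator_def[abs_def] of_bool_def)
              ultimately show ?thesis by (simp add: has_integral_iff)
            qed
            then show ?thesis by (rule has_integral_mult_right)
          qed
          have "(q t - \<eta>) * indicat_real A s \<le> qB s" if s: "s \<in> I" for s
          proof (cases "s \<in> A")
            case True
            have "q t \<le> q s + \<eta>"
              using abs_support_diff_le_hausdorff[OF G G h, of t s] E(5)[of t "\<kappa> t" s] True tA s I(3) t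
              by (auto simp: q_def A_def)
            then show ?thesis using True AB by (auto simp: qB_def)
          next
            case False
            then show ?thesis using q0[of s] s I(3) by (auto simp: qB_def)
          qed
          then show ?thesis
            using has_integral_le[OF 1 integrable_integral[OF qBint]] I by auto
        qed
        have "L * q t - integral I qB \<le> q t * L2 + \<eta> * L1"
          using low by (simp add: LL algebra_simps)
        also have "\<dots> \<le> M (\<kappa> t) * L2 + \<eta> * L"
          using L12 \<eta> qn nrm_le[of t "\<kappa> t"] \<kappa>[OF True] LL
          by (intro add_mono mult_right_mono mult_left_mono) auto
        finally show ?thesis
          using up True by (simp add: L(2) L2_def A_def)
      qed
    qed
    also have "\<dots> = (\<Sum>(t, I)\<in>p. e t I) + \<eta> * (\<Sum>(t, I)\<in>p. measure lborel I) +
        (\<Sum>(t, I)\<in>p. if t \<in> S then M (\<kappa> t) * measure lebesgue (I - E (\<kappa> t)) else nrm t * measure lebesgue I)"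
      by (simp add: case_prod_beta sum.distrib sum_distrib_left)
    also have "(\<Sum>(t, I)\<in>p. measure lborel I) = 1"
      using additive_content_tagged_division[of p 0 1] p(1) by simp
    also have "(\<Sum>(t, I)\<in>p. if t \<in> S then M (\<kappa> t) * measure lebesgue (I - E (\<kappa> t)) else nrm t * measure lebesgue I) =
        (\<Sum>(t, I)\<in>r. M (\<kappa> t) * measure lebesgue (I - E (\<kappa> t))) + (\<Sum>(t, I)\<in>p - r. nrm t * measure lebesgue I)"
    proof -
      have "(\<Sum>(t, I)\<in>p. if t \<in> S then M (\<kappa> t) * measure lebesgue (I - E (\<kappa> t)) else nrm t * measure lebesgue I) =
          (\<Sum>(t, I)\<in>r. if t \<in> S then M (\<kappa> t) * measure lebesgue (I - E (\<kappa> t)) else nrm t * measure lebesgue I) +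
          (\<Sum>(t, I)\<in>p - r. if t \<in> S then M (\<kappa> t) * measure lebesgue (I - E (\<kappa> t)) else nrm t * measure lebesgue I)"
        using finp by (subst sum.subset_diff[of r p]) (auto simp: r_def)
      also have "\<dots> = (\<Sum>(t, I)\<in>r. M (\<kappa> t) * measure lebesgue (I - E (\<kappa> t))) + (\<Sum>(t, I)\<in>p - r. nrm t * measure lebesgue I)"
        by (intro arg_cong2[where f="(+)"] sum.cong) (auto simp: r_def)
      finally show ?thesis .
    qed
    finally have "integral ({0..1} - B) q \<le> (\<Sum>(t, I)\<in>p. e t I) + \<eta> * 1 +
        ((\<Sum>(t, I)\<in>r. M (\<kappa> t) * measure lebesgue (I - E (\<kappa> t))) + (\<Sum>(t, I)\<in>p - r. nrm t * measure lebesgue I))" .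
    moreover have "(\<Sum>(t, I)\<in>p. e t I) < \<eta>"
      using \<delta>1(2)[OF p(1) fine(1)] by (simp only: e_def)
    moreover have "(\<Sum>(t, I)\<in>r. M (\<kappa> t) * measure lebesgue (I - E (\<kappa> t))) < \<eta>"
      using \<delta>2(2)[OF p(1) fine(2)] by (simp only: r_def)
    moreover have "(\<Sum>(t, I)\<in>p - r. nrm t * measure lebesgue I) < \<eta>"
      using \<delta>3(2)[OF p(1) fine(3)] by (simp only: p_minus_r)
    moreover have "\<epsilon> = \<eta> + \<eta> * 1 + (\<eta> + \<eta>)" by (simp add: \<eta>_def)
    ultimately have "integral ({0..1} - B) q \<le> \<epsilon>" by linarith
    then show ?thesis by (simp only: q_def)
  qed
  define M' where "M' = (\<Sum>i\<in>J. M i)"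
  show ?thesis
  proof
    show "B \<in> sets lebesgue" "B \<subseteq> {0..1}" by (fact B)+
    show "M' \<ge> 0" unfolding M'_def by (intro sum_nonneg M_nonneg)
    show "support h (G t) \<le> M'" if t: "t \<in> B" and h: "norm h \<le> 1" for t h
    proof -
      obtain i where i: "i \<in> J" "t \<in> E i" using t unfolding B_def by blast
      have "support h (G t) \<le> M i"
        using support_le_norm[OF h, of t] nrm_le[OF i(2)] t B(2) by (auto simp: nrm_def)
      also have "\<dots> \<le> M'"
        unfolding M'_def by (rule member_le_sum[OF i(1) _ finJ]) (simp add: M_nonneg)
      finally show ?thesis .
    qed
  qed (rule main)
qed

text \<open>Outside \<open>B\<close> the integrals are small by \<open>uniformly_small_remainder\<close>, and on \<open>B\<close> the integrands have a
  common bound.\<close>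

theorem uniformly_absolutely_continuous:
  assumes "\<epsilon> > 0"
  obtains \<eta> where "\<eta> > 0" "\<And>A h. A \<in> sets lebesgue \<Longrightarrow> A \<subseteq> {0..1} \<Longrightarrow> measure lebesgue A < \<eta> \<Longrightarrow> norm h \<le> 1 \<Longrightarrow>
      integral A (\<lambda>t. support h (G t)) \<le> \<epsilon>"
proof -
  obtain B M where B: "B \<in> sets lebesgue" "B \<subseteq> {0..1}" "M \<ge> 0"
    "\<And>t h. t \<in> B \<Longrightarrow> norm h \<le> 1 \<Longrightarrow> support h (G t) \<le> M"
    "\<And>h. norm h \<le> 1 \<Longrightarrow> integral ({0..1} - B) (\<lambda>t. support h (G t)) \<le> \<epsilon> / 2"
    using uniformly_small_remainder[of "\<epsilon> / 2"] assms by (metis half_gt_zero)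
  define \<eta> where "\<eta> = (\<epsilon> / 2) / (M + 1)"
  have "\<eta> > 0" using assms B(3) by (simp add: \<eta>_def)
  moreover have "integral A (\<lambda>t. support h (G t)) \<le> \<epsilon>"
    if A: "A \<in> sets lebesgue" "A \<subseteq> {0..1}" "measure lebesgue A < \<eta>" and h: "norm h \<le> 1" for A h
  proof -
    define q where "q = (\<lambda>t. support h (G t))"
    have qint: "q integrable_on A" if "A \<in> sets lebesgue" "A \<subseteq> {0..1}" for A
      unfolding q_def by (rule support_integrable[OF h that])
    have Alm: "A \<in> lmeasurable"
      using A by (intro bounded_set_imp_lmeasurable) (auto intro: bounded_subset[of "{0..1}"])
    have ABlm: "A \<inter> B \<in> lmeasurable" using Alm B(1) by (rule fmeasurable_Int_fmeasurable)
    have "integral A q = integral (A - B) q + integral (A \<inter> B) q"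
    proof -
      have eq: "A = (A - B) \<union> (A \<inter> B)" by blast
      have "integral ((A - B) \<union> (A \<inter> B)) q = integral (A - B) q + integral (A \<inter> B) q"
        using A B by (intro integral_Un qint) (auto intro: negligible_subset[OF negligible_empty])
      with eq show ?thesis by simp
    qed
    also have "integral (A - B) q \<le> integral ({0..1} - B) q"
      using A B support_nonneg by (intro integral_subset_le qint) (auto simp: q_def)
    also have "\<dots> \<le> \<epsilon> / 2" using B(5)[OF h] by (simp add: q_def)
    also have "integral (A \<inter> B) q \<le> integral (A \<inter> B) (\<lambda>t. M)"
      using A B(1,2,4) h ABlm by (intro integral_le qint integrable_on_const) (auto simp: q_def)
    also have "\<dots> = M * measure lebesgue (A \<inter> B)"
      using ABlm lmeasure_integral[OF ABlm] integral_mult_right[of "A \<inter> B" M "\<lambda>_. 1"] by simp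
    also have "\<dots> \<le> (M + 1) * \<eta>"
    proof (intro mult_mono)
      have "measure lebesgue (A \<inter> B) \<le> measure lebesgue A"
        using Alm ABlm by (intro measure_mono_fmeasurable) (auto dest: fmeasurableD)
      then show "measure lebesgue (A \<inter> B) \<le> \<eta>" using A(3) by simp
    qed (use B(3) in auto)
    also have "\<dots> = \<epsilon> / 2"
    proof -
      have "c * (\<epsilon> / 2 / c) = \<epsilon> / 2" if "c \<noteq> 0" for c :: real using that by simp
      from this[of "M + 1"] show ?thesis using B(3) by (simp only: \<eta>_def)
    qed
    finally show ?thesis by (simp add: q_def)
  qed
  ultimately show ?thesis by (rule that)
qed

end

section \<open>Birkhoff integrability of multifunctions containing zero\<close>

text \<open>The given partition consists of pieces of small oscillation and a null set. In a finer one, the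
  term of a set \<open>A\<close> has support function within \<open>\<epsilon>' * |A|\<close> of the integral over \<open>A\<close>, for all functionals at
  once. Hence uniform absolute continuity bounds the Hausdorff size of tails, which gives the sum, as
  well as the distance of the finite partial sums from the integral.\<close>

theorem nonneg_vH_birkhoff_integrable:
  fixes G :: "real \<Rightarrow> 'a::banach set"
  assumes nn: "nonneg_vH_multifunction G \<Phi>" and \<Phi>cwk: "\<Phi> {0..1} \<in> cwk"
    and Gcwk: "\<And>t. t \<in> {0..1} \<Longrightarrow> G t \<in> cwk"
  shows "birkhoff_integrable G"
  unfolding birkhoff_integrable_def
proof (intro bexI[OF _ \<Phi>cwk] allI impI)
  interpret nonneg_vH_multifunction G \<Phi> by (rule nn)
  fix \<epsilon> :: real assume "\<epsilon> > 0"
  \<comment> \<open>Three errors of size \<open>\<epsilon>'\<close> will occur: from the oscillation, from the part of the interval not yet summed, and from the tail of the series.\<close>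
  define \<epsilon>' where "\<epsilon>' = \<epsilon> / 4"
  have \<epsilon>': "\<epsilon>' > 0" using \<open>\<epsilon> > 0\<close> by (simp add: \<epsilon>'_def)
  obtain E :: "nat \<Rightarrow> real set" where E: "disjoint_family E" "\<And>i. E i \<in> sets lebesgue" "\<And>i. E i \<subseteq> {0..1}"
    "negligible ({0..1} - (\<Union>i. E i))"
    "\<And>i s t. s \<in> E i \<Longrightarrow> t \<in> E i \<Longrightarrow> hausdorff_distance (G s) (G t) \<le> \<epsilon>'"
    by (rule vH_measurable_pieces[OF \<Phi> G small \<epsilon>']) (assumption, assumption, rule that, assumption+)
  define N where "N = {0..1} - (\<Union>i. E i)"
  define P\<^sub>0 where "P\<^sub>0 = insert N (range E) - {{}}"
  have P0: "countable_partition P\<^sub>0"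
    unfolding countable_partition_def
  proof (intro conjI)
    show "countable P\<^sub>0" by (simp add: P\<^sub>0_def)
    have "N \<in> sets lebesgue" unfolding N_def by (rule negligible_imp_sets[OF E(4)])
    then show "P\<^sub>0 \<subseteq> sets (lebesgue_on {0..1})"
      using E(2,3) by (auto simp: P\<^sub>0_def sets_restrict_space_iff N_def)
    show "partition_on {0..1} P\<^sub>0"
    proof (rule partition_onI)
      have "\<Union>P\<^sub>0 = N \<union> (\<Union>i. E i)" unfolding P\<^sub>0_def by blast
      also have "\<dots> = {0..1}" unfolding N_def using E(3) by blast
      finally show "\<Union>P\<^sub>0 = {0..1}" .
      show "disjnt A B" if "A \<in> P\<^sub>0" "B \<in> P\<^sub>0" "A \<noteq> B" for A B
      proof -
        have NE: "N \<inter> E i = {}" for i unfolding N_def by blast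
        have EE: "E i \<inter> E j = {}" if "E i \<noteq> E j" for i j
          using disjoint_family_onD[OF E(1), of i j] that by auto
        have "A = N \<or> A \<in> range E" "B = N \<or> B \<in> range E" using that by (auto simp: P\<^sub>0_def)
        then show ?thesis using NE EE \<open>A \<noteq> B\<close> unfolding disjnt_def by (metis Int_commute imageE)
      qed
    qed (simp add: P\<^sub>0_def)
  qed
  show "\<exists>P\<^sub>0. countable_partition P\<^sub>0 \<and>
      (\<forall>P t. countable_partition P \<and> refines {0..1} P P\<^sub>0 \<and> (\<forall>A\<in>P. t A \<in> A) \<longrightarrow>
        (\<exists>S\<in>cwk. hausdorff_has_sum (\<lambda>A. measure lebesgue A *\<^sub>S G (t A)) P S \<and> hausdorff_distance (\<Phi> {0..1}) S < \<epsilon>))"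
  proof (intro exI[of _ P\<^sub>0] conjI allI impI P0)
    fix P t assume asm: "countable_partition P \<and> refines {0..1} P P\<^sub>0 \<and> (\<forall>A\<in>P. t A \<in> A)"
    have P: "countable P" "partition_on {0..1} P" and Pleb: "\<And>A. A \<in> P \<Longrightarrow> A \<in> sets lebesgue"
      using asm by (auto simp: countable_partition_def sets_restrict_space_iff)
    have PU: "\<Union>P = {0..1}" using P(2) by (simp add: partition_on_def)
    have P01: "A \<subseteq> {0..1}" if "A \<in> P" for A using that PU by blast
    have Plm: "A \<in> lmeasurable" if "A \<in> P" for A
      using Pleb[OF that] P01[OF that] by (intro bounded_set_imp_lmeasurable) (auto intro: bounded_subset[of "{0..1}"])
    have tA: "t A \<in> A" "t A \<in> {0..1}" if "A \<in> P" for A using asm P01[OF that] that by auto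
    have piece: "A \<subseteq> N \<or> (\<exists>i. A \<subseteq> E i)" if "A \<in> P" for A
      using asm that by (auto simp: refines_def P\<^sub>0_def)
    define K where "K = (\<lambda>A. measure lebesgue A *\<^sub>S G (t A))"
    have Kcwk: "K A \<in> cwk" if "A \<in> P" for A
      unfolding K_def by (intro cwk_scale Gcwk tA that)
    have K0: "0 \<in> K A" if "A \<in> P" for A
      unfolding K_def using zero[OF tA(2)[OF that]] by (auto intro!: image_eqI[of _ _ 0])
    have Kbcx: "(\<Sum>A\<in>F. K A) \<in> convex_bounded" if "F \<subseteq> P" for F
      by (rule convex_bounded_sum, rule cwk_convex_bounded, rule Kcwk) (use that in blast)
    have suppK: "support h (\<Sum>A\<in>F. K A) = (\<Sum>A\<in>F. measure lebesgue A * support h (G (t A)))" if "F \<subseteq> P" for F h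
    proof -
      have "support h (\<Sum>A\<in>F. K A) = (\<Sum>A\<in>F. support h (K A))"
        by (rule support_sum, rule cwk_convex_bounded, rule Kcwk) (use that in blast)
      also have "\<dots> = (\<Sum>A\<in>F. measure lebesgue A * support h (G (t A)))"
        unfolding K_def
      proof (rule sum.cong[OF refl], rule support_scale[OF G measure_nonneg])
        fix A assume "A \<in> F"
        then show "t A \<in> {0..1}" using that by (intro tA(2)) blast
      qed
      finally show ?thesis .
    qed
    have suppK0: "0 \<le> support h (\<Sum>A\<in>F. K A)" if "F \<subseteq> P" for F h
      unfolding suppK[OF that]
    proof (rule sum_nonneg)
      fix A assume "A \<in> F"
      then have "0 \<le> support h (G (t A))" using that by (intro support_nonneg tA(2)) blast
      then show "0 \<le> measure lebesgue A * support h (G (t A))" by simp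
    qed
    have close: "\<bar>measure lebesgue A * support h (G (t A)) - integral A (\<lambda>s. support h (G s))\<bar> \<le> \<epsilon>' * measure lebesgue A"
      if A: "A \<in> P" and h: "norm h \<le> 1" for A h
    proof (cases "A \<subseteq> N")
      case True
      then have "negligible A" using E(4) negligible_subset unfolding N_def by blast
      then show ?thesis
        using integral_unique[OF has_integral_negligible[of A A "\<lambda>s. support h (G s)"]]
        by (simp add: negligible_imp_measure0)
    next
      case False
      then obtain i where i: "A \<subseteq> E i" using piece[OF A] by blast
      define q where "q = (\<lambda>s. support h (G s))"
      have qint: "q integrable_on A" unfolding q_def by (rule support_integrable[OF h Pleb[OF A] P01[OF A]])
      have cint: "(\<lambda>s. c) integrable_on A" for c :: real using Plm[OF A] by (rule integrable_on_const)
      have cval: "integral A (\<lambda>s. c) = c * measure lebesgue A" for c :: real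
        using lmeasure_integral[OF Plm[OF A]] integral_mult_right[of A c "\<lambda>_. 1"] by simp
      have near: "\<bar>q (t A) - q s\<bar> \<le> \<epsilon>'" if s: "s \<in> A" for s
      proof -
        have "\<bar>q (t A) - q s\<bar> \<le> hausdorff_distance (G (t A)) (G s)"
          unfolding q_def using tA[OF A] s P01[OF A] by (intro abs_support_diff_le_hausdorff G h) auto
        also have "\<dots> \<le> \<epsilon>'" using E(5)[of "t A" i s] tA(1)[OF A] s i by blast
        finally show ?thesis .
      qed
      have "integral A q \<le> integral A (\<lambda>s. q (t A) + \<epsilon>')"
        by (intro integral_le qint cint) (use near in force)
      moreover have "integral A (\<lambda>s. q (t A) - \<epsilon>') \<le> integral A q"
        by (intro integral_le qint cint) (use near in force)
      ultimately show ?thesis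
        unfolding cval by (simp add: q_def abs_le_iff algebra_simps)
    qed
    have meas_sum: "(\<Sum>A\<in>F. measure lebesgue A) = measure lebesgue (\<Union>F)"
      and int_sum: "norm h \<le> 1 \<Longrightarrow> (\<Sum>A\<in>F. integral A (\<lambda>s. support h (G s))) = integral (\<Union>F) (\<lambda>s. support h (G s))"
      if F: "F \<subseteq> P" "finite F" for F and h :: "'a \<Rightarrow>\<^sub>L real"
    proof -
      have dis: "pairwise (\<lambda>A B. negligible (A \<inter> B)) F"
      proof (rule pairwiseI)
        fix A B assume "A \<in> F" "B \<in> F" "A \<noteq> B"
        then have "A \<inter> B = {}" using P(2) F(1) unfolding partition_on_def disjoint_def by blast
        then show "negligible (A \<inter> B)" by simp
      qed
      show "(\<Sum>A\<in>F. measure lebesgue A) = measure lebesgue (\<Union>F)"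
        using F Plm dis by (intro measure_negligible_finite_Union[symmetric]) auto
      show "(\<Sum>A\<in>F. integral A (\<lambda>s. support h (G s))) = integral (\<Union>F) (\<lambda>s. support h (G s))" if h: "norm h \<le> 1"
      proof -
        have "((\<lambda>s. support h (G s)) has_integral (\<Sum>A\<in>F. integral A (\<lambda>s. support h (G s)))) (\<Union>A\<in>F. A)"
        proof (rule has_integral_UN[OF F(2) _ dis])
          fix A assume "A \<in> F"
          then show "((\<lambda>s. support h (G s)) has_integral integral A (\<lambda>s. support h (G s))) A"
            using F by (intro integrable_integral support_integrable h Pleb P01) auto
        qed
        then show ?thesis by (simp add: integral_unique)
      qed
    qed
    have closeF: "\<bar>support h (\<Sum>A\<in>F. K A) - integral (\<Union>F) (\<lambda>s. support h (G s))\<bar> \<le> \<epsilon>' * measure lebesgue (\<Union>F)"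
      if F: "F \<subseteq> P" "finite F" and h: "norm h \<le> 1" for F h
    proof -
      have "\<bar>support h (\<Sum>A\<in>F. K A) - integral (\<Union>F) (\<lambda>s. support h (G s))\<bar> =
          \<bar>\<Sum>A\<in>F. measure lebesgue A * support h (G (t A)) - integral A (\<lambda>s. support h (G s))\<bar>"
        by (simp add: suppK[OF F(1)] int_sum[OF F h, symmetric] sum_subtractf)
      also have "\<dots> \<le> (\<Sum>A\<in>F. \<epsilon>' * measure lebesgue A)"
        by (rule order_trans[OF sum_abs sum_mono]) (use close F h in blast)
      also have "\<dots> = \<epsilon>' * measure lebesgue (\<Union>F)"
        by (simp add: meas_sum[OF F] flip: sum_distrib_left)
      finally show ?thesis .
    qed
    have UP: "\<Union>F \<in> sets lebesgue" "\<Union>F \<subseteq> {0..1}" if "F \<subseteq> P" "finite F" for F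
      by (rule sets.finite_Union) (use that Pleb PU in blast)+
    have exhaust: "\<exists>F0. finite F0 \<and> F0 \<subseteq> P \<and> measure lebesgue ({0..1} - \<Union>F0) < d" if "d > 0" for d
    proof -
      have sub: "measure lebesgue (\<Union>D) \<le> 1" if "D \<subseteq> P" "finite D" for D
      proof -
        have "measure lebesgue (\<Union>D) \<le> measure lebesgue {0..1::real}"
          using UP[OF that] by (intro measure_mono_fmeasurable) auto
        then show ?thesis by simp
      qed
      obtain F0 where F0: "F0 \<subseteq> P" "finite F0" "measure lebesgue (\<Union>P) - d < measure lebesgue (\<Union>F0)"
        by (rule measure_countable_Union_approachable[OF P(1) \<open>d > 0\<close> Plm sub]) ((assumption | rule that)+)
      have "measure lebesgue ({0..1} - \<Union>F0) = measure lebesgue {0..1::real} - measure lebesgue (\<Union>F0)"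
        using UP[OF F0(1,2)] by (intro measurable_measure_Diff) auto
      with F0 show ?thesis unfolding PU by (intro exI[of _ F0]) auto
    qed
    have tail: "\<exists>F0. finite F0 \<and> F0 \<subseteq> P \<and>
        (\<forall>F. finite F \<and> F \<subseteq> P - F0 \<longrightarrow> hausdorff_distance (\<Sum>A\<in>F. K A) {0} \<le> e)" if "e > 0" for e
    proof -
      have e2: "e / 2 > 0" using \<open>e > 0\<close> by simp
      obtain \<eta> where \<eta>: "\<eta> > 0" "\<And>A h. A \<in> sets lebesgue \<Longrightarrow> A \<subseteq> {0..1} \<Longrightarrow> measure lebesgue A < \<eta> \<Longrightarrow> norm h \<le> 1 \<Longrightarrow>
          integral A (\<lambda>t. support h (G t)) \<le> e / 2"
        by (rule uniformly_absolutely_continuous[OF e2]) (rule that, assumption+)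
      define d where "d = min \<eta> (e / (2 * \<epsilon>'))"
      have "d > 0" using \<eta>(1) \<open>e > 0\<close> \<epsilon>' by (simp add: d_def)
      from exhaust[OF this] obtain F0 where F0: "finite F0" "F0 \<subseteq> P" "measure lebesgue ({0..1} - \<Union>F0) < d"
        by (elim exE conjE)
      have "hausdorff_distance (\<Sum>A\<in>F. K A) {0} \<le> e" if F: "finite F" "F \<subseteq> P - F0" for F
      proof (rule hausdorff_zero_le_supportI)
        have FP: "F \<subseteq> P" using F by blast
        show "(\<Sum>A\<in>F. K A) \<in> convex_bounded" by (rule Kbcx[OF FP])
        fix h :: "'a \<Rightarrow>\<^sub>L real" assume h: "norm h \<le> 1"
        have UF: "\<Union>F \<in> sets lebesgue" "\<Union>F \<subseteq> {0..1}"
          using UP[OF FP F(1)] by auto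
        have "\<Union>F \<subseteq> {0..1} - \<Union>F0"
        proof -
          have "A \<inter> B = {}" if "A \<in> F" "B \<in> F0" for A B
          proof -
            have "A \<in> P" "B \<in> P" "A \<noteq> B" using that F F0(2) by auto
            then show ?thesis using P(2) by (auto simp: partition_on_def disjoint_def)
          qed
          with UF(2) show ?thesis by blast
        qed
        then have "measure lebesgue (\<Union>F) \<le> measure lebesgue ({0..1} - \<Union>F0)"
          using UF UP[OF F0(2,1)] by (intro measure_mono_fmeasurable) (auto intro!: fmeasurable_Diff)
        then have m: "measure lebesgue (\<Union>F) < d" using F0(3) by simp
        have "support h (\<Sum>A\<in>F. K A) \<le> integral (\<Union>F) (\<lambda>s. support h (G s)) + \<epsilon>' * measure lebesgue (\<Union>F)"
          using closeF[OF FP F(1) h] by linarith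
        also have "integral (\<Union>F) (\<lambda>s. support h (G s)) \<le> e / 2"
          using m by (intro \<eta>(2) UF h) (simp add: d_def)
        also have "\<epsilon>' * measure lebesgue (\<Union>F) \<le> \<epsilon>' * (e / (2 * \<epsilon>'))"
          using m \<epsilon>' by (intro mult_left_mono) (auto simp: d_def)
        also have "\<dots> = e / 2" using \<epsilon>' by simp
        finally show "\<bar>support h (\<Sum>A\<in>F. K A)\<bar> \<le> e" using suppK0[OF FP, of h] by simp
      qed
      with F0(1,2) show ?thesis by metis
    qed
    obtain S where S: "S \<in> cwk" "hausdorff_has_sum K P S"
      by (rule cwk_unconditional_sum[OF Kcwk K0 tail]) ((assumption | rule that)+)
    have "hausdorff_distance (\<Phi> {0..1}) S < \<epsilon>"
    proof -
      obtain \<eta> where \<eta>: "\<eta> > 0" "\<And>A h. A \<in> sets lebesgue \<Longrightarrow> A \<subseteq> {0..1} \<Longrightarrow> measure lebesgue A < \<eta> \<Longrightarrow> norm h \<le> 1 \<Longrightarrow>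
          integral A (\<lambda>t. support h (G t)) \<le> \<epsilon>'"
        by (rule uniformly_absolutely_continuous[OF \<epsilon>']) (rule that, assumption+)
      from exhaust[OF \<eta>(1)] obtain F0 where F0: "finite F0" "F0 \<subseteq> P" "measure lebesgue ({0..1} - \<Union>F0) < \<eta>"
        by (elim exE conjE)
      have "\<forall>\<^sub>F F in finite_subsets_at_top P. dist (hausdorff_distance (\<Sum>A\<in>F. K A) S) 0 < \<epsilon>'"
        using S(2) \<epsilon>' unfolding hausdorff_has_sum_def by (rule tendstoD)
      then obtain F1 where F1: "finite F1" "F1 \<subseteq> P"
        "\<And>F. finite F \<Longrightarrow> F1 \<subseteq> F \<Longrightarrow> F \<subseteq> P \<Longrightarrow> dist (hausdorff_distance (\<Sum>A\<in>F. K A) S) 0 < \<epsilon>'"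
        unfolding eventually_finite_subsets_at_top by metis
      define F where "F = F0 \<union> F1"
      have F: "F \<subseteq> P" "finite F" using F0 F1 by (auto simp: F_def)
      have FS: "hausdorff_distance (\<Sum>A\<in>F. K A) S < \<epsilon>'"
        using F1(3)[of F] F by (auto simp: F_def dist_real_def)
      have UF: "\<Union>F \<in> sets lebesgue" "\<Union>F \<subseteq> {0..1}"
        using UP[OF F] by auto
      have "measure lebesgue ({0..1} - \<Union>F) \<le> measure lebesgue ({0..1} - \<Union>F0)"
        using UP[OF F0(2,1)] UF by (intro measure_mono_fmeasurable) (auto intro!: fmeasurable_Diff sets.Diff simp: F_def)
      then have m: "measure lebesgue ({0..1} - \<Union>F) < \<eta>" using F0(3) by simp
      have "measure lebesgue (\<Union>F) \<le> measure lebesgue {0..1::real}"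
        using UF by (intro measure_mono_fmeasurable) auto
      then have m1: "measure lebesgue (\<Union>F) \<le> 1" by simp
      have "hausdorff_distance (\<Phi> {0..1}) (\<Sum>A\<in>F. K A) \<le> 2 * \<epsilon>'"
      proof (rule hausdorff_le_supportI[OF cwk_convex_bounded[OF \<Phi>cwk] Kbcx[OF F(1)]])
        fix h :: "'a \<Rightarrow>\<^sub>L real" assume h: "norm h \<le> 1"
        define q where "q = (\<lambda>s. support h (G s))"
        have qint: "q integrable_on A" if "A \<in> sets lebesgue" "A \<subseteq> {0..1}" for A
          unfolding q_def by (rule support_integrable[OF h that])
        have "support h (\<Phi> {0..1}) = integral {0..1} q"
          using support_has_integral[OF \<Phi> G additive small h] by (simp add: q_def integral_unique)
        also have "\<dots> = integral (\<Union>F) q + integral ({0..1} - \<Union>F) q"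
          using UF by (subst integral_Un[symmetric]) (auto simp: Un_absorb1 intro!: qint sets.Diff)
        finally have "support h (\<Phi> {0..1}) - integral (\<Union>F) q = integral ({0..1} - \<Union>F) q" by simp
        moreover have "integral ({0..1} - \<Union>F) q \<le> \<epsilon>'"
          unfolding q_def using m UF(1) by (intro \<eta>(2) h) (auto intro!: sets.Diff)
        moreover have "0 \<le> integral ({0..1} - \<Union>F) q"
          using UF support_nonneg by (intro integral_nonneg qint) (auto simp: q_def intro!: sets.Diff)
        moreover have "\<bar>support h (\<Sum>A\<in>F. K A) - integral (\<Union>F) q\<bar> \<le> \<epsilon>' * measure lebesgue (\<Union>F)"
          unfolding q_def by (rule closeF[OF F h])
        moreover have "\<epsilon>' * measure lebesgue (\<Union>F) \<le> \<epsilon>'"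
          using m1 \<epsilon>' by (simp add: mult_left_le)
        ultimately show "\<bar>support h (\<Phi> {0..1}) - support h (\<Sum>A\<in>F. K A)\<bar> \<le> 2 * \<epsilon>'"
          by linarith
      qed
      then have "hausdorff_distance (\<Phi> {0..1}) S < 2 * \<epsilon>' + \<epsilon>'"
        using hausdorff_triangle[OF cwk_convex_bounded[OF \<Phi>cwk] Kbcx[OF F(1)] cwk_convex_bounded[OF S(1)]] FS by linarith
      then show ?thesis using \<open>\<epsilon> > 0\<close> by (simp add: \<epsilon>'_def)
    qed
    with S show "\<exists>S\<in>cwk. hausdorff_has_sum (\<lambda>A. measure lebesgue A *\<^sub>S G (t A)) P S \<and>
        hausdorff_distance (\<Phi> {0..1}) S < \<epsilon>"
      by (auto simp: K_def[abs_def])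
  qed
qed

section \<open>Lebesgue differentiation and Bochner integrals\<close>

text \<open>Henstock's lemma says that the error of the indefinite integral is variationally small.\<close>

theorem lebesgue_differentiation:
  fixes \<psi> :: "real \<Rightarrow> real"
  assumes int: "\<psi> integrable_on {0..1}"
  obtains N where "negligible N" "N \<subseteq> {0..1}"
    "\<And>t \<epsilon>. t \<in> {0..1} - N \<Longrightarrow> \<epsilon> > 0 \<Longrightarrow>
       \<exists>d>0. \<forall>a b. 0 \<le> a \<and> a \<le> t \<and> t \<le> b \<and> b \<le> 1 \<and> a < b \<and> b - a < d \<longrightarrow>
          \<bar>measure lborel {a..b} * \<psi> t - integral {a..b} \<psi>\<bar> \<le> \<epsilon> * (b - a)"
proof -
  define e where "e = (\<lambda>t I. \<bar>measure lborel I * \<psi> t - integral I \<psi>\<bar>)"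
  have "variationally_small e"
    unfolding variationally_small_def
  proof (intro allI impI)
    fix \<epsilon> :: real assume "\<epsilon> > 0"
    have int': "\<psi> integrable_on cbox 0 1" using int by simp
    obtain \<gamma> where \<gamma>: "gauge \<gamma>"
      "\<And>p. \<lbrakk>p tagged_partial_division_of (cbox 0 1); \<gamma> fine p\<rbrakk> \<Longrightarrow>
             (\<Sum>(x,k)\<in>p. norm (measure lborel k *\<^sub>R \<psi> x - integral k \<psi>)) < \<epsilon>"
      by (rule Henstock_lemma[OF int' \<open>\<epsilon> > 0\<close>]) (rule that, assumption+)
    have "\<exists>d>0. {t - d<..<t + d} \<subseteq> \<gamma> t" for t
    proof -
      have "open (\<gamma> t)" "t \<in> \<gamma> t" using \<gamma>(1) by (auto simp: gauge_def)
      then obtain d where "d > 0" "ball t d \<subseteq> \<gamma> t" using open_contains_ball by blast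
      then show ?thesis by (auto simp: ball_eq_greaterThanLessThan)
    qed
    then obtain \<delta> where \<delta>: "\<And>t. \<delta> t > 0" "\<And>t. around \<delta> t \<subseteq> \<gamma> t" by metis
    show "\<exists>\<delta>. (\<forall>t\<in>{0..1}. 0 < \<delta> t) \<and>
        (\<forall>p. p tagged_division_of {0..1} \<and> around \<delta> fine p \<longrightarrow> (\<Sum>(t, I)\<in>p. e t I) < \<epsilon>)"
    proof (intro exI[of _ \<delta>] conjI ballI allI impI \<delta>(1))
      fix p assume p: "p tagged_division_of {0..1} \<and> around \<delta> fine p"
      have "\<gamma> fine p" using p \<delta>(2) unfolding fine_def by blast
      moreover have "p tagged_partial_division_of (cbox 0 1)"
        using p by (simp add: tagged_division_of_def)
      ultimately show "(\<Sum>(t, I)\<in>p. e t I) < \<epsilon>"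
        using \<gamma>(2)[of p] by (simp add: e_def)
    qed
  qed
  then show ?thesis
    by (rule variationally_small_derivative) (simp add: e_def, rule that, assumption, assumption, simp add: e_def)
qed

lemma borel_measurable_norm_diff_const:
  fixes g :: "'m \<Rightarrow> 'a::real_normed_vector"
  assumes "g \<in> borel_measurable M"
  shows "(\<lambda>x. norm (g x - c)) \<in> borel_measurable M"
  by (rule measurable_compose[OF assms]) (intro borel_measurable_continuous_onI continuous_intros)

text \<open>In a non-separable space differences of measurable functions may fail to be measurable. The finitely
  many values of \<open>s\<close> reduce the claim to differences with constants.\<close>

lemma borel_measurable_norm_diff_simple:
  fixes g :: "'m \<Rightarrow> 'a::real_normed_vector"
  assumes g: "g \<in> borel_measurable M" and s: "simple_function M s"
  shows "(\<lambda>x. norm (g x - s x)) \<in> borel_measurable M"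
proof (rule borel_measurable_iff_le[THEN iffD2], rule allI)
  fix a
  have "{x \<in> space M. norm (g x - s x) \<le> a} =
      (\<Union>c\<in>s ` space M. (s -` {c} \<inter> space M) \<inter> {x \<in> space M. norm (g x - c) \<le> a})"
    by auto
  also have "\<dots> \<in> sets M"
  proof (rule sets.finite_UN)
    show "finite (s ` space M)" using s by (simp add: simple_function_def)
    fix c assume "c \<in> s ` space M"
    then have "s -` {c} \<inter> space M \<in> sets M"
      using s by (auto simp: simple_function_def)
    moreover have "{x \<in> space M. norm (g x - c) \<le> a} \<in> sets M"
      using borel_measurable_norm_diff_const[OF g, of c] by (rule borel_measurable_iff_le[THEN iffD1, rule_format])
    ultimately show "(s -` {c} \<inter> space M) \<inter> {x \<in> space M. norm (g x - c) \<le> a} \<in> sets M"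
      by (rule sets.Int)
  qed
  finally show "{x \<in> space M. norm (g x - s x) \<le> a} \<in> sets M" .
qed

lemma simple_bochner_integral_norm_diff_le:
  fixes s t :: "'m \<Rightarrow> 'a::real_normed_vector"
  assumes s: "Bochner_Integration.simple_bochner_integrable M s" and t: "Bochner_Integration.simple_bochner_integrable M t"
  shows "ennreal (norm (Bochner_Integration.simple_bochner_integral M s - Bochner_Integration.simple_bochner_integral M t)) \<le> (\<integral>\<^sup>+ x. norm (s x - t x) \<partial>M)"
proof -
  have d: "Bochner_Integration.simple_bochner_integrable M (\<lambda>x. s x - t x)"
    by (rule simple_bochner_integrable_compose2[OF _ s t]) simp
  have nd: "Bochner_Integration.simple_bochner_integrable M (\<lambda>x. norm (s x - t x))"
    by (rule simple_bochner_integrable_compose2[OF _ s t, where p="\<lambda>x y. norm (x - y)"]) simp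
  have "norm (Bochner_Integration.simple_bochner_integral M s - Bochner_Integration.simple_bochner_integral M t) \<le> Bochner_Integration.simple_bochner_integral M (\<lambda>x. norm (s x - t x))"
    using simple_bochner_integral_norm_bound[OF d] simple_bochner_integral_diff[OF s t] by simp
  then have "ennreal (norm (Bochner_Integration.simple_bochner_integral M s - Bochner_Integration.simple_bochner_integral M t)) \<le> ennreal (Bochner_Integration.simple_bochner_integral M (\<lambda>x. norm (s x - t x)))"
    by (rule ennreal_leI)
  also have "\<dots> = (\<integral>\<^sup>+ x. norm (s x - t x) \<partial>M)"
    by (rule simple_bochner_integral_eq_nn_integral[OF nd]) simp
  finally show ?thesis .
qed

text \<open>The estimate for simple functions is passed to the limit along the sequence in the definition of the
  integral; the constant times the indicator of \<open>A\<close> is itself simple.\<close>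

lemma bochner_has_integral_diff_const_le:
  fixes g :: "'m \<Rightarrow> 'a::real_normed_vector"
  assumes bi: "bochner_has_integral M (\<lambda>\<omega>. indicator A \<omega> *\<^sub>R g \<omega>) x"
    and A: "A \<in> sets M" and fin: "finite_measure M"
    and g: "g \<in> borel_measurable M"
  shows "ennreal (norm (x - measure M A *\<^sub>R y)) \<le> (\<integral>\<^sup>+ \<omega>. ennreal (indicator A \<omega> * norm (g \<omega> - y)) \<partial>M)"
proof -
  interpret finite_measure M by (rule fin)
  define gA where "gA = (\<lambda>\<omega>. indicator A \<omega> *\<^sub>R g \<omega>)"
  define t where "t = (\<lambda>\<omega>. indicator A \<omega> *\<^sub>R y)"
  have gAm: "gA \<in> borel_measurable M"
    using bi unfolding bochner_has_integral_def gA_def by (rule conjunct1)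
  have "\<exists>s. (\<forall>i::nat. Bochner_Integration.simple_bochner_integrable M (s i)) \<and>
      (\<lambda>i. \<integral>\<^sup>+ \<omega>. norm (gA \<omega> - s i \<omega>) \<partial>M) \<longlonglongrightarrow> 0 \<and> (\<lambda>i. Bochner_Integration.simple_bochner_integral M (s i)) \<longlonglongrightarrow> x"
    using bi unfolding bochner_has_integral_def gA_def by (rule conjunct2)
  then obtain s where s: "\<forall>i::nat. Bochner_Integration.simple_bochner_integrable M (s i)"
    "(\<lambda>i. \<integral>\<^sup>+ \<omega>. norm (gA \<omega> - s i \<omega>) \<partial>M) \<longlonglongrightarrow> 0" "(\<lambda>i. Bochner_Integration.simple_bochner_integral M (s i)) \<longlonglongrightarrow> x"
    by (elim exE conjE)
  have tsf: "simple_function M t"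
    unfolding t_def using A by (intro simple_function_compose1[of M "indicator A" "\<lambda>r::real. r *\<^sub>R y"]) simp
  have t: "Bochner_Integration.simple_bochner_integrable M t"
    by (rule simple_bochner_integrable.intros[OF tsf]) simp
  have tint: "Bochner_Integration.simple_bochner_integral M t = measure M A *\<^sub>R y"
  proof -
    have "Bochner_Integration.simple_bochner_integral M t = (\<Sum>c\<in>(indicator A :: _ \<Rightarrow> real) ` space M. measure M {x\<in>space M. indicator A x = c} *\<^sub>R (c *\<^sub>R y))"
      using A by (intro simple_bochner_integral_partition[OF t]) (auto simp: t_def)
    also have "\<dots> = (\<Sum>c\<in>{0, 1}. measure M {x\<in>space M. indicator A x = c} *\<^sub>R (c *\<^sub>R y))"
    proof (rule sum.mono_neutral_left)
      show "\<forall>i\<in>{0, 1} - (indicator A :: _ \<Rightarrow> real) ` space M. measure M {x \<in> space M. indicator A x = i} *\<^sub>R i *\<^sub>R y = 0"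
      proof
        fix c assume c: "c \<in> {0, 1} - (indicator A :: _ \<Rightarrow> real) ` space M"
        then have "{x \<in> space M. indicator A x = c} = {}" by auto
        then show "measure M {x \<in> space M. indicator A x = c} *\<^sub>R c *\<^sub>R y = 0" by (simp only: measure_empty scaleR_zero_left)
      qed
    qed (auto simp: indicator_def)
    also have "{x\<in>space M. indicator A x = (1::real)} = A" using sets.sets_into_space[OF A] by (auto simp: indicator_def)
    then have "(\<Sum>c\<in>{0, 1}. measure M {x\<in>space M. indicator A x = c} *\<^sub>R (c *\<^sub>R y)) = measure M A *\<^sub>R y" by simp
    finally show ?thesis .
  qed
  define R where "R = (\<integral>\<^sup>+ \<omega>. ennreal (indicator A \<omega> * norm (g \<omega> - y)) \<partial>M)"
  have le: "ennreal (norm (Bochner_Integration.simple_bochner_integral M (s i) - measure M A *\<^sub>R y)) \<le> (\<integral>\<^sup>+ \<omega>. norm (gA \<omega> - s i \<omega>) \<partial>M) + R" for i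
  proof -
    have sf: "simple_function M (s i)" using s(1)[rule_format, of i] by (auto elim: simple_bochner_integrable.cases)
    have m1: "(\<lambda>\<omega>. norm (gA \<omega> - s i \<omega>)) \<in> borel_measurable M"
      by (rule borel_measurable_norm_diff_simple[OF gAm sf])
    have m2: "(\<lambda>\<omega>. indicator A \<omega> * norm (g \<omega> - y)) \<in> borel_measurable M"
      using borel_measurable_norm_diff_const[OF g, of y] A by measurable
    have "ennreal (norm (Bochner_Integration.simple_bochner_integral M (s i) - measure M A *\<^sub>R y)) \<le> (\<integral>\<^sup>+ \<omega>. norm (s i \<omega> - t \<omega>) \<partial>M)"
      unfolding tint[symmetric] by (rule simple_bochner_integral_norm_diff_le[OF s(1)[rule_format] t])
    also have "\<dots> \<le> (\<integral>\<^sup>+ \<omega>. ennreal (norm (gA \<omega> - s i \<omega>)) + ennreal (indicator A \<omega> * norm (g \<omega> - y)) \<partial>M)"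
    proof (rule nn_integral_mono)
      fix \<omega>
      have "norm (s i \<omega> - t \<omega>) \<le> norm (gA \<omega> - s i \<omega>) + norm (gA \<omega> - t \<omega>)"
        using norm_triangle_ineq4[of "gA \<omega> - t \<omega>" "gA \<omega> - s i \<omega>"] by simp
      also have "norm (gA \<omega> - t \<omega>) = indicator A \<omega> * norm (g \<omega> - y)"
        by (simp add: gA_def t_def flip: scaleR_diff_right)
      finally show "ennreal (norm (s i \<omega> - t \<omega>)) \<le> ennreal (norm (gA \<omega> - s i \<omega>)) + ennreal (indicator A \<omega> * norm (g \<omega> - y))"
        by (simp add: ennreal_leI flip: ennreal_plus)
    qed
    also have "\<dots> = (\<integral>\<^sup>+ \<omega>. norm (gA \<omega> - s i \<omega>) \<partial>M) + R"
      unfolding R_def using m1 m2 by (intro nn_integral_add) auto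
    finally show ?thesis .
  qed
  have l1: "(\<lambda>i. ennreal (norm (Bochner_Integration.simple_bochner_integral M (s i) - measure M A *\<^sub>R y))) \<longlonglongrightarrow> ennreal (norm (x - measure M A *\<^sub>R y))"
    by (intro tendsto_ennrealI tendsto_intros s(3))
  have l2: "(\<lambda>i. (\<integral>\<^sup>+ \<omega>. norm (gA \<omega> - s i \<omega>) \<partial>M) + R) \<longlonglongrightarrow> 0 + R"
    by (intro tendsto_add s(2) tendsto_const)
  have "ennreal (norm (x - measure M A *\<^sub>R y)) \<le> 0 + R"
    by (rule LIMSEQ_le[OF l1 l2]) (use le in blast)
  then show ?thesis by (simp add: R_def)
qed

section \<open>The vector measure of a Lipschitz curve\<close>

abbreviation unit_measure :: "real measure" where
  "unit_measure \<equiv> uniform_measure lborel {0..1}"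

lemma measure_unit_measure: "A \<in> sets borel \<Longrightarrow> measure unit_measure A = measure lborel ({0..1} \<inter> A)"
  by (subst measure_uniform_measure) auto

lemma finite_measure_unit_measure: "finite_measure unit_measure"
  by (rule finite_measureI) (simp add: emeasure_uniform_measure)

definition grid_cell :: "nat \<Rightarrow> nat \<Rightarrow> real set" where
  "grid_cell n i = {real i / real (Suc n)<..real (Suc i) / real (Suc n)}"

definition grid_increment :: "(real \<Rightarrow> 'a::real_vector) \<Rightarrow> nat \<Rightarrow> nat \<Rightarrow> 'a" where
  "grid_increment u n i = u (real (Suc i) / real (Suc n)) - u (real i / real (Suc n))"

text \<open>The measure whose density is constant on every cell of the grid and whose value on a cell is the
  increment of \<open>u\<close>.\<close>

definition grid_measure :: "(real \<Rightarrow> 'a::real_vector) \<Rightarrow> nat \<Rightarrow> real set \<Rightarrow> 'a" where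
  "grid_measure u n A = (\<Sum>i\<le>n. (real (Suc n) * measure unit_measure (A \<inter> grid_cell n i)) *\<^sub>R grid_increment u n i)"

lemma grid_cell_borel [measurable]: "grid_cell n i \<in> sets borel"
  by (simp add: grid_cell_def)

lemma grid_cell_subset:
  assumes "i \<le> n"
  shows "grid_cell n i \<subseteq> {0<..1}"
proof
  fix x assume "x \<in> grid_cell n i"
  then have "real i / real (Suc n) < x" "x \<le> real (Suc i) / real (Suc n)"
    unfolding grid_cell_def greaterThanAtMost_iff by blast+
  moreover have "0 \<le> real i / real (Suc n)" "real (Suc i) / real (Suc n) \<le> 1"
    using assms by (simp_all add: divide_simps)
  ultimately show "x \<in> {0<..1}" unfolding greaterThanAtMost_iff by linarith
qed

lemma grid_cell_disjoint: "disjoint_family_on (\<lambda>i. A \<inter> grid_cell n i) I"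
proof -
  have "x \<notin> grid_cell n j" if "x \<in> grid_cell n i" "i < j" for x i j
  proof -
    have "real (Suc i) \<le> real j" using that(2) by linarith
    then have "real (Suc i) / real (Suc n) \<le> real j / real (Suc n)" by (intro divide_right_mono) auto
    then show ?thesis using that(1) by (auto simp: grid_cell_def)
  qed
  then show ?thesis
    unfolding disjoint_family_on_def by (metis (no_types, lifting) Int_iff disjoint_iff linorder_neqE_nat)
qed

lemma measure_grid_cell:
  assumes "i \<le> n"
  shows "measure unit_measure (grid_cell n i) = 1 / real (Suc n)"
proof -
  have "grid_cell n i \<subseteq> {0..1}" using grid_cell_subset[OF assms] by (rule order_trans) auto
  then have "measure unit_measure (grid_cell n i) = measure lborel (grid_cell n i)"
    by (simp add: measure_unit_measure Int_absorb1)
  also have "\<dots> = real (Suc i) / real (Suc n) - real i / real (Suc n)"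
    unfolding grid_cell_def by (intro measure_lborel_Ioc divide_right_mono) auto
  also have "\<dots> = 1 / real (Suc n)" by (simp flip: diff_divide_distrib)
  finally show ?thesis .
qed

lemma grid_measure_disjoint_Un:
  assumes "A \<in> sets borel" "B \<in> sets borel" "A \<inter> B = {}"
  shows "grid_measure u n (A \<union> B) = grid_measure u n A + grid_measure u n B"
proof -
  interpret finite_measure unit_measure by (rule finite_measure_unit_measure)
  have "measure unit_measure ((A \<union> B) \<inter> grid_cell n i) = measure unit_measure (A \<inter> grid_cell n i) + measure unit_measure (B \<inter> grid_cell n i)" for i
    unfolding Int_Un_distrib2 using assms by (intro finite_measure_Union) auto
  then show ?thesis
    by (simp add: grid_measure_def sum.distrib[symmetric] distrib_left scaleR_left_distrib del: of_nat_Suc)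
qed

lemma grid_measure_finite_UN:
  assumes "\<And>i::nat. A i \<in> sets borel" "disjoint_family A"
  shows "grid_measure u n (\<Union>i<k. A i) = (\<Sum>i<k. grid_measure u n (A i))"
proof (induction k)
  case 0
  show ?case by (simp add: grid_measure_def)
next
  case (Suc k)
  have "(\<Union>i<k. A i) \<inter> A k = {}"
  proof -
    have "A i \<inter> A k = {}" if "i < k" for i
      by (rule disjoint_family_onD[OF assms(2)]) (use that in auto)
    then show ?thesis by blast
  qed
  then have "grid_measure u n ((\<Union>i<k. A i) \<union> A k) = grid_measure u n (\<Union>i<k. A i) + grid_measure u n (A k)"
    using assms(1) by (intro grid_measure_disjoint_Un) auto
  with Suc show ?case by (simp add: lessThan_Suc Un_commute)
qed

locale lipschitz_curve =
  fixes u :: "real \<Rightarrow> 'a::banach" and L :: real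
  assumes lip: "\<And>s t. s \<in> {0..1} \<Longrightarrow> t \<in> {0..1} \<Longrightarrow> norm (u s - u t) \<le> L * \<bar>s - t\<bar>" and L: "L \<ge> 0"
begin

lemma norm_grid_measure_le:
  assumes A: "A \<in> sets borel"
  shows "norm (grid_measure u n A) \<le> L * measure unit_measure A"
proof -
  interpret finite_measure unit_measure by (rule finite_measure_unit_measure)
  have "norm (grid_measure u n A) \<le> (\<Sum>i\<le>n. L * measure unit_measure (A \<inter> grid_cell n i))"
    unfolding grid_measure_def
  proof (rule sum_norm_le)
    fix i assume "i \<in> {..n}"
    then have "norm (grid_increment u n i) \<le> L * \<bar>real (Suc i) / real (Suc n) - real i / real (Suc n)\<bar>"
      unfolding grid_increment_def by (intro lip) (auto simp: divide_simps)
    also have "\<dots> = L / real (Suc n)" by (simp flip: diff_divide_distrib)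
    finally have "norm (grid_increment u n i) \<le> L / real (Suc n)" .
    then have "(real (Suc n) * measure unit_measure (A \<inter> grid_cell n i)) * norm (grid_increment u n i) \<le>
        (real (Suc n) * measure unit_measure (A \<inter> grid_cell n i)) * (L / real (Suc n))"
      by (intro mult_left_mono) auto
    then show "norm ((real (Suc n) * measure unit_measure (A \<inter> grid_cell n i)) *\<^sub>R grid_increment u n i) \<le>
        L * measure unit_measure (A \<inter> grid_cell n i)"
      by (simp add: abs_mult mult.commute del: of_nat_Suc)
  qed
  also have "\<dots> = L * measure unit_measure (\<Union>i\<le>n. A \<inter> grid_cell n i)"
    using A grid_cell_disjoint by (subst finite_measure_finite_Union) (auto simp: sum_distrib_left)
  also have "\<dots> \<le> L * measure unit_measure A"
    using A L by (intro mult_left_mono finite_measure_mono) auto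
  finally show ?thesis .
qed

text \<open>At the grid points the value is exact, and \<open>b\<close> has a grid point within \<open>1 / Suc n\<close>.\<close>

lemma grid_measure_atMost:
  assumes b: "0 \<le> b" "b \<le> 1"
  shows "(\<lambda>n. grid_measure u n {..b}) \<longlonglongrightarrow> u b - u 0"
proof -
  have "norm (grid_measure u n {..b} - (u b - u 0)) \<le> (2 * L) * (1 / real (Suc n))" for n
  proof -
    define k where "k = nat \<lfloor>real (Suc n) * b\<rfloor>"
    define c where "c = real k / real (Suc n)"
    have k: "real k \<le> real (Suc n) * b" "real (Suc n) * b < real k + 1"
    proof -
      have "real k = of_int \<lfloor>real (Suc n) * b\<rfloor>" using b by (simp add: k_def)
      then show "real k \<le> real (Suc n) * b" "real (Suc n) * b < real k + 1" by linarith+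
    qed
    have bc: "b - c = (real (Suc n) * b - real k) / real (Suc n)"
      by (simp add: c_def diff_divide_distrib del: of_nat_Suc)
    have "0 \<le> b - c" unfolding bc using k(1) by (intro divide_nonneg_pos) auto
    moreover have "b - c \<le> 1 / real (Suc n)" unfolding bc using k(2) by (intro divide_right_mono) auto
    ultimately have cb: "c \<le> b" "b - c \<le> 1 / real (Suc n)" "0 \<le> c"
      by (simp_all add: c_def del: of_nat_Suc)
    have "real (Suc n) * b \<le> real (Suc n) * 1" using b by (intro mult_left_mono) auto
    then have kn: "k \<le> Suc n" using k(1) by (metis le_trans mult.right_neutral of_nat_le_iff order_trans)
    have lowc: "grid_measure u n {..c} = u c - u 0"
    proof -
      have "(real (Suc n) * measure unit_measure ({..c} \<inter> grid_cell n i)) *\<^sub>R grid_increment u n i =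
          (if i < k then grid_increment u n i else 0)" if "i \<le> n" for i
      proof (cases "i < k")
        case True
        then have "real (Suc i) / real (Suc n) \<le> c"
          unfolding c_def by (intro divide_right_mono) auto
        then have "{..c} \<inter> grid_cell n i = grid_cell n i" by (auto simp: grid_cell_def)
        then have "measure unit_measure ({..c} \<inter> grid_cell n i) = 1 / real (Suc n)"
          by (simp only: measure_grid_cell[OF that])
        then show ?thesis using True by (simp del: of_nat_Suc measure_uniform_measure)
      next
        case False
        then have "c \<le> real i / real (Suc n)"
          unfolding c_def by (intro divide_right_mono) auto
        then have "{..c} \<inter> grid_cell n i = {}" by (auto simp: grid_cell_def)
        then show ?thesis using False by simp
      qed
      then have "grid_measure u n {..c} = (\<Sum>i\<le>n. if i < k then grid_increment u n i else 0)"
        unfolding grid_measure_def by (intro sum.cong) auto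
      also have "\<dots> = (\<Sum>i<k. grid_increment u n i)"
        using kn by (intro sum.mono_neutral_cong_right) auto
      also have "\<dots> = u (real k / real (Suc n)) - u (real 0 / real (Suc n))"
        unfolding grid_increment_def by (rule sum_lessThan_telescope)
      finally show ?thesis by (simp add: c_def)
    qed
    have split: "{..b} = {..c} \<union> {c<..b}" using cb by auto
    have "grid_measure u n {..b} = (u c - u 0) + grid_measure u n {c<..b}"
      unfolding split lowc[symmetric] by (intro grid_measure_disjoint_Un) auto
    then have "norm (grid_measure u n {..b} - (u b - u 0)) = norm ((u c - u b) + grid_measure u n {c<..b})"
      by (simp add: algebra_simps)
    also have "\<dots> \<le> norm (u c - u b) + norm (grid_measure u n {c<..b})"
      by (rule norm_triangle_ineq)
    also have "norm (u c - u b) \<le> L * (1 / real (Suc n))"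
    proof -
      have "norm (u c - u b) \<le> L * \<bar>c - b\<bar>" by (rule lip) (use cb b in auto)
      also have "\<dots> \<le> L * (1 / real (Suc n))" using cb by (intro mult_left_mono L) linarith
      finally show ?thesis .
    qed
    also have "norm (grid_measure u n {c<..b}) \<le> L * (1 / real (Suc n))"
    proof -
      have "{0..1} \<inter> {c<..b} = {c<..b}" using cb b by auto
      then have "measure unit_measure {c<..b} \<le> measure lborel {c<..b}"
        by (subst measure_unit_measure) auto
      also have "\<dots> \<le> 1 / real (Suc n)" using cb by simp
      finally have "L * measure unit_measure {c<..b} \<le> L * (1 / real (Suc n))"
        by (rule mult_left_mono[OF _ L])
      then show ?thesis
        using norm_grid_measure_le[of "{c<..b}" n] by (rule order_trans[rotated]) simp
    qed
    finally show ?thesis by (simp add: algebra_simps)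
  qed
  then have "(\<lambda>n. grid_measure u n {..b} - (u b - u 0)) \<longlonglongrightarrow> 0"
    by (intro Lim_null_comparison[OF always_eventually tendsto_mult_right_zero[OF LIMSEQ_Suc[OF lim_1_over_n]]]) auto
  then show ?thesis by (simp add: LIM_zero_iff)
qed

text \<open>The Borel sets on which the approximations converge contain the half-lines and form a Dynkin
  system; for disjoint unions the tails are controlled by the bound \<open>norm_grid_measure_le\<close>, which does not
  depend on the grid.\<close>

lemma grid_measure_convergent:
  assumes "A \<in> sets borel"
  shows "convergent (\<lambda>n. grid_measure u n A)"
proof -
  interpret finite_measure unit_measure by (rule finite_measure_unit_measure)
  have all: "convergent (\<lambda>n. grid_measure u n UNIV)"
  proof -
    have "grid_measure u n UNIV = grid_measure u n {..1}" for n
    proof -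
      have "UNIV \<inter> grid_cell n i = {..1} \<inter> grid_cell n i" if "i \<le> n" for i
        using grid_cell_subset[OF that] by auto
      then show ?thesis unfolding grid_measure_def by (intro sum.cong) auto
    qed
    then show ?thesis using grid_measure_atMost[of 1] by (auto simp: convergent_def)
  qed
  have borel: "sets borel = sigma_sets UNIV (range (\<lambda>a::real. {..a}))"
    unfolding borel_eq_atMost by simp
  have stable: "Int_stable (range (\<lambda>a::real. {..a}))"
    by (auto simp: Int_stable_def)
  have "A \<in> sigma_sets UNIV (range (\<lambda>a::real. {..a}))" using assms borel by simp
  from stable subset_Pow_Union[of "range (\<lambda>a::real. {..a})", THEN order_trans, OF Pow_mono[OF subset_UNIV]] this show ?thesis
  proof (induction rule: sigma_sets_induct_disjoint)
    case (basic A)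
    then obtain b where b: "A = {..b}" by blast
    have *: "grid_measure u n {..b} = grid_measure u n {..max 0 (min 1 b)}" for n
    proof -
      have "measure unit_measure ({..b} \<inter> grid_cell n i) = measure unit_measure ({..max 0 (min 1 b)} \<inter> grid_cell n i)"
        if "i \<le> n" for i
      proof -
        have "{..b} \<inter> grid_cell n i = {..max 0 (min 1 b)} \<inter> grid_cell n i"
          using grid_cell_subset[OF that] by (auto simp: le_max_iff_disj)
        then show ?thesis by simp
      qed
      then show ?thesis unfolding grid_measure_def by (intro sum.cong) auto
    qed
    show ?case
      unfolding b using * grid_measure_atMost[of "max 0 (min 1 b)"] by (auto simp: convergent_def)
  next
    case empty
    show ?case by (simp add: grid_measure_def convergent_const)
  next
    case (compl A)
    then have A: "A \<in> sets borel" using borel by simp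
    have "grid_measure u n (UNIV - A) = grid_measure u n UNIV - grid_measure u n A" for n
    proof -
      have "A \<union> (UNIV - A) = UNIV" by blast
      moreover have "grid_measure u n (A \<union> (UNIV - A)) = grid_measure u n A + grid_measure u n (UNIV - A)"
        by (rule grid_measure_disjoint_Un) (use A in auto)
      ultimately show ?thesis by simp
    qed
    moreover have "convergent (\<lambda>n. grid_measure u n UNIV - grid_measure u n A)"
      by (rule convergent_diff[OF all compl(2)])
    ultimately show ?case by simp
  next
    case (union A)
    have A: "\<And>i. A i \<in> sets borel" using union(2) borel by auto
    define T where "T = (\<lambda>k. \<Union>i\<in>{k..}. A i)"
    have T: "T k \<in> sets borel" for k unfolding T_def using A by (intro sets.countable_UN') auto
    have split: "grid_measure u n (\<Union>i. A i) = (\<Sum>i<k. grid_measure u n (A i)) + grid_measure u n (T k)" for n k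
    proof -
      have "(\<Union>i. A i) = (\<Union>i<k. A i) \<union> T k"
      proof -
        have "UNIV = {..<k} \<union> {k..}" by auto
        then have "(\<Union>i. A i) = (\<Union>i\<in>{..<k} \<union> {k..}. A i)" by (rule arg_cong)
        then show ?thesis unfolding T_def UN_Un .
      qed
      moreover have "(\<Union>i<k. A i) \<inter> T k = {}"
      proof -
        have "A i \<inter> A j = {}" if "i < k" "k \<le> j" for i j
          by (rule disjoint_family_onD[OF union(1)]) (use that in auto)
        then show ?thesis unfolding T_def by blast
      qed
      moreover have "(\<Union>i<k. A i) \<in> sets borel" using A by auto
      ultimately show ?thesis
        using grid_measure_disjoint_Un[of "\<Union>i<k. A i" "T k" u n] T grid_measure_finite_UN[OF A union(1), of u n k] by simp
    qed
    have Tlim: "(\<lambda>k. L * measure unit_measure (T k)) \<longlonglongrightarrow> 0"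
    proof -
      have "(\<lambda>k. measure unit_measure (T k)) \<longlonglongrightarrow> measure unit_measure (\<Inter>k. T k)"
      proof (rule finite_Lim_measure_decseq)
        show "range T \<subseteq> sets unit_measure" using T by auto
        show "decseq T" unfolding decseq_def T_def by (intro allI impI UN_mono) auto
      qed
      also have "(\<Inter>k. T k) = {}"
      proof -
        have "x \<notin> (\<Inter>k. T k)" for x
        proof
          assume x: "x \<in> (\<Inter>k. T k)"
          then obtain i where "x \<in> A i" by (auto simp: T_def)
          moreover obtain j where "j \<ge> Suc i" "x \<in> A j" using x unfolding T_def by blast
          moreover have "A i \<inter> A j = {}" if "j \<ge> Suc i" for j
            by (rule disjoint_family_onD[OF union(1)]) (use that in auto)
          ultimately show False by blast
        qed
        then show ?thesis by blast
      qed
      finally have "(\<lambda>k. measure unit_measure (T k)) \<longlonglongrightarrow> 0" by simp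
      then show ?thesis by (rule tendsto_mult_right_zero)
    qed
    have "Cauchy (\<lambda>n. grid_measure u n (\<Union>i. A i))"
    proof (rule metric_CauchyI)
      fix e :: real assume "e > 0"
      then have "\<forall>\<^sub>F k in sequentially. dist (L * measure unit_measure (T k)) 0 < e / 4"
        using Tlim by (intro tendstoD) auto
      then obtain k where "dist (L * measure unit_measure (T k)) 0 < e / 4"
        unfolding eventually_sequentially by blast
      then have k: "L * measure unit_measure (T k) < e / 4" by (simp add: dist_real_def)
      have "convergent (\<lambda>n. \<Sum>i<k. grid_measure u n (A i))"
        using union(3) by (intro convergent_sum) auto
      then have "Cauchy (\<lambda>n. \<Sum>i<k. grid_measure u n (A i))" by (rule convergent_Cauchy)
      then obtain n0 where n0: "\<And>m n. m \<ge> n0 \<Longrightarrow> n \<ge> n0 \<Longrightarrow>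
          dist (\<Sum>i<k. grid_measure u m (A i)) (\<Sum>i<k. grid_measure u n (A i)) < e / 4"
        using metric_CauchyD[of _ "e / 4"] \<open>e > 0\<close> by fastforce
      have "dist (grid_measure u m (\<Union>i. A i)) (grid_measure u n (\<Union>i. A i)) < e" if "m \<ge> n0" "n \<ge> n0" for m n
      proof -
        have "norm (grid_measure u m (T k)) < e / 4" "norm (grid_measure u n (T k)) < e / 4"
          using norm_grid_measure_le[OF T, of _ k] k by (meson le_less_trans)+
        then have "dist (grid_measure u m (T k)) (grid_measure u n (T k)) < e / 2"
          using norm_triangle_ineq4[of "grid_measure u m (T k)" "grid_measure u n (T k)"] by (simp add: dist_norm)
        then show ?thesis
          using dist_triangle_add[of "\<Sum>i<k. grid_measure u m (A i)" "grid_measure u m (T k)"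
              "\<Sum>i<k. grid_measure u n (A i)" "grid_measure u n (T k)"] n0[OF that] \<open>e > 0\<close>
          unfolding split[of _ k] by linarith
      qed
      then show "\<exists>M. \<forall>m\<ge>M. \<forall>n\<ge>M. dist (grid_measure u m (\<Union>i. A i)) (grid_measure u n (\<Union>i. A i)) < e" by blast
    qed
    then show ?case by (rule Cauchy_convergent)
  qed
qed

definition increment_measure :: "real set \<Rightarrow> 'a" where
  "increment_measure A = lim (\<lambda>n. grid_measure u n A)"

lemma grid_measure_tendsto:
  "A \<in> sets borel \<Longrightarrow> (\<lambda>n. grid_measure u n A) \<longlonglongrightarrow> increment_measure A"
  unfolding increment_measure_def by (rule convergent_LIMSEQ_iff[THEN iffD1, OF grid_measure_convergent])

lemma norm_increment_measure_le:
  assumes "A \<in> sets borel"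
  shows "norm (increment_measure A) \<le> L * measure unit_measure A"
  by (rule tendsto_upperbound[OF tendsto_norm[OF grid_measure_tendsto[OF assms]]])
    (use norm_grid_measure_le[OF assms] in auto)

lemma increment_measure_disjoint_Un:
  assumes "A \<in> sets borel" "B \<in> sets borel" "A \<inter> B = {}"
  shows "increment_measure (A \<union> B) = increment_measure A + increment_measure B"
proof (rule LIMSEQ_unique[OF grid_measure_tendsto])
  show "(\<lambda>n. grid_measure u n (A \<union> B)) \<longlonglongrightarrow> increment_measure A + increment_measure B"
    unfolding grid_measure_disjoint_Un[OF assms] by (intro tendsto_add grid_measure_tendsto assms)
qed (use assms in auto)

lemma increment_measure_Ioc:
  assumes "0 \<le> a" "a \<le> b" "b \<le> 1"
  shows "increment_measure {a<..b} = u b - u a"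
proof -
  have *: "increment_measure {..c} = u c - u 0" if "0 \<le> c" "c \<le> 1" for c
    by (rule LIMSEQ_unique[OF grid_measure_tendsto grid_measure_atMost[OF that]]) simp
  have "{..b} = {..a} \<union> {a<..b}" using assms by auto
  moreover have "increment_measure ({..a} \<union> {a<..b}) = increment_measure {..a} + increment_measure {a<..b}"
    by (intro increment_measure_disjoint_Un) auto
  ultimately have "increment_measure {..b} = increment_measure {..a} + increment_measure {a<..b}" by simp
  then show ?thesis using *[of a] *[of b] assms by simp
qed

text \<open>Finite additivity, with tails dominated by \<open>L\<close> times the measure of sets decreasing to the empty set.\<close>

lemma vector_measure_increment_measure: "vector_measure unit_measure increment_measure"
  unfolding vector_measure_def
proof (intro allI impI)
  interpret finite_measure unit_measure by (rule finite_measure_unit_measure)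
  fix A :: "nat \<Rightarrow> real set" assume "range A \<subseteq> sets unit_measure \<and> disjoint_family A"
  then have A: "\<And>i. A i \<in> sets borel" and dis: "disjoint_family A" by auto
  have fin: "increment_measure (\<Union>i<k. A i) = (\<Sum>i<k. increment_measure (A i))" for k
  proof (rule LIMSEQ_unique[OF grid_measure_tendsto])
    show "(\<lambda>n. grid_measure u n (\<Union>i<k. A i)) \<longlonglongrightarrow> (\<Sum>i<k. increment_measure (A i))"
      unfolding grid_measure_finite_UN[OF A dis] by (intro tendsto_sum grid_measure_tendsto A)
  qed (use A in auto)
  define T where "T = (\<lambda>k. (\<Union>i. A i) - (\<Union>i<k. A i))"
  have T: "T k \<in> sets borel" for k unfolding T_def using A by auto
  have "(\<lambda>k. measure unit_measure (T k)) \<longlonglongrightarrow> measure unit_measure (\<Inter>k. T k)"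
    using T by (intro finite_Lim_measure_decseq) (auto simp: decseq_def T_def)
  also have "(\<Inter>k. T k) = {}" by (auto simp: T_def)
  finally have "(\<lambda>k. L * measure unit_measure (T k)) \<longlonglongrightarrow> 0" by (simp add: tendsto_mult_right_zero)
  then have "(\<lambda>k. increment_measure (T k)) \<longlonglongrightarrow> 0"
    by (rule Lim_null_comparison[rotated]) (use norm_increment_measure_le[OF T] in auto)
  then have "(\<lambda>k. increment_measure (\<Union>i. A i) - increment_measure (T k)) \<longlonglongrightarrow> increment_measure (\<Union>i. A i) - 0"
    by (intro tendsto_intros)
  moreover have "increment_measure (\<Union>i. A i) - increment_measure (T k) = (\<Sum>i<k. increment_measure (A i))" for k
  proof -
    have "(\<Union>i. A i) = (\<Union>i<k. A i) \<union> T k" by (auto simp: T_def)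
    moreover have "increment_measure ((\<Union>i<k. A i) \<union> T k) = increment_measure (\<Union>i<k. A i) + increment_measure (T k)"
      using A T by (intro increment_measure_disjoint_Un) (auto simp: T_def)
    ultimately show ?thesis by (simp add: fin)
  qed
  ultimately show "(\<lambda>n. increment_measure (A n)) sums increment_measure (\<Union>n. A n)"
    by (simp add: sums_def)
qed

end

section \<open>Differentiability of Lipschitz curves\<close>

lemma borel_measurable_unit_measure: "borel_measurable unit_measure = borel_measurable borel"
  by (rule measurable_cong_sets) auto

lemma nn_integral_unit_measure:
  assumes "f \<in> borel_measurable borel"
  shows "(\<integral>\<^sup>+ t. f t \<partial>unit_measure) = (\<integral>\<^sup>+ t. f t * indicator {0..1} t \<partial>lborel)"
proof -
  have "(\<integral>\<^sup>+ t. f t \<partial>unit_measure) = (\<integral>\<^sup>+ t. f t * indicator {0..1} t \<partial>lborel) / emeasure lborel {0..1::real}"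
    using assms by (intro nn_integral_uniform_measure) auto
  then show ?thesis by (simp add: divide_ennreal_def)
qed

context lipschitz_curve
begin

lemma finite_variation_increment_measure: "finite_variation unit_measure increment_measure"
  unfolding finite_variation_def
proof (intro exI[of _ L] allI impI)
  interpret finite_measure unit_measure by (rule finite_measure_unit_measure)
  fix P assume P: "finite P \<and> P \<subseteq> sets unit_measure \<and> partition_on (space unit_measure) P"
  have "(\<Sum>A\<in>P. norm (increment_measure A)) \<le> (\<Sum>A\<in>P. L * measure unit_measure A)"
    using P by (intro sum_mono norm_increment_measure_le) auto
  also have "\<dots> = L * measure unit_measure (\<Union>A\<in>P. A)"
  proof -
    have "disjoint_family_on (\<lambda>A. A) P"
      using P by (auto simp: partition_on_def disjoint_def disjoint_family_on_def)
    then show ?thesis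
      using P by (subst finite_measure_finite_Union) (auto simp: sum_distrib_left)
  qed
  also have "\<dots> \<le> L * 1"
  proof (intro mult_left_mono L)
    have "measure unit_measure (\<Union>A\<in>P. A) \<le> measure unit_measure UNIV"
      by (intro finite_measure_mono) auto
    also have "\<dots> = 1" by (subst measure_unit_measure) auto
    finally show "measure unit_measure (\<Union>A\<in>P. A) \<le> 1" .
  qed
  finally show "(\<Sum>A\<in>P. norm (increment_measure A)) \<le> L" by simp
qed

lemma continuous_wrt_increment_measure: "continuous_wrt unit_measure increment_measure"
  unfolding continuous_wrt_def
proof (intro allI impI)
  fix \<epsilon> :: real assume "\<epsilon> > 0"
  define d where "d = \<epsilon> / (L + 1)"
  have L1: "L + 1 > 0" using L by simp
  have "norm (increment_measure A) < \<epsilon>" if A: "A \<in> sets unit_measure" "measure unit_measure A < d" for A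
  proof -
    have "norm (increment_measure A) \<le> L * measure unit_measure A"
      using A(1) by (intro norm_increment_measure_le) simp
    also have "\<dots> \<le> (L + 1) * measure unit_measure A"
      by (intro mult_right_mono) auto
    also have "\<dots> < (L + 1) * d" using A(2) L1 by (intro mult_strict_left_mono)
    also have "\<dots> = \<epsilon>" using L1 by (simp only: d_def) simp
    finally show ?thesis .
  qed
  moreover have "d > 0" using \<open>\<epsilon> > 0\<close> L1 by (simp add: d_def)
  ultimately show "\<exists>\<delta>>0. \<forall>A\<in>sets unit_measure. measure unit_measure A < \<delta> \<longrightarrow> norm (increment_measure A) < \<epsilon>"
    by blast
qed

text \<open>The derivative is the Radon--Nikodym density \<open>g\<close> of the increments. The norm of \<open>u b - u a - (b - a) *\<^sub>R c\<close>
  is at most the integral of \<open>norm (g t - c)\<close> from \<open>a\<close> to \<open>b\<close>, to which real Lebesgue differentiation applies. Exceptional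
  null sets are collected only for the countably many values \<open>c\<close> of the approximating simple functions; these
  suffice, because almost every \<open>g t\<close> is a limit of such values.\<close>

theorem rnp_differentiable:
  assumes rnp: "radon_nikodym_property TYPE('a)"
  obtains N v where "negligible N" "N \<subseteq> {0..1}"
    "\<And>t \<epsilon>. t \<in> {0..1} - N \<Longrightarrow> \<epsilon> > 0 \<Longrightarrow>
       \<exists>d>0. \<forall>a b. 0 \<le> a \<and> a \<le> t \<and> t \<le> b \<and> b \<le> 1 \<and> a < b \<and> b - a < d \<longrightarrow>
          norm (u b - u a - (b - a) *\<^sub>R v t) \<le> \<epsilon> * (b - a)"
proof -
  interpret finite_measure unit_measure by (rule finite_measure_unit_measure)
  have "finite_measure unit_measure \<and> vector_measure unit_measure increment_measure \<and>
      finite_variation unit_measure increment_measure \<and> continuous_wrt unit_measure increment_measure"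
    by (intro conjI finite_measure_unit_measure vector_measure_increment_measure
        finite_variation_increment_measure continuous_wrt_increment_measure)
  from rnp[unfolded radon_nikodym_property_def, rule_format, OF this]
  obtain g where g: "\<forall>A\<in>sets unit_measure. bochner_has_integral unit_measure (\<lambda>\<omega>. indicator A \<omega> *\<^sub>R g \<omega>) (increment_measure A)"
    by (elim exE)
  have gU: "bochner_has_integral unit_measure g (increment_measure UNIV)"
    using g[rule_format, of UNIV] by simp
  have gm: "g \<in> borel_measurable unit_measure"
    using gU unfolding bochner_has_integral_def by (rule conjunct1)
  from gU[unfolded bochner_has_integral_def, THEN conjunct2] obtain s
    where s: "\<forall>i::nat. Bochner_Integration.simple_bochner_integrable unit_measure (s i)"
      "(\<lambda>i. \<integral>\<^sup>+ \<omega>. norm (g \<omega> - s i \<omega>) \<partial>unit_measure) \<longlonglongrightarrow> 0"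
    by (elim exE conjE)
  have sf: "simple_function unit_measure (s i)" for i
    using s(1)[rule_format, of i] by (auto elim: simple_bochner_integrable.cases)
  have frange: "finite (range (s i))" for i using sf[of i] by (simp add: simple_function_def)
  have sm: "(\<lambda>t. norm (g t - s i t)) \<in> borel_measurable borel" for i
    using borel_measurable_norm_diff_simple[OF gm sf[of i]] by (simp only: borel_measurable_unit_measure)
  define \<psi> where "\<psi> = (\<lambda>c t. norm (g t - c))"
  have \<psi>m [measurable]: "\<psi> c \<in> borel_measurable borel" for c
    using borel_measurable_norm_diff_const[OF gm, of c] by (simp only: borel_measurable_unit_measure \<psi>_def)
  have \<psi>0: "0 \<le> \<psi> c t" for c t by (simp add: \<psi>_def)
  have \<psi>int: "\<psi> c integrable_on {0..1}" for c
  proof -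
    have "\<forall>\<^sub>F i in sequentially. (\<integral>\<^sup>+ \<omega>. norm (g \<omega> - s i \<omega>) \<partial>unit_measure) < 1"
      using s(2) by (rule order_tendstoD(2)) simp
    then obtain i where i: "(\<integral>\<^sup>+ \<omega>. norm (g \<omega> - s i \<omega>) \<partial>unit_measure) < 1"
      unfolding eventually_sequentially by blast
    obtain K where K: "\<And>t. norm (s i t - c) \<le> K"
      using finite_imp_bounded[OF frange[of i]] unfolding bounded_any_center[where a=c] by (auto simp: dist_norm norm_minus_commute)
    have K0: "K \<ge> 0" using K[of 0] norm_ge_zero order_trans by blast
    have "(\<integral>\<^sup>+ t. ennreal (\<psi> c t) \<partial>unit_measure) \<le> (\<integral>\<^sup>+ t. ennreal (norm (g t - s i t)) + ennreal K \<partial>unit_measure)"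
    proof (rule nn_integral_mono)
      fix t
      have "\<psi> c t \<le> norm (g t - s i t) + K"
        using norm_triangle_ineq[of "g t - s i t" "s i t - c"] K[of t] by (simp add: \<psi>_def)
      then show "ennreal (\<psi> c t) \<le> ennreal (norm (g t - s i t)) + ennreal K"
        using K0 by (simp add: ennreal_leI flip: ennreal_plus)
    qed
    also have "\<dots> = (\<integral>\<^sup>+ t. norm (g t - s i t) \<partial>unit_measure) + (\<integral>\<^sup>+ t. ennreal K \<partial>unit_measure)"
      using sm[of i] by (intro nn_integral_add) (auto simp: borel_measurable_unit_measure)
    also have "\<dots> < top"
    proof -
      have "(\<integral>\<^sup>+ t. ennreal K \<partial>unit_measure) < top"
        by (simp add: ennreal_mult_less_top less_top[symmetric])
      moreover have "(\<integral>\<^sup>+ t. norm (g t - s i t) \<partial>unit_measure) < top" using i by (rule less_trans) simp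
      ultimately show ?thesis by (simp add: less_top[symmetric])
    qed
    finally have fin: "(\<integral>\<^sup>+ t. ennreal (\<psi> c t) * indicator {0..1} t \<partial>lborel) < top"
      by (subst (asm) nn_integral_unit_measure) auto
    have "set_integrable lborel {0..1} (\<psi> c)"
      unfolding set_integrable_def
    proof (rule integrableI_bounded)
      show "(\<lambda>x. indicat_real {0..1} x *\<^sub>R \<psi> c x) \<in> borel_measurable lborel" by measurable
      have "(\<integral>\<^sup>+ x. ennreal (norm (indicat_real {0..1} x *\<^sub>R \<psi> c x)) \<partial>lborel) = (\<integral>\<^sup>+ t. ennreal (\<psi> c t) * indicator {0..1} t \<partial>lborel)"
        using \<psi>0 by (intro nn_integral_cong) (auto simp: indicator_def)
      then show "(\<integral>\<^sup>+ x. ennreal (norm (indicat_real {0..1} x *\<^sub>R \<psi> c x)) \<partial>lborel) < \<infinity>" using fin by simp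
    qed
    then show ?thesis by (rule set_borel_integral_eq_integral(1))
  qed
  define Q where "Q = (\<Union>i. range (s i))"
  have Q: "countable Q" unfolding Q_def using frange by (auto intro: countable_finite)
  have "\<exists>N. negligible N \<and> (\<forall>t\<in>{0..1} - N. \<forall>\<epsilon>>0.
       \<exists>d>0. \<forall>a b. 0 \<le> a \<and> a \<le> t \<and> t \<le> b \<and> b \<le> 1 \<and> a < b \<and> b - a < d \<longrightarrow>
          \<bar>measure lborel {a..b} * \<psi> c t - integral {a..b} (\<psi> c)\<bar> \<le> \<epsilon> * (b - a))" for c
  proof -
    obtain N where N: "negligible N" "N \<subseteq> {0..1}" "\<And>t \<epsilon>. t \<in> {0..1} - N \<Longrightarrow> \<epsilon> > 0 \<Longrightarrow>
       \<exists>d>0. \<forall>a b. 0 \<le> a \<and> a \<le> t \<and> t \<le> b \<and> b \<le> 1 \<and> a < b \<and> b - a < d \<longrightarrow>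
          \<bar>measure lborel {a..b} * \<psi> c t - integral {a..b} (\<psi> c)\<bar> \<le> \<epsilon> * (b - a)"
      by (rule lebesgue_differentiation[OF \<psi>int[of c]]) (rule that, assumption+)
    show ?thesis by (intro exI[of _ N] conjI N(1) ballI allI impI N(3))
  qed
  then obtain NQ where NQ: "\<And>c. negligible (NQ c)" "\<And>c t \<epsilon>. t \<in> {0..1} - NQ c \<Longrightarrow> \<epsilon> > 0 \<Longrightarrow>
       \<exists>d>0. \<forall>a b. 0 \<le> a \<and> a \<le> t \<and> t \<le> b \<and> b \<le> 1 \<and> a < b \<and> b - a < d \<longrightarrow>
          \<bar>measure lborel {a..b} * \<psi> c t - integral {a..b} (\<psi> c)\<bar> \<le> \<epsilon> * (b - a)"
    by metis
  \<comment> \<open>On \<open>Z n\<close> no simple function comes within \<open>1 / Suc n\<close> of \<open>g\<close>, which contradicts convergence in mean if \<open>Z n\<close> has positive measure.\<close>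
  define Z where "Z = (\<lambda>n::nat. {0..1} \<inter> (\<Inter>c\<in>Q. {t. \<psi> c t \<ge> 1 / Suc n}))"
  have Zb: "Z n \<in> sets borel" for n
    unfolding Z_def using Q by (intro sets.Int sets.countable_INT') (auto simp: Q_def)
  have Z: "negligible (Z n)" for n
  proof -
    have le: "ennreal (1 / Suc n) * emeasure unit_measure (Z n) \<le> (\<integral>\<^sup>+ \<omega>. norm (g \<omega> - s i \<omega>) \<partial>unit_measure)" for i
    proof -
      have "ennreal (1 / Suc n) * emeasure unit_measure (Z n) = (\<integral>\<^sup>+ t. ennreal (1 / Suc n) * indicator (Z n) t \<partial>unit_measure)"
        using Zb by (intro nn_integral_cmult_indicator[symmetric]) simp
      also have "\<dots> \<le> (\<integral>\<^sup>+ \<omega>. norm (g \<omega> - s i \<omega>) \<partial>unit_measure)"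
      proof (rule nn_integral_mono)
        fix t
        show "ennreal (1 / Suc n) * indicator (Z n) t \<le> ennreal (norm (g t - s i t))"
        proof (cases "t \<in> Z n")
          case True
          then have "1 / Suc n \<le> \<psi> (s i t) t" by (auto simp: Z_def Q_def)
          then show ?thesis using True by (simp add: \<psi>_def ennreal_leI)
        qed simp
      qed
      finally show ?thesis .
    qed
    have "ennreal (1 / Suc n) * emeasure unit_measure (Z n) \<le> 0"
      by (rule tendsto_lowerbound[OF s(2)]) (use le in auto)
    then have "emeasure unit_measure (Z n) = 0" by simp
    then have "emeasure lborel ({0..1} \<inter> Z n) = 0"
      using Zb[of n] by (subst (asm) emeasure_uniform_measure) auto
    moreover have "{0..1} \<inter> Z n = Z n" by (auto simp: Z_def)
    ultimately have "Z n \<in> null_sets lborel" using Zb by (auto simp: null_sets_def)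
    then show ?thesis by (simp add: negligible_iff_null_sets null_sets_completionI)
  qed
  define N where "N = {0..1} \<inter> ((\<Union>c\<in>Q. NQ c) \<union> (\<Union>n. Z n))"
  show ?thesis
  proof
    have "negligible (\<Union>c\<in>Q. NQ c)" using Q NQ(1) by (intro negligible_countable_Union) auto
    moreover have "negligible (\<Union>n. Z n)" using Z by (rule negligible_Union_nat)
    ultimately have "negligible ((\<Union>c\<in>Q. NQ c) \<union> (\<Union>n. Z n))" by (rule negligible_Un)
    then show "negligible N" unfolding N_def by (rule negligible_subset) auto
    show "N \<subseteq> {0..1}" by (auto simp: N_def)
    fix t \<epsilon> :: real assume t: "t \<in> {0..1} - N" and "\<epsilon> > 0"
    obtain n :: nat where n: "1 / real (Suc n) < \<epsilon> / 4"
      using nat_approx_posE[of "\<epsilon> / 4"] \<open>\<epsilon> > 0\<close> by auto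
    have "t \<notin> Z n" using t by (auto simp: N_def)
    then obtain c where c: "c \<in> Q" "\<psi> c t < 1 / real (Suc n)" using t by (auto simp: Z_def not_le)
    have tc: "t \<in> {0..1} - NQ c" using t c(1) by (auto simp: N_def)
    have "\<epsilon> / 4 > 0" using \<open>\<epsilon> > 0\<close> by simp
    from NQ(2)[OF tc this] obtain d where d: "d > 0"
      "\<forall>a b. 0 \<le> a \<and> a \<le> t \<and> t \<le> b \<and> b \<le> 1 \<and> a < b \<and> b - a < d \<longrightarrow>
          \<bar>measure lborel {a..b} * \<psi> c t - integral {a..b} (\<psi> c)\<bar> \<le> \<epsilon> / 4 * (b - a)"
      by (elim exE conjE)
    show "\<exists>d>0. \<forall>a b. 0 \<le> a \<and> a \<le> t \<and> t \<le> b \<and> b \<le> 1 \<and> a < b \<and> b - a < d \<longrightarrow>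
          norm (u b - u a - (b - a) *\<^sub>R g t) \<le> \<epsilon> * (b - a)"
    proof (intro exI[of _ d] conjI d(1) allI impI)
      fix a b assume ab: "0 \<le> a \<and> a \<le> t \<and> t \<le> b \<and> b \<le> 1 \<and> a < b \<and> b - a < d"
      define I where "I = integral {a..b} (\<psi> c)"
      have hi: "(\<psi> c has_integral I) {a..b}"
        unfolding I_def using integrable_on_subinterval[OF \<psi>int[of c], of a b] ab by (intro integrable_integral) auto
      have I0: "I \<ge> 0" using hi \<psi>0 by (rule has_integral_nonneg)
      have "I \<le> \<epsilon> / 2 * (b - a)"
      proof -
        have "\<bar>(b - a) * \<psi> c t - I\<bar> \<le> \<epsilon> / 4 * (b - a)"
          using d(2)[rule_format, OF ab] ab by (simp add: I_def)
        then have "I \<le> (b - a) * \<psi> c t + \<epsilon> / 4 * (b - a)" by linarith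
        also have "(b - a) * \<psi> c t \<le> (b - a) * (\<epsilon> / 4)"
          using c(2) n ab by (intro mult_left_mono) auto
        also have "(b - a) * (\<epsilon> / 4) + \<epsilon> / 4 * (b - a) = \<epsilon> / 2 * (b - a)"
          by (simp add: field_simps)
        finally show ?thesis by simp
      qed
      have ab01: "{0..1} \<inter> {a<..b} = {a<..b}" using ab by auto
      have "ennreal (norm (increment_measure {a<..b} - measure unit_measure {a<..b} *\<^sub>R c)) \<le>
          (\<integral>\<^sup>+ \<omega>. ennreal (indicator {a<..b} \<omega> * norm (g \<omega> - c)) \<partial>unit_measure)"
        by (rule bochner_has_integral_diff_const_le[OF g[rule_format] _ finite_measure_unit_measure gm]) auto
      also have "\<dots> = (\<integral>\<^sup>+ \<omega>. ennreal (indicator {a<..b} \<omega> * \<psi> c \<omega>) * indicator {0..1} \<omega> \<partial>lborel)"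
      proof -
        have eq: "norm (g \<omega> - c) = \<psi> c \<omega>" for \<omega> by (simp add: \<psi>_def)
        show ?thesis unfolding eq by (rule nn_integral_unit_measure) measurable
      qed
      also have "\<dots> \<le> (\<integral>\<^sup>+ \<omega>. ennreal (\<psi> c \<omega>) * indicator {a..b} \<omega> \<partial>lborel)"
        by (intro nn_integral_mono) (auto simp: indicator_def \<psi>0)
      also have "\<dots> = ennreal I"
        by (rule nn_integral_has_integral_lebesgue'[OF _ hi]) (use \<psi>0 in auto)
      finally have "norm (increment_measure {a<..b} - measure unit_measure {a<..b} *\<^sub>R c) \<le> I"
        using I0 by simp
      moreover have "measure unit_measure {a<..b} = b - a"
        using ab by (subst measure_unit_measure) (auto simp: ab01)
      moreover have "increment_measure {a<..b} = u b - u a"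
        using ab by (intro increment_measure_Ioc) auto
      ultimately have 1: "norm (u b - u a - (b - a) *\<^sub>R c) \<le> \<epsilon> / 2 * (b - a)"
        using \<open>I \<le> \<epsilon> / 2 * (b - a)\<close> by simp
      have 2: "norm ((b - a) *\<^sub>R (g t - c)) \<le> \<epsilon> / 4 * (b - a)"
        using c(2) n ab mult_left_mono[of "\<psi> c t" "\<epsilon> / 4" "b - a"] by (simp add: \<psi>_def mult.commute)
      have "u b - u a - (b - a) *\<^sub>R g t = (u b - u a - (b - a) *\<^sub>R c) - (b - a) *\<^sub>R (g t - c)"
        by (simp add: algebra_simps)
      then have "norm (u b - u a - (b - a) *\<^sub>R g t) \<le> norm (u b - u a - (b - a) *\<^sub>R c) + norm ((b - a) *\<^sub>R (g t - c))"
        by (simp only: norm_triangle_ineq4)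
      then have "norm (u b - u a - (b - a) *\<^sub>R g t) \<le> \<epsilon> / 2 * (b - a) + \<epsilon> / 4 * (b - a)"
        using 1 2 by linarith
      also have "\<dots> \<le> \<epsilon> * (b - a)"
        using ab \<open>\<epsilon> > 0\<close> by (simp flip: distrib_right)
      finally show "norm (u b - u a - (b - a) *\<^sub>R g t) \<le> \<epsilon> * (b - a)" .
    qed
  qed
qed

end

section \<open>Stepanov's theorem\<close>

text \<open>Affine interpolation across the gaps of \<open>H\<close>, where \<open>p s\<close> and \<open>q s\<close> are the nearest points of \<open>H\<close> on either
  side of \<open>s\<close>.\<close>

lemma lipschitz_extension_from_closed:
  fixes u :: "real \<Rightarrow> 'a::real_normed_vector"
  assumes H: "closed H" "H \<subseteq> {0..1}" "0 \<in> H" "1 \<in> H"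
    and lip: "\<And>s t. s \<in> H \<Longrightarrow> t \<in> H \<Longrightarrow> norm (u s - u t) \<le> L * \<bar>s - t\<bar>"
  obtains w where "\<And>t. t \<in> H \<Longrightarrow> w t = u t"
    "\<And>s t. s \<in> {0..1} \<Longrightarrow> t \<in> {0..1} \<Longrightarrow> norm (w s - w t) \<le> L * \<bar>s - t\<bar>"
proof -
  define p where "p = (\<lambda>s. Sup (H \<inter> {..s}))"
  define q where "q = (\<lambda>s. Inf (H \<inter> {s..}))"
  define w where "w = (\<lambda>s. if p s = q s then u (p s) else u (p s) + ((s - p s) / (q s - p s)) *\<^sub>R (u (q s) - u (p s)))"
  have bdd: "bdd_above (H \<inter> {..s})" "bdd_below (H \<inter> {s..})" for s by auto
  have p: "p s \<in> H" "p s \<le> s" if "s \<in> {0..1}" for s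
  proof -
    have "p s \<in> H \<inter> {..s}"
      unfolding p_def using H that by (intro closed_contains_Sup bdd) auto
    then show "p s \<in> H" "p s \<le> s" by auto
  qed
  have q: "q s \<in> H" "s \<le> q s" if "s \<in> {0..1}" for s
  proof -
    have "q s \<in> H \<inter> {s..}"
      unfolding q_def using H that by (intro closed_contains_Inf bdd) auto
    then show "q s \<in> H" "s \<le> q s" by auto
  qed
  have pmax: "c \<le> p s" if "c \<in> H" "c \<le> s" for c s
    unfolding p_def using that by (intro cSup_upper bdd) auto
  have qmin: "q s \<le> c" if "c \<in> H" "s \<le> c" for c s
    unfolding q_def using that by (intro cInf_lower bdd) auto
  have wu: "w t = u t" if "t \<in> H" for t
  proof -
    have "t \<in> {0..1}" using that H(2) by blast
    then have "p t = t" "q t = t"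
      using p(2)[of t] q(2)[of t] pmax[OF that, of t] qmin[OF that, of t] by auto
    then show ?thesis by (simp add: w_def)
  qed
  have slope: "norm (u (q s) - u (p s)) \<le> L * (q s - p s)" if "s \<in> {0..1}" for s
    using lip[OF q(1)[OF that] p(1)[OF that]] p(2)[OF that] q(2)[OF that] by simp
  have left: "norm (w s - u (p s)) \<le> L * (s - p s)" and right: "norm (u (q s) - w s) \<le> L * (q s - s)" if s: "s \<in> {0..1}" for s
  proof -
    show "norm (w s - u (p s)) \<le> L * (s - p s)"
    proof (cases "p s = q s")
      case True
      then have "s = p s" using p(2)[OF s] q(2)[OF s] by simp
      then show ?thesis using True by (simp add: w_def)
    next
      case False
      then have pos: "q s - p s > 0" using p(2)[OF s] q(2)[OF s] by simp
      have "norm (w s - u (p s)) = (s - p s) / (q s - p s) * norm (u (q s) - u (p s))"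
        using False pos p(2)[OF s] by (simp add: w_def)
      also have "\<dots> \<le> (s - p s) / (q s - p s) * (L * (q s - p s))"
        using pos p(2)[OF s] by (intro mult_left_mono slope s) auto
      also have "\<dots> = L * (s - p s)" using pos by simp
      finally show ?thesis .
    qed
    show "norm (u (q s) - w s) \<le> L * (q s - s)"
    proof (cases "p s = q s")
      case True
      then have "s = q s" using p(2)[OF s] q(2)[OF s] by simp
      then show ?thesis using True by (simp add: w_def)
    next
      case False
      then have pos: "q s - p s > 0" using p(2)[OF s] q(2)[OF s] by simp
      have one: "1 - (s - p s) / (q s - p s) = (q s - s) / (q s - p s)"
        using pos by (simp add: field_simps)
      have "u (q s) - w s = (1 - (s - p s) / (q s - p s)) *\<^sub>R (u (q s) - u (p s))"
        using False by (simp add: w_def scaleR_left_diff_distrib)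
      then have "norm (u (q s) - w s) = (q s - s) / (q s - p s) * norm (u (q s) - u (p s))"
        unfolding one using pos q(2)[OF s] by simp
      also have "\<dots> \<le> (q s - s) / (q s - p s) * (L * (q s - p s))"
        using pos q(2)[OF s] by (intro mult_left_mono slope s) auto
      also have "\<dots> = L * (q s - s)" using pos by simp
      finally show ?thesis .
    qed
  qed
  have main: "norm (w s - w t) \<le> L * (t - s)" if st: "s \<in> {0..1}" "t \<in> {0..1}" "s \<le> t" for s t
  proof (cases "q s \<le> t")
    case True
    then have qp: "q s \<le> p t" using pmax q(1)[OF st(1)] by blast
    have "w s - w t = (w s - u (q s)) + (u (q s) - u (p t)) + (u (p t) - w t)" by simp
    also have "norm \<dots> \<le> norm (w s - u (q s)) + norm (u (q s) - u (p t)) + norm (u (p t) - w t)"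
      by (intro order_trans[OF norm_triangle_ineq] add_right_mono norm_triangle_ineq)
    also have "\<dots> \<le> L * (q s - s) + L * (p t - q s) + L * (t - p t)"
    proof (intro add_mono)
      show "norm (w s - u (q s)) \<le> L * (q s - s)" using right[OF st(1)] by (simp add: norm_minus_commute)
      show "norm (u (q s) - u (p t)) \<le> L * (p t - q s)"
        using lip[OF q(1)[OF st(1)] p(1)[OF st(2)]] qp by simp
      show "norm (u (p t) - w t) \<le> L * (t - p t)" using left[OF st(2)] by (simp add: norm_minus_commute)
    qed
    also have "\<dots> = L * (t - s)" by (simp add: algebra_simps)
    finally show ?thesis .
  next
    case False
    \<comment> \<open>The points \<open>s\<close> and \<open>t\<close> lie in the same gap.\<close>
    have "H \<inter> {..t} = H \<inter> {..s}" "H \<inter> {t..} = H \<inter> {s..}"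
      using False qmin[of _ s] st(3) by force+
    then have eq: "p t = p s" "q t = q s" by (simp_all add: p_def q_def)
    have pos: "q s - p s > 0" using False p(2)[OF st(1)] st(3) by simp
    have "w s - w t = ((s - p s) / (q s - p s) - (t - p s) / (q s - p s)) *\<^sub>R (u (q s) - u (p s))"
      using pos by (simp add: w_def eq scaleR_left_diff_distrib)
    also have "(s - p s) / (q s - p s) - (t - p s) / (q s - p s) = - ((t - s) / (q s - p s))"
      unfolding diff_divide_distrib[symmetric] minus_divide_left by simp
    finally have "norm (w s - w t) = (t - s) / (q s - p s) * norm (u (q s) - u (p s))"
      using pos st(3) by simp
    also have "\<dots> \<le> (t - s) / (q s - p s) * (L * (q s - p s))"
      using pos st(3) by (intro mult_left_mono slope st) auto
    also have "\<dots> = L * (t - s)" using pos by simp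
    finally show ?thesis .
  qed
  have "norm (w s - w t) \<le> L * \<bar>s - t\<bar>" if "s \<in> {0..1}" "t \<in> {0..1}" for s t
    using main[of s t] main[of t s] that by (cases "s \<le> t") (auto simp: norm_minus_commute)
  with wu show ?thesis by (rule that)
qed

text \<open>Almost every point of \<open>H\<close> is a density point. If \<open>H\<close> missed the part of length \<open>\<eta> * |s - t|\<close> next to
  \<open>s\<close> of the interval between \<open>s\<close> and \<open>t\<close>, its proportion there would be at most \<open>1 - \<eta>\<close>.\<close>

lemma dense_points_nearby:
  fixes H :: "real set"
  assumes H: "closed H" "H \<subseteq> {0..1}"
  obtains N where "negligible N"
    "\<And>t \<eta>. t \<in> H - N \<Longrightarrow> \<eta> > 0 \<Longrightarrow>
       \<exists>d>0. \<forall>s\<in>{0..1}. \<bar>s - t\<bar> < d \<longrightarrow> (\<exists>c\<in>H. \<bar>s - c\<bar> \<le> \<eta> * \<bar>s - t\<bar> \<and> \<bar>c - t\<bar> \<le> \<bar>s - t\<bar>)"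
proof -
  define \<psi> where "\<psi> = (\<lambda>x. if x \<in> H then 1 else 0 :: real)"
  have int: "\<psi> integrable_on {a..b}" for a b
  proof -
    have "H \<inter> {a..b} \<in> lmeasurable" by (intro lmeasurable_compact closed_Int_compact[OF H(1)]) simp
    then show ?thesis unfolding \<psi>_def integrable_restrict_Int by (simp add: lmeasurable_iff_integrable_on)
  qed
  obtain N where N: "negligible N" "N \<subseteq> {0..1}" "\<And>t \<epsilon>. t \<in> {0..1} - N \<Longrightarrow> \<epsilon> > 0 \<Longrightarrow>
       \<exists>d>0. \<forall>a b. 0 \<le> a \<and> a \<le> t \<and> t \<le> b \<and> b \<le> 1 \<and> a < b \<and> b - a < d \<longrightarrow>
          \<bar>measure lborel {a..b} * \<psi> t - integral {a..b} \<psi>\<bar> \<le> \<epsilon> * (b - a)"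
    by (rule lebesgue_differentiation[OF int[of 0 1]]) (rule that, assumption+)
  have le_len: "integral {a..b} \<psi> \<le> b - a" if "a \<le> b" for a b
  proof -
    have "integral {a..b} \<psi> \<le> integral {a..b} (\<lambda>x. 1 :: real)"
      by (intro integral_le int) (auto simp: \<psi>_def)
    then show ?thesis using that by simp
  qed
  have zero: "integral {a..b} \<psi> = 0" if "H \<inter> {a..b} = {}" for a b
  proof -
    have "integral {a..b} \<psi> = integral {a..b} (\<lambda>x. 0)"
      using that by (intro integral_cong) (auto simp: \<psi>_def)
    then show ?thesis by simp
  qed
  show ?thesis
  proof (rule that[OF N(1)])
    fix t \<eta> :: real assume t: "t \<in> H - N" and "\<eta> > 0"
    have t': "t \<in> {0..1} - N" using t H(2) by blast
    \<comment> \<open>The cap at 1 keeps the missed part between \<open>s\<close> and \<open>t\<close>.\<close>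
    define \<eta>' where "\<eta>' = min \<eta> 1"
    have \<eta>': "\<eta>' > 0" "\<eta>' \<le> 1" "\<eta>' \<le> \<eta>" using \<open>\<eta> > 0\<close> by (auto simp: \<eta>'_def)
    have "\<eta>' / 2 > 0" using \<eta>' by simp
    from N(3)[OF t' this] obtain d where d: "d > 0" "\<forall>a b. 0 \<le> a \<and> a \<le> t \<and> t \<le> b \<and> b \<le> 1 \<and> a < b \<and> b - a < d \<longrightarrow>
          \<bar>measure lborel {a..b} * \<psi> t - integral {a..b} \<psi>\<bar> \<le> \<eta>' / 2 * (b - a)"
      by (elim exE conjE)
    have low: "integral {a..b} \<psi> \<ge> (1 - \<eta>' / 2) * (b - a)"
      if "0 \<le> a" "a \<le> t" "t \<le> b" "b \<le> 1" "a < b" "b - a < d" for a b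
    proof -
      have "\<bar>(b - a) * \<psi> t - integral {a..b} \<psi>\<bar> \<le> \<eta>' / 2 * (b - a)" using d(2) that by auto
      moreover have "\<psi> t = 1" using t by (simp add: \<psi>_def)
      moreover have "(1 - \<eta>' / 2) * (b - a) = (b - a) - \<eta>' / 2 * (b - a)" by (simp add: left_diff_distrib)
      ultimately have "\<bar>(b - a) - integral {a..b} \<psi>\<bar> \<le> (b - a) - (1 - \<eta>' / 2) * (b - a)" by simp
      then show ?thesis by linarith
    qed
    show "\<exists>d>0. \<forall>s\<in>{0..1}. \<bar>s - t\<bar> < d \<longrightarrow> (\<exists>c\<in>H. \<bar>s - c\<bar> \<le> \<eta> * \<bar>s - t\<bar> \<and> \<bar>c - t\<bar> \<le> \<bar>s - t\<bar>)"
    proof (intro exI[of _ d] conjI d(1) ballI impI)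
      fix s assume s: "s \<in> {0..1}" "\<bar>s - t\<bar> < d"
      define r where "r = \<bar>s - t\<bar>"
      have \<eta>r: "\<eta>' * r \<le> \<eta> * r" using \<eta>' by (intro mult_right_mono) (auto simp: r_def)
      have \<eta>r1: "\<eta>' * r \<le> r" using \<eta>' by (simp add: r_def mult_left_le_one_le)
      have \<eta>r0: "0 \<le> \<eta>' * r" using \<eta>' by (simp add: r_def)
      consider "s = t" | "t < s" | "s < t" by linarith
      then show "\<exists>c\<in>H. \<bar>s - c\<bar> \<le> \<eta> * \<bar>s - t\<bar> \<and> \<bar>c - t\<bar> \<le> \<bar>s - t\<bar>"
      proof cases
        case 1
        then show ?thesis using t by (intro bexI[of _ t]) auto
      next
        case 2
        then have r: "r = s - t" "r > 0" by (auto simp: r_def)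
        have "H \<inter> {s - \<eta>' * r..s} \<noteq> {}"
        proof
          assume empty: "H \<inter> {s - \<eta>' * r..s} = {}"
          have "integral {t..s} \<psi> = integral {t..s - \<eta>' * r} \<psi> + integral {s - \<eta>' * r..s} \<psi>"
            using \<eta>r0 \<eta>r1 r by (intro Henstock_Kurzweil_Integration.integral_combine[symmetric] int) linarith+
          also have "\<dots> \<le> (s - \<eta>' * r) - t"
          proof -
            have "t \<le> s - \<eta>' * r" using \<eta>r1 r by linarith
            then show ?thesis using zero[OF empty] le_len[of t "s - \<eta>' * r"] by linarith
          qed
          finally have "integral {t..s} \<psi> \<le> r - \<eta>' * r" using r by simp
          moreover have "(1 - \<eta>' / 2) * r \<le> integral {t..s} \<psi>"
            using low[of t s] 2 s t' r by auto
          ultimately have "\<eta>' * r \<le> 0" by (simp add: left_diff_distrib)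
          then show False using \<eta>' r by (simp add: mult_le_0_iff)
        qed
        then obtain c where c: "c \<in> H" "s - \<eta>' * r \<le> c" "c \<le> s" by auto
        have "\<bar>s - c\<bar> \<le> \<eta> * r" "\<bar>c - t\<bar> \<le> r" using c \<eta>r \<eta>r1 r by linarith+
        then show ?thesis using c(1) unfolding r_def by blast
      next
        case 3
        then have r: "r = t - s" "r > 0" by (auto simp: r_def)
        have "H \<inter> {s..s + \<eta>' * r} \<noteq> {}"
        proof
          assume empty: "H \<inter> {s..s + \<eta>' * r} = {}"
          have "integral {s..t} \<psi> = integral {s..s + \<eta>' * r} \<psi> + integral {s + \<eta>' * r..t} \<psi>"
            using \<eta>r0 \<eta>r1 r by (intro Henstock_Kurzweil_Integration.integral_combine[symmetric] int) linarith+
          also have "\<dots> \<le> t - (s + \<eta>' * r)"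
          proof -
            have "s + \<eta>' * r \<le> t" using \<eta>r1 r by linarith
            then show ?thesis using zero[OF empty] le_len[of "s + \<eta>' * r" t] by linarith
          qed
          finally have "integral {s..t} \<psi> \<le> r - \<eta>' * r" using r by simp
          moreover have "(1 - \<eta>' / 2) * r \<le> integral {s..t} \<psi>"
            using low[of s t] 3 s t' r by auto
          ultimately have "\<eta>' * r \<le> 0" by (simp add: left_diff_distrib)
          then show False using \<eta>' r by (simp add: mult_le_0_iff)
        qed
        then obtain c where c: "c \<in> H" "s \<le> c" "c \<le> s + \<eta>' * r" by auto
        have "\<bar>s - c\<bar> \<le> \<eta> * r" "\<bar>c - t\<bar> \<le> r" using c \<eta>r \<eta>r1 r by linarith+
        then show ?thesis using c(1) unfolding r_def by blast
      qed
    qed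
  qed
qed

text \<open>Stepanov's sets: for a continuous curve they are closed, and with growing \<open>k\<close> they exhaust the points where
  the curve is pointwise Lipschitz.\<close>

definition uniformly_pointwise_lipschitz :: "(real \<Rightarrow> 'a::real_normed_vector) \<Rightarrow> nat \<Rightarrow> real set" where
  "uniformly_pointwise_lipschitz u k =
     {t\<in>{0..1}. \<forall>s\<in>{0..1}. \<bar>s - t\<bar> < 1 / Suc k \<longrightarrow> norm (u s - u t) \<le> Suc k * \<bar>s - t\<bar>}"

lemma closed_uniformly_pointwise_lipschitz:
  assumes cont: "continuous_on {0..1} u"
  shows "closed (uniformly_pointwise_lipschitz u k)"
  unfolding closed_sequential_limits
proof (intro allI impI, elim conjE)
  fix x t assume x: "\<forall>n. x n \<in> uniformly_pointwise_lipschitz u k" and lim: "x \<longlonglongrightarrow> t"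
  have x01: "x n \<in> {0..1}" for n using x by (auto simp: uniformly_pointwise_lipschitz_def)
  have t01: "t \<in> {0..1}"
    using closed_sequentially[OF closed_atLeastAtMost x01 lim] .
  have "norm (u s - u t) \<le> Suc k * \<bar>s - t\<bar>" if s: "s \<in> {0..1}" "\<bar>s - t\<bar> < 1 / Suc k" for s
  proof (rule tendsto_le[OF sequentially_bot])
    have ux: "(\<lambda>n. u (x n)) \<longlonglongrightarrow> u t"
      using continuous_on_tendsto_compose[OF cont lim t01] x01 by auto
    show "(\<lambda>n. norm (u s - u (x n))) \<longlonglongrightarrow> norm (u s - u t)" by (intro tendsto_intros ux)
    have lims: "(\<lambda>n. \<bar>s - x n\<bar>) \<longlonglongrightarrow> \<bar>s - t\<bar>" by (intro tendsto_intros lim)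
    show "(\<lambda>n. Suc k * \<bar>s - x n\<bar>) \<longlonglongrightarrow> Suc k * \<bar>s - t\<bar>" by (intro tendsto_intros lim)
    have "\<forall>\<^sub>F n in sequentially. \<bar>s - x n\<bar> < 1 / Suc k"
      using order_tendstoD(2)[OF lims s(2)] .
    then show "\<forall>\<^sub>F n in sequentially. norm (u s - u (x n)) \<le> Suc k * \<bar>s - x n\<bar>"
      by eventually_elim (use x s(1) in \<open>auto simp: uniformly_pointwise_lipschitz_def simp del: of_nat_Suc\<close>)
  qed
  with t01 show "t \<in> uniformly_pointwise_lipschitz u k"
    by (auto simp: uniformly_pointwise_lipschitz_def)
qed

text \<open>Let \<open>w\<close> be a Lipschitz curve that agrees with \<open>u\<close> on the set \<open>H\<close> in question, and let \<open>t\<close> be a density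
  point of \<open>H\<close> at which \<open>w\<close> is differentiable. Every \<open>s\<close> near \<open>t\<close> has some \<open>c \<in> H\<close> with \<open>s - c\<close> small
  against \<open>s - t\<close>. The derivative of \<open>w\<close> describes \<open>u c - u t\<close>, and the Lipschitz condition at
  the point \<open>c\<close> itself bounds \<open>u s - u c\<close>.\<close>

lemma differentiable_on_uniformly_pointwise_lipschitz:
  fixes u :: "real \<Rightarrow> 'a::banach"
  assumes rnp: "radon_nikodym_property TYPE('a)" and cont: "continuous_on {0..1} u"
  obtains N v where "negligible N"
    "\<And>t \<epsilon>. t \<in> uniformly_pointwise_lipschitz u k - N \<Longrightarrow> \<epsilon> > 0 \<Longrightarrow>
       \<exists>d>0. \<forall>s\<in>{0..1}. \<bar>s - t\<bar> < d \<longrightarrow> norm (u s - u t - (s - t) *\<^sub>R v t) \<le> \<epsilon> * \<bar>s - t\<bar>"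
proof -
  define K where "K = real (Suc k)"
  have K: "K > 0" by (simp add: K_def)
  define H where "H = uniformly_pointwise_lipschitz u k"
  have Hc: "closed H" unfolding H_def by (rule closed_uniformly_pointwise_lipschitz[OF cont])
  have H01: "H \<subseteq> {0..1}" by (auto simp: H_def uniformly_pointwise_lipschitz_def)
  have near: "norm (u s - u t) \<le> K * \<bar>s - t\<bar>" if "t \<in> H" "s \<in> {0..1}" "\<bar>s - t\<bar> < 1 / K" for s t
    using that by (auto simp: H_def uniformly_pointwise_lipschitz_def K_def simp del: of_nat_Suc)
  have "bounded (u ` {0..1})"
    by (rule compact_imp_bounded[OF compact_continuous_image[OF cont compact_Icc]])
  then obtain C where "\<forall>x\<in>u ` {0..1}. norm x \<le> C"
    unfolding bounded_iff by (elim exE)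
  then have C: "norm (u s) \<le> C" if "s \<in> {0..1}" for s using that by blast
  have C0: "C \<ge> 0" using order_trans[OF norm_ge_zero C[of 0]] by simp
  \<comment> \<open>One constant for three cases: \<open>K\<close> for close points, \<open>2 * C * K\<close> for points at distance at least \<open>1 / K\<close>, and \<open>2 * C\<close> for the two end points added to \<open>H\<close>.\<close>
  define L where "L = K + 2 * C * K + 2 * C"
  have L: "L \<ge> 0" "K \<le> L" "2 * C * K \<le> L" "2 * C \<le> L" using K C0 by (auto simp: L_def)
  have far: "norm (u s - u t) \<le> 2 * C" if "s \<in> {0..1}" "t \<in> {0..1}" for s t
    using norm_triangle_ineq4[of "u s" "u t"] C[OF that(1)] C[OF that(2)] by linarith
  have one: "norm (u s - u t) \<le> L * \<bar>s - t\<bar>" if t: "t \<in> H" and s: "s \<in> {0..1}" for s t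
  proof (cases "\<bar>s - t\<bar> < 1 / K")
    case True
    have "K * \<bar>s - t\<bar> \<le> L * \<bar>s - t\<bar>" using L by (intro mult_right_mono) auto
    with near[OF t s True] show ?thesis by linarith
  next
    case False
    then have "1 \<le> K * \<bar>s - t\<bar>" using K by (simp add: not_less divide_le_eq mult.commute)
    then have "2 * C * 1 \<le> 2 * C * (K * \<bar>s - t\<bar>)" using C0 by (intro mult_left_mono) auto
    also have "\<dots> \<le> L * \<bar>s - t\<bar>" using mult_right_mono[OF L(3), of "\<bar>s - t\<bar>"] by (simp add: mult.assoc)
    finally show ?thesis using far[of s t] s t H01 by auto
  qed
  have cl: "closed (H \<union> {0, 1})" using Hc by (intro closed_Un) auto
  have HU: "H \<union> {0, 1} \<subseteq> {0..1}" using H01 by auto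
  have ends: "0 \<in> H \<union> {0, 1}" "1 \<in> H \<union> {0, 1}" by auto
  have lips: "norm (u s - u t) \<le> L * \<bar>s - t\<bar>" if "s \<in> H \<union> {0, 1}" "t \<in> H \<union> {0, 1}" for s t
  proof -
    have s01: "s \<in> {0..1}" using \<open>s \<in> H \<union> {0, 1}\<close> HU by blast
    have t01: "t \<in> {0..1}" using \<open>t \<in> H \<union> {0, 1}\<close> HU by blast
    consider "t \<in> H" | "s \<in> H" | "s = t" | "\<bar>s - t\<bar> = 1" using \<open>s \<in> H \<union> {0, 1}\<close> \<open>t \<in> H \<union> {0, 1}\<close> by auto
    then show ?thesis
    proof cases
      case 1 then show ?thesis using s01 by (rule one)
    next
      case 2 then show ?thesis using one[of s t, OF _ t01] by (simp add: norm_minus_commute abs_minus_commute)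
    next
      case 3 then show ?thesis by simp
    next
      case 4 then show ?thesis using far[OF s01 t01] L(4) by simp
    qed
  qed
  obtain w where w: "\<And>t. t \<in> H \<union> {0, 1} \<Longrightarrow> w t = u t"
    "\<And>s t. s \<in> {0..1} \<Longrightarrow> t \<in> {0..1} \<Longrightarrow> norm (w s - w t) \<le> L * \<bar>s - t\<bar>"
    by (rule lipschitz_extension_from_closed[OF cl HU ends lips]) ((assumption | rule that)+)
  interpret lipschitz_curve w L
    by unfold_locales (use w(2) L(1) in auto)
  obtain N1 v where N1: "negligible N1" "\<And>t \<epsilon>. t \<in> {0..1} - N1 \<Longrightarrow> \<epsilon> > 0 \<Longrightarrow>
       \<exists>d>0. \<forall>a b. 0 \<le> a \<and> a \<le> t \<and> t \<le> b \<and> b \<le> 1 \<and> a < b \<and> b - a < d \<longrightarrow>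
          norm (w b - w a - (b - a) *\<^sub>R v t) \<le> \<epsilon> * (b - a)"
    by (rule rnp_differentiable[OF rnp]) (rule that, assumption+)
  obtain N2 where N2: "negligible N2" "\<And>t \<eta>. t \<in> H - N2 \<Longrightarrow> \<eta> > 0 \<Longrightarrow>
       \<exists>d>0. \<forall>s\<in>{0..1}. \<bar>s - t\<bar> < d \<longrightarrow> (\<exists>c\<in>H. \<bar>s - c\<bar> \<le> \<eta> * \<bar>s - t\<bar> \<and> \<bar>c - t\<bar> \<le> \<bar>s - t\<bar>)"
    by (rule dense_points_nearby[OF Hc H01]) (rule that, assumption+)
  show ?thesis
  proof (rule that)
    show "negligible (N1 \<union> N2)" using N1(1) N2(1) by (rule negligible_Un)
    fix t \<epsilon> :: real assume t: "t \<in> uniformly_pointwise_lipschitz u k - (N1 \<union> N2)" and "\<epsilon> > 0"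
    have tH: "t \<in> H" and t1: "t \<in> {0..1} - N1" and t2: "t \<in> H - N2"
      using t H01 by (auto simp: H_def)
    \<comment> \<open>The factor of \<open>s - c\<close> in the final estimate: \<open>K\<close> from \<open>u s - u c\<close> and \<open>norm (v t)\<close> from the linear term.\<close>
    define B where "B = K + norm (v t) + 1"
    have B: "B > 0" using K by (simp add: B_def add_pos_nonneg)
    have e2: "\<epsilon> / 2 > 0" using \<open>\<epsilon> > 0\<close> by simp
    from N1(2)[OF t1 e2] obtain d1 where d1: "d1 > 0"
      "\<forall>a b. 0 \<le> a \<and> a \<le> t \<and> t \<le> b \<and> b \<le> 1 \<and> a < b \<and> b - a < d1 \<longrightarrow>
          norm (w b - w a - (b - a) *\<^sub>R v t) \<le> \<epsilon> / 2 * (b - a)"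
      by (elim exE conjE)
    have eB: "\<epsilon> / (2 * B) > 0" using \<open>\<epsilon> > 0\<close> B by simp
    from N2(2)[OF t2 eB] obtain d2 where d2: "d2 > 0"
      "\<forall>s\<in>{0..1}. \<bar>s - t\<bar> < d2 \<longrightarrow> (\<exists>c\<in>H. \<bar>s - c\<bar> \<le> \<epsilon> / (2 * B) * \<bar>s - t\<bar> \<and> \<bar>c - t\<bar> \<le> \<bar>s - t\<bar>)"
      by (elim exE conjE)
    have wd: "norm (w c - w t - (c - t) *\<^sub>R v t) \<le> \<epsilon> / 2 * \<bar>c - t\<bar>" if c: "c \<in> {0..1}" "\<bar>c - t\<bar> < d1" for c
    proof -
      consider "c = t" | "t < c" | "c < t" by linarith
      then show ?thesis
      proof cases
        case 2
        then show ?thesis using d1(2)[rule_format, of t c] c t1 by auto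
      next
        case 3
        then have "norm (w t - w c - (t - c) *\<^sub>R v t) \<le> \<epsilon> / 2 * (t - c)"
          using d1(2)[rule_format, of c t] c t1 by auto
        moreover have "w c - w t - (c - t) *\<^sub>R v t = - (w t - w c - (t - c) *\<^sub>R v t)"
          by (simp add: algebra_simps)
        ultimately show ?thesis using 3 by (simp only: norm_minus_cancel) simp
      qed simp
    qed
    \<comment> \<open>The last bound gives \<open>|s - c| < 1 / K\<close>, so that the Lipschitz condition at \<open>c\<close> reaches \<open>s\<close>.\<close>
    define d where "d = min (min d1 d2) (1 / (2 * K))"
    show "\<exists>d>0. \<forall>s\<in>{0..1}. \<bar>s - t\<bar> < d \<longrightarrow> norm (u s - u t - (s - t) *\<^sub>R v t) \<le> \<epsilon> * \<bar>s - t\<bar>"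
    proof (intro exI[of _ d] conjI ballI impI)
      show "d > 0" using d1(1) d2(1) K by (simp add: d_def)
      fix s assume s: "s \<in> {0..1}" "\<bar>s - t\<bar> < d"
      then obtain c where c: "c \<in> H" "\<bar>s - c\<bar> \<le> \<epsilon> / (2 * B) * \<bar>s - t\<bar>" "\<bar>c - t\<bar> \<le> \<bar>s - t\<bar>"
        using d2(2)[rule_format, OF s(1)] by (auto simp: d_def)
      have c01: "c \<in> {0..1}" using c(1) H01 by blast
      have "\<bar>s - c\<bar> \<le> \<bar>s - t\<bar> + \<bar>t - c\<bar>" using abs_triangle_ineq[of "s - t" "t - c"] by simp
      also have "\<dots> \<le> 2 * \<bar>s - t\<bar>" using c(3) abs_minus_commute[of t c] by simp
      also have "\<dots> < 2 * (1 / (2 * K))" using s(2) by (simp add: d_def)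
      also have "\<dots> = 1 / K" by simp
      finally have sc: "norm (u s - u c) \<le> K * \<bar>s - c\<bar>" by (rule near[OF c(1) s(1)])
      have wc: "norm (u c - u t - (c - t) *\<^sub>R v t) \<le> \<epsilon> / 2 * \<bar>c - t\<bar>"
        using wd[OF c01] c(1,3) tH w(1)[of c] w(1)[of t] s(2) by (simp add: d_def)
      have "u s - u t - (s - t) *\<^sub>R v t = (u s - u c) + ((u c - u t - (c - t) *\<^sub>R v t) - (s - c) *\<^sub>R v t)"
        by (simp add: algebra_simps)
      also have "norm \<dots> \<le> norm (u s - u c) + (norm (u c - u t - (c - t) *\<^sub>R v t) + norm ((s - c) *\<^sub>R v t))"
        by (intro order_trans[OF norm_triangle_ineq] add_left_mono norm_triangle_ineq4)
      also have "\<dots> \<le> K * \<bar>s - c\<bar> + (\<epsilon> / 2 * \<bar>c - t\<bar> + \<bar>s - c\<bar> * norm (v t))"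
        using sc wc by simp
      also have "\<dots> \<le> B * \<bar>s - c\<bar> + \<epsilon> / 2 * \<bar>c - t\<bar>"
        by (simp add: B_def algebra_simps)
      also have "\<dots> \<le> B * (\<epsilon> / (2 * B) * \<bar>s - t\<bar>) + \<epsilon> / 2 * \<bar>s - t\<bar>"
        using B c e2 by (intro add_mono mult_left_mono) auto
      also have "\<dots> = \<epsilon> * \<bar>s - t\<bar>" using B by (simp add: field_simps)
      finally show "norm (u s - u t - (s - t) *\<^sub>R v t) \<le> \<epsilon> * \<bar>s - t\<bar>" .
    qed
  qed
qed

text \<open>Almost every point belongs to one of the sets \<open>uniformly_pointwise_lipschitz u k\<close>.\<close>

theorem rnp_stepanov:
  fixes u :: "real \<Rightarrow> 'a::banach"
  assumes rnp: "radon_nikodym_property TYPE('a)" and cont: "continuous_on {0..1} u"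
    and N0: "negligible N0"
    and pl: "\<And>t. t \<in> {0..1} - N0 \<Longrightarrow>
       \<exists>K d. d > 0 \<and> (\<forall>s\<in>{0..1}. \<bar>s - t\<bar> < d \<longrightarrow> norm (u s - u t) \<le> K * \<bar>s - t\<bar>)"
  obtains N v where "negligible N"
    "\<And>t \<epsilon>. t \<in> {0..1} - N \<Longrightarrow> \<epsilon> > 0 \<Longrightarrow>
       \<exists>d>0. \<forall>s\<in>{0..1}. \<bar>s - t\<bar> < d \<longrightarrow> norm (u s - u t - (s - t) *\<^sub>R v t) \<le> \<epsilon> * \<bar>s - t\<bar>"
proof -
  have "\<exists>N v. negligible N \<and> (\<forall>t\<in>uniformly_pointwise_lipschitz u k - N. \<forall>\<epsilon>>0.
       \<exists>d>0. \<forall>s\<in>{0..1}. \<bar>s - t\<bar> < d \<longrightarrow> norm (u s - u t - (s - t) *\<^sub>R v t) \<le> \<epsilon> * \<bar>s - t\<bar>)" for k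
  proof -
    obtain N v where N: "negligible N" "\<And>t \<epsilon>. t \<in> uniformly_pointwise_lipschitz u k - N \<Longrightarrow> \<epsilon> > 0 \<Longrightarrow>
       \<exists>d>0. \<forall>s\<in>{0..1}. \<bar>s - t\<bar> < d \<longrightarrow> norm (u s - u t - (s - t) *\<^sub>R v t) \<le> \<epsilon> * \<bar>s - t\<bar>"
      by (rule differentiable_on_uniformly_pointwise_lipschitz[OF rnp cont]) (rule that, assumption+)
    show ?thesis by (intro exI[of _ N] exI[of _ v] conjI N(1) ballI allI impI N(2))
  qed
  then obtain N v where N: "\<And>k. negligible (N k)" and v: "\<And>k t \<epsilon>. t \<in> uniformly_pointwise_lipschitz u k - N k \<Longrightarrow> \<epsilon> > 0 \<Longrightarrow>
       \<exists>d>0. \<forall>s\<in>{0..1}. \<bar>s - t\<bar> < d \<longrightarrow> norm (u s - u t - (s - t) *\<^sub>R v k t) \<le> \<epsilon> * \<bar>s - t\<bar>"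
    by metis
  define \<kappa> where "\<kappa> = (\<lambda>t. SOME k. t \<in> uniformly_pointwise_lipschitz u k)"
  show ?thesis
  proof (rule that)
    show "negligible (N0 \<union> (\<Union>k. N k))" by (intro negligible_Un N0 negligible_Union_nat N)
    fix t \<epsilon> :: real assume t: "t \<in> {0..1} - (N0 \<union> (\<Union>k. N k))" and "\<epsilon> > 0"
    then have "t \<in> {0..1} - N0" by blast
    from pl[OF this] obtain K d where Kd: "d > 0" "\<forall>s\<in>{0..1}. \<bar>s - t\<bar> < d \<longrightarrow> norm (u s - u t) \<le> K * \<bar>s - t\<bar>"
      by (elim exE conjE)
    obtain k1 where k1: "1 / real (Suc k1) < d" using nat_approx_posE[OF Kd(1)] .
    obtain k2 where k2: "K < real k2" using reals_Archimedean2 by blast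
    define k where "k = max k1 k2"
    have "t \<in> uniformly_pointwise_lipschitz u k"
      unfolding uniformly_pointwise_lipschitz_def
    proof (intro CollectI conjI ballI impI)
      fix s assume s: "s \<in> {0..1}" "\<bar>s - t\<bar> < 1 / Suc k"
      have "1 / real (Suc k) \<le> 1 / real (Suc k1)" by (intro divide_left_mono) (auto simp: k_def)
      then have "norm (u s - u t) \<le> K * \<bar>s - t\<bar>" using s k1 by (intro Kd(2)[rule_format]) auto
      also have "\<dots> \<le> real (Suc k) * \<bar>s - t\<bar>" using k2 by (intro mult_right_mono) (auto simp: k_def)
      finally show "norm (u s - u t) \<le> Suc k * \<bar>s - t\<bar>" .
    qed (use t in auto)
    then have "t \<in> uniformly_pointwise_lipschitz u (\<kappa> t)" unfolding \<kappa>_def by (rule someI)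
    then have "t \<in> uniformly_pointwise_lipschitz u (\<kappa> t) - N (\<kappa> t)" using t by blast
    from v[OF this \<open>\<epsilon> > 0\<close>]
    show "\<exists>d>0. \<forall>s\<in>{0..1}. \<bar>s - t\<bar> < d \<longrightarrow> norm (u s - u t - (s - t) *\<^sub>R v (\<kappa> t) t) \<le> \<epsilon> * \<bar>s - t\<bar>" .
  qed
qed

section \<open>Additive selections\<close>

text \<open>Points are added from left to right. If \<open>m\<close> is the last point so far, the increment from \<open>m\<close> to the new point
  is chosen in the value of \<open>\<Phi>\<close> on that interval, and additivity of \<open>\<Phi>\<close> takes care of all earlier points.\<close>

lemma finite_additive_selection:
  fixes \<Phi> :: "real set \<Rightarrow> 'a::real_vector set"
  assumes add: "finitely_additive \<Phi>" and ne: "\<And>I. I \<in> subintervals \<Longrightarrow> \<Phi> I \<noteq> {}"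
    and "finite D" "D \<subseteq> {0..1}"
  shows "\<exists>x. (\<forall>t\<in>D. x t \<in> \<Phi> {0..t}) \<and> (\<forall>s\<in>D. \<forall>t\<in>D. s < t \<longrightarrow> x t - x s \<in> \<Phi> {s..t})"
  using assms(3,4)
proof (induction D rule: finite_linorder_max_induct)
  case empty
  show ?case by simp
next
  case (insert b D)
  then obtain x where x: "\<forall>t\<in>D. x t \<in> \<Phi> {0..t}" "\<forall>s\<in>D. \<forall>t\<in>D. s < t \<longrightarrow> x t - x s \<in> \<Phi> {s..t}"
    by (auto simp: less_imp_le)
  have b01: "0 \<le> b" "b \<le> 1" using insert.prems by auto
  show ?case
  proof (cases "D = {}")
    case True
    obtain y where "y \<in> \<Phi> {0..b}" using ne[OF subintervalsI[of 0 b]] b01 by auto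
    then show ?thesis using True by (intro exI[of _ "\<lambda>_. y"]) auto
  next
    case False
    define m where "m = Max D"
    have m: "m \<in> D" "\<And>s. s \<in> D \<Longrightarrow> s \<le> m" using False insert.hyps(1) by (auto simp: m_def)
    have m01: "0 \<le> m" "m < b" using m(1) insert.hyps(2) insert.prems by auto
    obtain y where y: "y \<in> \<Phi> {m..b}" using ne[OF subintervalsI[of m b]] b01 m01 by auto
    define x' where "x' = x(b := x m + y)"
    have old: "x' s = x s" if "s \<in> D" for s using insert.hyps(2) that by (auto simp: x'_def)
    have new: "x' b = x m + y" by (simp add: x'_def)
    have "x' b \<in> \<Phi> {0..b}"
      unfolding new finitely_additiveD[OF add, of 0 m b, OF order_refl m01(1) less_imp_le[OF m01(2)] b01(2)]
      using x(1) m(1) y by (intro set_plus_intro) auto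
    moreover have "x' b - x' s \<in> \<Phi> {s..b}" if s: "s \<in> D" for s
    proof (cases "s = m")
      case True
      then show ?thesis using y m(1) by (simp add: new old)
    next
      case False
      then have sm: "s < m" using m(2)[OF s] by simp
      have s0: "0 \<le> s" using s insert.prems by auto
      have "x' b - x' s = (x m - x s) + y" by (simp add: new old[OF s])
      also have "\<dots> \<in> \<Phi> {s..m} + \<Phi> {m..b}"
        using x(2) s m(1) sm y by (intro set_plus_intro) auto
      also have "\<dots> = \<Phi> {s..b}"
        using finitely_additiveD[OF add s0 less_imp_le[OF sm] less_imp_le[OF m01(2)] b01(2)] by simp
      finally show ?thesis .
    qed
    ultimately show ?thesis
      using x old insert.hyps(2) by (intro exI[of _ x']) (auto dest: less_asym)
  qed
qed

text \<open>Compactness: the product of the sets \<open>\<Phi> {0..t}\<close> is compact for the product of the weak topologies, every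
  condition on an increment defines a closed set, and finitely many conditions can be met at once.\<close>

theorem additive_selection_exists:
  fixes \<Phi> :: "real set \<Rightarrow> 'a::real_normed_vector set"
  assumes add: "finitely_additive \<Phi>" and cwk: "\<And>I. I \<in> subintervals \<Longrightarrow> \<Phi> I \<in> cwk"
  obtains u where "\<And>s t. 0 \<le> s \<Longrightarrow> s < t \<Longrightarrow> t \<le> 1 \<Longrightarrow> u t - u s \<in> \<Phi> {s..t}"
proof -
  define T where "T = product_topology (\<lambda>_::real. weak_topology :: 'a topology) {0..1}"
  define X where "X = PiE {0..1} (\<lambda>t. \<Phi> {0..t})"
  define C where "C = (\<lambda>(s, t). {x \<in> topspace T. x t - x s \<in> \<Phi> {s..t}})"
  define pairs where "pairs = {(s, t). 0 \<le> s \<and> s < t \<and> t \<le> (1::real)}"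
  have comp: "compactin T X"
    unfolding T_def X_def compactin_PiE using cwk by (auto simp: cwk_def subintervalsI)
  have closed: "closedin T (C st)" if "st \<in> pairs" for st
  proof -
    obtain s t where st: "st = (s, t)" "0 \<le> s" "s < t" "t \<le> 1" using \<open>st \<in> pairs\<close> by (auto simp: pairs_def)
    have coord: "continuous_map T euclideanreal (\<lambda>x. blinfun_apply h (x r))" if "r \<in> {0..1}" for h :: "'a \<Rightarrow>\<^sub>L real" and r
    proof -
      have "continuous_map T weak_topology (\<lambda>x. x r)"
        unfolding T_def using that by (intro continuous_map_product_projection)
      from continuous_map_compose[OF this continuous_map_blinfun_weak_topology[of h]] show ?thesis by (simp add: o_def)
    qed
    have "continuous_map T weak_topology (\<lambda>x. x t - x s)"
      unfolding continuous_map_weak_topology_iff blinfun.diff_right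
      using st by (intro allI continuous_map_diff coord) auto
    then show ?thesis
      unfolding C_def st(1) prod.case using st
      by (intro closedin_continuous_map_preimage[where Y=weak_topology] cwk_closedin_weak_topology cwk subintervalsI) auto
  qed
  have fip: "X \<inter> \<Inter>F \<noteq> {}" if F: "finite F" "F \<subseteq> C ` pairs" for F
  proof -
    obtain P where P: "finite P" "P \<subseteq> pairs" "F = C ` P"
      using finite_subset_image[OF F] by blast
    define D where "D = fst ` P \<union> snd ` P"
    have D: "finite D" "D \<subseteq> {0..1}" using P(1,2) by (auto simp: D_def pairs_def)
    have ne: "\<Phi> I \<noteq> {}" if "I \<in> subintervals" for I by (rule cwk_nonempty[OF cwk[OF that]])
    have "\<exists>x. (\<forall>t\<in>D. x t \<in> \<Phi> {0..t}) \<and> (\<forall>s\<in>D. \<forall>t\<in>D. s < t \<longrightarrow> x t - x s \<in> \<Phi> {s..t})"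
      by (rule finite_additive_selection[OF add ne D])
    then obtain x where x: "\<forall>t\<in>D. x t \<in> \<Phi> {0..t}" "\<forall>s\<in>D. \<forall>t\<in>D. s < t \<longrightarrow> x t - x s \<in> \<Phi> {s..t}"
      by (elim exE conjE)
    have "\<exists>y. y \<in> \<Phi> {0..t}" if "t \<in> {0..1}" for t
      using cwk_nonempty[OF cwk[OF subintervalsI[of 0 t]]] that by auto
    then obtain y where y: "\<And>t. t \<in> {0..1} \<Longrightarrow> y t \<in> \<Phi> {0..t}" by metis
    \<comment> \<open>Outside the finitely many points involved, any element of the factor will do.\<close>
    define z where "z = (\<lambda>t\<in>{0..1}. if t \<in> D then x t else y t)"
    have zX: "z \<in> X" using x(1) y by (auto simp: X_def z_def)
    have "z \<in> topspace T" by (auto simp: T_def z_def)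
    have "z \<in> C st" if "st \<in> P" for st
    proof -
      obtain s t where st: "st = (s, t)" by force
      have "s \<in> D" "t \<in> D" using that by (force simp: D_def st)+
      moreover have "s < t" using that P(2) by (auto simp: pairs_def st)
      ultimately show ?thesis
        using x(2) D(2) \<open>z \<in> topspace T\<close> by (auto simp: C_def st z_def subset_iff)
    qed
    with zX P(3) show ?thesis by blast
  qed
  have "X \<inter> \<Inter>(C ` pairs) \<noteq> {}"
    using comp unfolding compactin_fip using closed fip by blast
  then obtain u where "u \<in> \<Inter>(C ` pairs)" by blast
  then have "u t - u s \<in> \<Phi> {s..t}" if "0 \<le> s" "s < t" "t \<le> 1" for s t
    using that by (force simp: C_def pairs_def)
  then show ?thesis by (rule that)
qed

text \<open>Two non-overlapping intervals whose union is an interval either share an end point only or one of them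
  is a single point contained in the other.\<close>

lemma increments_finitely_additive:
  fixes u :: "real \<Rightarrow> 'a::real_vector"
  shows "finitely_additive (\<lambda>I. {u (Sup I) - u (Inf I)})"
  unfolding finitely_additive_def
proof (intro ballI impI, elim conjE)
  have main: "u (Sup ({a..b} \<union> {c..d})) - u (Inf ({a..b} \<union> {c..d})) = (u b - u a) + (u d - u c)"
    if ab: "a \<le> b" and cd: "c \<le> d" and un: "{a..b} \<union> {c..d} \<in> subintervals"
      and int: "{a<..<b} \<inter> {c<..<d} = {}" and ac: "a \<le> c" for a b c d
  proof -
    obtain p q where pq: "{a..b} \<union> {c..d} = {p..q}" using un by (auto simp: subintervals_def)
    have "c \<le> b"
    proof (rule ccontr)
      assume "\<not> c \<le> b"
      then have gap: "(b + c) / 2 \<notin> {a..b} \<union> {c..d}" and bc: "b < (b + c) / 2" "(b + c) / 2 < c"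
        by (auto simp: field_simps)
      have "b \<in> {p..q}" "c \<in> {p..q}" unfolding pq[symmetric] using ab cd by auto
      then have "p \<le> b" "c \<le> q" by auto
      then have "(b + c) / 2 \<in> {p..q}" unfolding atLeastAtMost_iff using bc by linarith
      with gap show False unfolding pq by blast
    qed
    have "b = c \<or> d = c"
    proof (rule ccontr)
      assume "\<not> (b = c \<or> d = c)"
      then have "c < min b d" using \<open>c \<le> b\<close> cd by auto
      then have "(c + min b d) / 2 \<in> {a<..<b} \<inter> {c<..<d}" using ac by (auto simp: min_def field_simps)
      with int show False by blast
    qed
    then show ?thesis
    proof
      assume "b = c"
      then have "{a..b} \<union> {c..d} = {a..d}" using ab cd by auto
      then show ?thesis using \<open>b = c\<close> ab cd by simp
    next
      assume "d = c"
      then have "{a..b} \<union> {c..d} = {a..b}" using ac \<open>c \<le> b\<close> by auto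
      then show ?thesis using \<open>d = c\<close> ab by simp
    qed
  qed
  fix I J assume I: "I \<in> subintervals" and J: "J \<in> subintervals"
    and un: "I \<union> J \<in> subintervals" and int: "interior I \<inter> interior J = {}"
  obtain a b where ab: "I = {a..b}" "a \<le> b" using I by (auto simp: subintervals_def)
  obtain c d where cd: "J = {c..d}" "c \<le> d" using J by (auto simp: subintervals_def)
  have int': "{a<..<b} \<inter> {c<..<d} = {}" using int ab cd by simp
  have "u (Sup (I \<union> J)) - u (Inf (I \<union> J)) = (u b - u a) + (u d - u c)"
  proof (cases "a \<le> c")
    case True
    then show ?thesis using main[of a b c d] ab cd un int' by simp
  next
    case False
    then show ?thesis using main[of c d a b] ab cd un int' by (simp add: Un_commute Int_commute add.commute)
  qed
  then show "{u (Sup (I \<union> J)) - u (Inf (I \<union> J))} = {u (Sup I) - u (Inf I)} + {u (Sup J) - u (Inf J)}"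
    using ab cd by (simp add: set_plus_def)
qed

section \<open>Variationally Henstock integrable selections\<close>

lemma tagged_division_lengths: "p tagged_division_of {0..1::real} \<Longrightarrow> (\<Sum>(t, I)\<in>p. measure lebesgue I) = 1"
proof -
  assume p: "p tagged_division_of {0..1::real}"
  have "(\<Sum>(t, I)\<in>p. measure lebesgue I) = (\<Sum>(t, I)\<in>p. measure lborel I)"
  proof (rule sum.cong[OF refl], clarify)
    fix t I assume "(t, I) \<in> p"
    then obtain a b where "I = {a..b}" by (rule tagged_division_interval[OF p])
    then show "measure lebesgue I = measure lborel I" by simp
  qed
  also have "\<dots> = 1" using additive_content_tagged_division[of p 0 1] p by simp
  finally show ?thesis .
qed

lemma vH_primitive_iff:
  "vH_primitive \<Phi> \<Gamma> \<longleftrightarrow> finitely_additive \<Phi> \<and>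
     variationally_small (\<lambda>t I. hausdorff_distance (\<Phi> I) (measure lebesgue I *\<^sub>S \<Gamma> t))"
  by (simp add: vH_primitive_def variationally_small_def)

text \<open>The support functions of singletons are the functionals themselves, so they are Henstock integrable along
  \<open>f\<close> and therefore measurable.\<close>

lemma vH_primitive_scalarly_measurable:
  assumes prim: "vH_primitive (\<lambda>I. {\<phi> I}) (\<lambda>t. {f t})"
  shows "scalarly_measurable f"
  unfolding scalarly_measurable_def
proof
  fix h :: "'a \<Rightarrow>\<^sub>L real"
  define k where "k = inverse (norm h + 1) *\<^sub>R h"
  have pos: "norm h + 1 > 0" by (simp add: add_nonneg_pos)
  have k: "norm k \<le> 1" using pos by (simp add: k_def field_simps)
  have "((\<lambda>t. support k {f t}) has_integral support k {\<phi> {0..1}}) {0..1}"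
    using prim by (intro support_has_integral[OF _ _ _ _ k]) (auto simp: vH_primitive_iff)
  then have "(\<lambda>t. blinfun_apply k (f t)) \<in> borel_measurable (lebesgue_on {0..1})"
    by (intro integrable_imp_measurable) (auto intro: has_integral_integrable)
  then have "(\<lambda>t. (norm h + 1) * blinfun_apply k (f t)) \<in> borel_measurable (lebesgue_on {0..1})"
    by (intro borel_measurable_times borel_measurable_const)
  then show "(\<lambda>t. blinfun_apply h (f t)) \<in> borel_measurable (lebesgue_on {0..1})"
  proof -
    have "c * (inverse c * x) = x" if "c \<noteq> 0" for c x :: real using that by simp
    then have "(norm h + 1) * blinfun_apply k x = blinfun_apply h x" for x
      using pos by (simp add: k_def blinfun.scaleR_left)
    then show ?thesis
      using \<open>(\<lambda>t. (norm h + 1) * blinfun_apply k (f t)) \<in> borel_measurable (lebesgue_on {0..1})\<close> by simp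
  qed
qed

text \<open>The increment belongs to \<open>\<Phi> {a..b}\<close>, which is close to a multiple of \<open>\<Gamma> t\<close>.\<close>

lemma selection_increment_le:
  fixes u :: "real \<Rightarrow> 'a::real_normed_vector"
  assumes \<Phi>: "\<And>I. I \<in> subintervals \<Longrightarrow> \<Phi> I \<in> cwk" and \<Gamma>: "\<And>t. t \<in> {0..1} \<Longrightarrow> \<Gamma> t \<in> cwk"
    and u: "\<And>s t. 0 \<le> s \<Longrightarrow> s < t \<Longrightarrow> t \<le> 1 \<Longrightarrow> u t - u s \<in> \<Phi> {s..t}"
    and ab: "0 \<le> a" "a \<le> t" "t \<le> b" "b \<le> 1"
  shows "norm (u b - u a) \<le> hausdorff_distance (\<Phi> {a..b}) (measure lebesgue {a..b} *\<^sub>S \<Gamma> t) +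
    hausdorff_distance (\<Gamma> t) {0} * (b - a)"
proof (cases "a = b")
  case True
  have "0 \<le> hausdorff_distance (\<Phi> {a..b}) (measure lebesgue {a..b} *\<^sub>S \<Gamma> t)"
    using ab by (intro hausdorff_primitive_nonneg cwk_convex_bounded \<Phi> \<Gamma>)
  then show ?thesis using True by simp
next
  case False
  then have "a < b" using ab by simp
  have I: "{a..b} \<in> subintervals" and t: "t \<in> {0..1}" using ab by (auto intro: subintervalsI)
  have "norm (u b - u a) \<le> hausdorff_distance (\<Phi> {a..b}) {0}"
    using u[OF ab(1) \<open>a < b\<close> ab(4)] by (intro norm_le_hausdorff_zero cwk_bounded \<Phi> I)
  also have "\<dots> \<le> hausdorff_distance (\<Phi> {a..b}) (measure lebesgue {a..b} *\<^sub>S \<Gamma> t) +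
      hausdorff_distance (measure lebesgue {a..b} *\<^sub>S \<Gamma> t) {0}"
    by (intro hausdorff_triangle cwk_convex_bounded[OF \<Phi>[OF I]] convex_bounded_scale cwk_convex_bounded[OF \<Gamma>[OF t]] convex_bounded_singleton)
  also have "hausdorff_distance (measure lebesgue {a..b} *\<^sub>S \<Gamma> t) {0} \<le>
      measure lebesgue {a..b} * hausdorff_distance (\<Gamma> t) {0}"
    using hausdorff_scale_le[OF cwk_convex_bounded[OF \<Gamma>[OF t]] convex_bounded_singleton[of 0] measure_nonneg[of lebesgue "{a..b}"]]
    by simp
  finally show ?thesis using \<open>a < b\<close> by (simp add: mult.commute)
qed

text \<open>Tags outside \<open>N\<close> are controlled by differentiability at the tag. For a tag in \<open>N\<close>, the error is at most that of
  \<open>\<Phi>\<close> plus a multiple of the length of the interval, with a factor depending on the tag, and a suitable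
  gauge makes all these multiples small together.\<close>

lemma vH_derivative_of_selection:
  fixes u :: "real \<Rightarrow> 'a::real_normed_vector"
  assumes \<Phi>: "\<And>I. I \<in> subintervals \<Longrightarrow> \<Phi> I \<in> cwk" and \<Gamma>: "\<And>t. t \<in> {0..1} \<Longrightarrow> \<Gamma> t \<in> cwk"
    and small: "variationally_small (\<lambda>t I. hausdorff_distance (\<Phi> I) (measure lebesgue I *\<^sub>S \<Gamma> t))"
    and u: "\<And>s t. 0 \<le> s \<Longrightarrow> s < t \<Longrightarrow> t \<le> 1 \<Longrightarrow> u t - u s \<in> \<Phi> {s..t}"
    and N: "negligible N" and f: "\<And>t. t \<in> {0..1} \<Longrightarrow> f t \<in> \<Gamma> t"
    and deriv: "\<And>t \<epsilon>. t \<in> {0..1} - N \<Longrightarrow> \<epsilon> > 0 \<Longrightarrow>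
       \<exists>d>0. \<forall>s\<in>{0..1}. \<bar>s - t\<bar> < d \<longrightarrow> norm (u s - u t - (s - t) *\<^sub>R f t) \<le> \<epsilon> * \<bar>s - t\<bar>"
  shows "vH_primitive (\<lambda>I. {u (Sup I) - u (Inf I)}) (\<lambda>t. {f t})"
  unfolding vH_primitive_iff
proof (intro conjI increments_finitely_additive)
  define e where "e = (\<lambda>t I. hausdorff_distance (\<Phi> I) (measure lebesgue I *\<^sub>S \<Gamma> t))"
  define nrm where "nrm = (\<lambda>t. hausdorff_distance (\<Gamma> t) {0})"
  have e0: "0 \<le> e t {a..b}" if "0 \<le> a" "a \<le> t" "t \<le> b" "b \<le> 1" for t a b
    unfolding e_def using that by (intro hausdorff_primitive_nonneg cwk_convex_bounded \<Phi> \<Gamma>)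
  have f_le: "norm (f t) \<le> nrm t" if "t \<in> {0..1}" for t
    unfolding nrm_def using that by (intro norm_le_hausdorff_zero cwk_bounded \<Gamma> f)
  have u_le: "norm (u b - u a) \<le> e t {a..b} + nrm t * (b - a)"
    if "0 \<le> a" "a \<le> t" "t \<le> b" "b \<le> 1" for a b t
    unfolding e_def nrm_def by (rule selection_increment_le[of \<Phi> \<Gamma> u, OF \<Phi> \<Gamma> u that])
  show "variationally_small (\<lambda>t I. hausdorff_distance {u (Sup I) - u (Inf I)} (measure lebesgue I *\<^sub>S {f t}))"
    unfolding variationally_small_def
  proof (intro allI impI)
    fix \<epsilon> :: real assume "\<epsilon> > 0"
    define \<eta> where "\<eta> = \<epsilon> / 4"
    have \<eta>: "\<eta> > 0" using \<open>\<epsilon> > 0\<close> by (simp add: \<eta>_def)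
    have "\<exists>d>0. t \<in> {0..1} - N \<longrightarrow> (\<forall>s\<in>{0..1}. \<bar>s - t\<bar> < d \<longrightarrow> norm (u s - u t - (s - t) *\<^sub>R f t) \<le> \<eta> * \<bar>s - t\<bar>)" for t
      using deriv[of t \<eta>] \<eta> by (cases "t \<in> {0..1} - N") (auto intro: exI[of _ 1])
    then obtain \<delta>1 where \<delta>1: "\<And>t. \<delta>1 t > 0" "\<And>t s. t \<in> {0..1} - N \<Longrightarrow> s \<in> {0..1} \<Longrightarrow> \<bar>s - t\<bar> < \<delta>1 t \<Longrightarrow>
        norm (u s - u t - (s - t) *\<^sub>R f t) \<le> \<eta> * \<bar>s - t\<bar>" by metis
    obtain \<delta>2 where \<delta>2: "\<forall>t\<in>{0..1}. \<delta>2 t > 0"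
      "\<And>p. p tagged_division_of {0..1} \<Longrightarrow> around \<delta>2 fine p \<Longrightarrow> (\<Sum>(t, I)\<in>p. e t I) < \<eta>"
      by (rule variationally_smallE[OF small[folded e_def] \<eta>]) (rule that, assumption, assumption)
    obtain \<delta>3 :: "real \<Rightarrow> real" where \<delta>3: "\<And>t. \<delta>3 t > 0"
      "\<And>p. p tagged_division_of {0..1} \<Longrightarrow> around \<delta>3 fine p \<Longrightarrow>
         (\<Sum>(t, I)\<in>{z\<in>p. fst z \<in> N}. (2 * nrm t) * measure lebesgue I) < \<eta>"
      by (rule gauge_for_negligible_tags[OF N \<eta>, of "\<lambda>t. 2 * nrm t"]) (rule that, assumption, assumption)
    define \<delta> where "\<delta> = (\<lambda>t. min (\<delta>1 t) (min (\<delta>2 t) (\<delta>3 t)))"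
    show "\<exists>\<delta>. (\<forall>t\<in>{0..1}. 0 < \<delta> t) \<and> (\<forall>p. p tagged_division_of {0..1} \<and> around \<delta> fine p \<longrightarrow>
        (\<Sum>(t, I)\<in>p. hausdorff_distance {u (Sup I) - u (Inf I)} (measure lebesgue I *\<^sub>S {f t})) < \<epsilon>)"
    proof (intro exI[of _ \<delta>] conjI allI impI)
      show "\<forall>t\<in>{0..1}. 0 < \<delta> t" using \<delta>1(1) \<delta>2(1) \<delta>3(1) by (simp add: \<delta>_def)
      fix p assume "p tagged_division_of {0..1} \<and> around \<delta> fine p"
      then have p: "p tagged_division_of {0..1}" "around \<delta> fine p" by auto
      have fine: "around \<delta>1 fine p" "around \<delta>2 fine p" "around \<delta>3 fine p"
        using p(2) by (force simp: fine_def \<delta>_def)+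
      have finp: "finite p" using tagged_division_ofD(1)[OF p(1)] .
      have "(\<Sum>(t, I)\<in>p. hausdorff_distance {u (Sup I) - u (Inf I)} (measure lebesgue I *\<^sub>S {f t})) \<le>
          (\<Sum>(t, I)\<in>p. \<eta> * measure lebesgue I + e t I + (if t \<in> N then (2 * nrm t) * measure lebesgue I else 0))"
      proof (rule sum_mono, clarify)
        fix t I assume tI: "(t, I) \<in> p"
        then obtain a b where ab: "I = {a..b}" "0 \<le> a" "a \<le> t" "t \<le> b" "b \<le> 1"
          by (rule tagged_division_interval[OF p(1)])
        then have t: "t \<in> {0..1}" and "a \<le> b" by auto
        have len: "measure lebesgue I = b - a" using ab by simp
        have hd: "hausdorff_distance {u (Sup I) - u (Inf I)} (measure lebesgue I *\<^sub>S {f t}) = norm (u b - u a - (b - a) *\<^sub>R f t)"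
          using ab \<open>a \<le> b\<close> by (simp add: dist_norm)
        have eI: "0 \<le> e t I" unfolding ab(1) by (rule e0[OF ab(2-5)])
        show "hausdorff_distance {u (Sup I) - u (Inf I)} (measure lebesgue I *\<^sub>S {f t}) \<le>
            \<eta> * measure lebesgue I + e t I + (if t \<in> N then (2 * nrm t) * measure lebesgue I else 0)"
        proof (cases "t \<in> N")
          case False
          then have tN: "t \<in> {0..1} - N" using t by blast
          have sub: "{a..b} \<subseteq> around \<delta>1 t" using fineD[OF fine(1) tI] ab(1) by simp
          have near: "a \<in> around \<delta>1 t" "b \<in> around \<delta>1 t" using sub \<open>a \<le> b\<close> by auto
          have da: "norm (u a - u t - (a - t) *\<^sub>R f t) \<le> \<eta> * \<bar>a - t\<bar>"
            using near(1) ab by (intro \<delta>1(2)[OF tN]) auto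
          have db: "norm (u b - u t - (b - t) *\<^sub>R f t) \<le> \<eta> * \<bar>b - t\<bar>"
            using near(2) ab by (intro \<delta>1(2)[OF tN]) auto
          have "u b - u a - (b - a) *\<^sub>R f t = (u b - u t - (b - t) *\<^sub>R f t) - (u a - u t - (a - t) *\<^sub>R f t)"
            by (simp add: algebra_simps)
          also have "norm \<dots> \<le> \<eta> * \<bar>b - t\<bar> + \<eta> * \<bar>a - t\<bar>"
            by (rule order_trans[OF norm_triangle_ineq4 add_mono[OF db da]])
          also have "\<dots> = \<eta> * (b - a)" using ab by (simp add: algebra_simps)
          finally show ?thesis using False eI unfolding hd unfolding len by simp
        next
          case True
          have "norm (u b - u a - (b - a) *\<^sub>R f t) \<le> norm (u b - u a) + norm ((b - a) *\<^sub>R f t)"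
            by (rule norm_triangle_ineq4)
          also have "norm ((b - a) *\<^sub>R f t) \<le> nrm t * (b - a)"
            using mult_left_mono[OF f_le[OF t], of "b - a"] \<open>a \<le> b\<close> by (simp add: mult.commute)
          also have "norm (u b - u a) \<le> e t I + nrm t * (b - a)" unfolding ab(1) by (rule u_le[OF ab(2-5)])
          finally have "norm (u b - u a - (b - a) *\<^sub>R f t) \<le> e t I + 2 * nrm t * (b - a)" by simp
          moreover have "0 \<le> \<eta> * (b - a)" using \<eta> \<open>a \<le> b\<close> by simp
          ultimately show ?thesis using True unfolding hd unfolding len by simp
        qed
      qed
      also have "\<dots> = \<eta> * (\<Sum>(t, I)\<in>p. measure lebesgue I) + (\<Sum>(t, I)\<in>p. e t I) +
          (\<Sum>(t, I)\<in>{z\<in>p. fst z \<in> N}. (2 * nrm t) * measure lebesgue I)"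
        unfolding sum.inter_filter[OF finp] by (simp add: case_prod_beta sum.distrib sum_distrib_left cong: if_cong)
      also have "\<dots> < \<eta> * 1 + \<eta> + \<eta>"
        unfolding tagged_division_lengths[OF p(1)] using \<delta>2(2)[OF p(1) fine(2)] \<delta>3(2)[OF p(1) fine(3)]
        by linarith
      also have "\<dots> < \<epsilon>" using \<open>\<epsilon> > 0\<close> by (simp add: \<eta>_def)
      finally show "(\<Sum>(t, I)\<in>p. hausdorff_distance {u (Sup I) - u (Inf I)} (measure lebesgue I *\<^sub>S {f t})) < \<epsilon>" .
    qed
  qed
qed

text \<open>Outside a null set, the additive selection \<open>u\<close> of the primitive is pointwise Lipschitz, hence
  differentiable, and its difference quotients approach \<open>\<Gamma> t\<close> because the averages of the primitive
  do. On the null set any selection will do.\<close>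

theorem rnp_vH_selection_exists:
  fixes \<Gamma> :: "real \<Rightarrow> 'a::banach set"
  assumes rnp: "radon_nikodym_property TYPE('a)"
    and \<Gamma>: "\<And>t. t \<in> {0..1} \<Longrightarrow> \<Gamma> t \<in> cwk" and vH: "vH_integrable \<Gamma>"
  shows "S_vH \<Gamma> \<noteq> {}"
proof -
  obtain \<Phi> where \<Phi>: "\<And>I. I \<in> subintervals \<Longrightarrow> \<Phi> I \<in> cwk" and add: "finitely_additive \<Phi>"
    and small: "variationally_small (\<lambda>t I. hausdorff_distance (\<Phi> I) (measure lebesgue I *\<^sub>S \<Gamma> t))"
    using vH unfolding vH_integrable_def vH_primitive_iff by blast
  define e where "e = (\<lambda>t I. hausdorff_distance (\<Phi> I) (measure lebesgue I *\<^sub>S \<Gamma> t))"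
  define nrm where "nrm = (\<lambda>t. hausdorff_distance (\<Gamma> t) {0})"
  have \<Phi>b: "\<Phi> I \<in> convex_bounded" if "I \<in> subintervals" for I by (rule cwk_convex_bounded[OF \<Phi>[OF that]])
  have \<Gamma>b: "\<Gamma> t \<in> convex_bounded" if "t \<in> {0..1}" for t by (rule cwk_convex_bounded[OF \<Gamma>[OF that]])
  have e0: "0 \<le> e t {a..b}" if "0 \<le> a" "a \<le> t" "t \<le> b" "b \<le> 1" for t a b
    unfolding e_def using that by (intro hausdorff_primitive_nonneg \<Phi>b \<Gamma>b)
  have nrm0: "0 \<le> nrm t" if "t \<in> {0..1}" for t
    using \<Gamma>b[OF that] unfolding nrm_def by (intro hausdorff_nonneg) (auto simp: convex_bounded_def)
  obtain u where u: "\<And>s t. 0 \<le> s \<Longrightarrow> s < t \<Longrightarrow> t \<le> 1 \<Longrightarrow> u t - u s \<in> \<Phi> {s..t}"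
    by (rule additive_selection_exists[OF add \<Phi>]) ((assumption | rule that)+)
  have u_le: "norm (u b - u a) \<le> e t {a..b} + nrm t * (b - a)"
    if "0 \<le> a" "a \<le> t" "t \<le> b" "b \<le> 1" for a b t
    unfolding e_def nrm_def by (rule selection_increment_le[of \<Phi> \<Gamma> u, OF \<Phi> \<Gamma> u that])
  have u_near: "norm (u s - u t) \<le> e t {min s t..max s t} + nrm t * \<bar>s - t\<bar>" if "s \<in> {0..1}" "t \<in> {0..1}" for s t
  proof -
    consider "s = t" | "s < t" | "t < s" by linarith
    then show ?thesis
    proof cases
      case 1 then show ?thesis using e0[of t t t] that by simp
    next
      case 2 then show ?thesis using u_le[of s t t] that by (simp add: norm_minus_commute)
    next
      case 3 then show ?thesis using u_le[of t t s] that by simp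
    qed
  qed
  have cont: "continuous_on {0..1} u"
    unfolding continuous_on_iff
  proof (intro ballI allI impI)
    fix t \<epsilon> :: real assume t: "t \<in> {0..1}" and "\<epsilon> > 0"
    then have e2: "\<epsilon> / 2 > 0" by simp
    obtain \<delta> where \<delta>: "\<forall>t\<in>{0..1}. \<delta> t > 0"
      "\<And>p. p tagged_division_of {0..1} \<Longrightarrow> around \<delta> fine p \<Longrightarrow> (\<Sum>(t, I)\<in>p. e t I) < \<epsilon> / 2"
      by (rule variationally_smallE[OF small[folded e_def] e2]) (rule that, assumption, assumption)
    define d where "d = min (\<delta> t) (\<epsilon> / (2 * (nrm t + 1)))"
    have np: "nrm t + 1 > 0" using nrm0[OF t] by simp
    show "\<exists>d>0. \<forall>s\<in>{0..1}. dist s t < d \<longrightarrow> dist (u s) (u t) < \<epsilon>"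
    proof (intro exI[of _ d] conjI ballI impI)
      show "d > 0" using \<delta>(1) t \<open>\<epsilon> > 0\<close> np by (simp add: d_def)
      fix s assume s: "s \<in> {0..1}" "dist s t < d"
      then have st: "\<bar>s - t\<bar> < \<delta> t" "\<bar>s - t\<bar> \<le> \<epsilon> / (2 * (nrm t + 1))" by (auto simp: d_def dist_real_def)
      have "(\<Sum>I\<in>{{min s t..max s t}}. e ((\<lambda>_. t) I) I) < \<epsilon> / 2"
      proof (rule fine_tags_sum_le[OF \<delta>(1) e0 \<delta>(2)])
        show "(\<lambda>_. t) I \<in> I \<and> I \<subseteq> {0..1} \<and> I \<subseteq> around \<delta> ((\<lambda>_. t) I)" if "I \<in> {{min s t..max s t}}" for I
        proof -
          have I: "I = {min s t..max s t}" using that by simp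
          have "x \<in> around \<delta> t" if "x \<in> I" for x
          proof -
            have "min s t \<le> x" "x \<le> max s t" using \<open>x \<in> I\<close> by (auto simp: I)
            then have "t - \<delta> t < x" "x < t + \<delta> t" using st(1) by linarith+
            then show ?thesis by simp
          qed
          then show ?thesis using s(1) t by (auto simp: I)
        qed
      qed (auto intro: exI)
      then have "e t {min s t..max s t} < \<epsilon> / 2" by simp
      moreover have "nrm t * \<bar>s - t\<bar> \<le> \<epsilon> / 2"
      proof -
        have "nrm t * \<bar>s - t\<bar> \<le> (nrm t + 1) * (\<epsilon> / (2 * (nrm t + 1)))"
          using st(2) nrm0[OF t] by (intro mult_mono) auto
        also have "\<dots> = \<epsilon> / 2"
        proof -
          have "c * (\<epsilon> / (2 * c)) = \<epsilon> / 2" if "c > 0" for c :: real using that by simp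
          then show ?thesis using np .
        qed
        finally show ?thesis .
      qed
      ultimately show "dist (u s) (u t) < \<epsilon>"
        using u_near[OF s(1) t] by (simp add: dist_norm)
    qed
  qed
  obtain N0 where N0: "negligible N0" "N0 \<subseteq> {0..1}"
    "\<And>t \<epsilon>. t \<in> {0..1} - N0 \<Longrightarrow> \<epsilon> > 0 \<Longrightarrow>
       \<exists>d>0. \<forall>a b. 0 \<le> a \<and> a \<le> t \<and> t \<le> b \<and> b \<le> 1 \<and> a < b \<and> b - a < d \<longrightarrow> e t {a..b} \<le> \<epsilon> * (b - a)"
    by (rule variationally_small_derivative[OF small[folded e_def] e0]) ((assumption | rule that)+)
  have pl: "\<exists>K d. d > 0 \<and> (\<forall>s\<in>{0..1}. \<bar>s - t\<bar> < d \<longrightarrow> norm (u s - u t) \<le> K * \<bar>s - t\<bar>)"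
    if t: "t \<in> {0..1} - N0" for t
  proof -
    obtain d where d: "d > 0" "\<forall>a b. 0 \<le> a \<and> a \<le> t \<and> t \<le> b \<and> b \<le> 1 \<and> a < b \<and> b - a < d \<longrightarrow> e t {a..b} \<le> 1 * (b - a)"
      using N0(3)[OF t zero_less_one] by (elim exE conjE)
    have "norm (u s - u t) \<le> (1 + nrm t) * \<bar>s - t\<bar>" if s: "s \<in> {0..1}" "\<bar>s - t\<bar> < d" for s
    proof (cases "s = t")
      case False
      have "e t {min s t..max s t} \<le> 1 * (max s t - min s t)"
        using s t False by (intro d(2)[rule_format]) (auto simp: min_def max_def)
      also have "\<dots> = \<bar>s - t\<bar>" by (simp add: min_def max_def)
      finally show ?thesis using u_near[OF s(1), of t] t by (simp add: distrib_right)
    qed simp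
    with d(1) show ?thesis by blast
  qed
  obtain N1 v where N1: "negligible N1" "\<And>t \<epsilon>. t \<in> {0..1} - N1 \<Longrightarrow> \<epsilon> > 0 \<Longrightarrow>
       \<exists>d>0. \<forall>s\<in>{0..1}. \<bar>s - t\<bar> < d \<longrightarrow> norm (u s - u t - (s - t) *\<^sub>R v t) \<le> \<epsilon> * \<bar>s - t\<bar>"
    by (rule rnp_stepanov[OF rnp cont N0(1) pl]) ((assumption | rule that)+)
  define N where "N = N0 \<union> N1"
  have N: "negligible N" unfolding N_def by (rule negligible_Un[OF N0(1) N1(1)])
  have vin: "v t \<in> \<Gamma> t" if t: "t \<in> {0..1} - N" for t
  proof -
    have t01: "t \<in> {0..1}" and t0: "t \<in> {0..1} - N0" and t1: "t \<in> {0..1} - N1" using t by (auto simp: N_def)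
    have "infdist (v t) (\<Gamma> t) \<le> 0 + \<epsilon>" if "\<epsilon> > 0" for \<epsilon>
    proof -
      have e2: "\<epsilon> / 2 > 0" using that by simp
      obtain d0 where d0: "d0 > 0" "\<forall>a b. 0 \<le> a \<and> a \<le> t \<and> t \<le> b \<and> b \<le> 1 \<and> a < b \<and> b - a < d0 \<longrightarrow> e t {a..b} \<le> \<epsilon> / 2 * (b - a)"
        using N0(3)[OF t0 e2] by (elim exE conjE)
      obtain d1 where d1: "d1 > 0" "\<forall>s\<in>{0..1}. \<bar>s - t\<bar> < d1 \<longrightarrow> norm (u s - u t - (s - t) *\<^sub>R v t) \<le> \<epsilon> / 2 * \<bar>s - t\<bar>"
        using N1(2)[OF t1 e2] by (elim exE conjE)
      obtain s where s: "s \<in> {0..1}" "s \<noteq> t" "\<bar>s - t\<bar> < min d0 d1"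
      proof (cases "t < 1")
        case True
        define h where "h = min (min d0 d1 / 2) (1 - t)"
        have "h > 0" "h < min d0 d1" "h \<le> 1 - t" using True d0(1) d1(1) by (auto simp: h_def min_def)
        then show ?thesis using t01 by (intro that[of "t + h"]) auto
      next
        case False
        define h where "h = min (min d0 d1 / 2) 1"
        have "h > 0" "h < min d0 d1" "h \<le> 1" using d0(1) d1(1) by (auto simp: h_def min_def)
        then show ?thesis using t01 False by (intro that[of "t - h"]) auto
      qed
      define a b where "a = min s t" and "b = max s t"
      have ab: "0 \<le> a" "a \<le> t" "t \<le> b" "b \<le> 1" "a < b" and len: "b - a = \<bar>s - t\<bar>"
        using s t01 by (auto simp: a_def b_def min_def max_def)
      have I: "{a..b} \<in> subintervals" using ab by (intro subintervalsI) auto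
      \<comment> \<open>The difference quotient between \<open>s\<close> and \<open>t\<close>.\<close>
      define x where "x = inverse (b - a) *\<^sub>R (u b - u a)"
      have xin: "x \<in> inverse (b - a) *\<^sub>S \<Phi> {a..b}"
        unfolding x_def using u[OF ab(1,5,4)] by blast
      have "infdist x (\<Gamma> t) \<le> hausdorff_distance (inverse (b - a) *\<^sub>S \<Phi> {a..b}) (\<Gamma> t)"
        using convex_bounded_scale[OF \<Phi>b[OF I], of "inverse (b - a)"] \<Gamma>b[OF t01] xin
        by (intro infdist_le_hausdorff) (auto simp: convex_bounded_def)
      also have "\<dots> \<le> inverse (b - a) * e t {a..b}"
      proof -
        have eq: "inverse (b - a) *\<^sub>S (measure lebesgue {a..b} *\<^sub>S \<Gamma> t) = \<Gamma> t"
          using ab by (simp add: image_image)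
        have "0 \<le> inverse (b - a)" using ab by simp
        from hausdorff_scale_le[OF \<Phi>b[OF I] convex_bounded_scale[OF \<Gamma>b[OF t01]] this, of "measure lebesgue {a..b}"]
        show ?thesis unfolding eq e_def .
      qed
      also have "\<dots> \<le> inverse (b - a) * (\<epsilon> / 2 * (b - a))"
        using ab s(3) len by (intro mult_left_mono d0(2)[rule_format]) auto
      also have "\<dots> = \<epsilon> / 2" using ab by (simp add: field_simps)
      finally have 1: "infdist x (\<Gamma> t) \<le> \<epsilon> / 2" .
      have "norm (u b - u a - (b - a) *\<^sub>R v t) \<le> \<epsilon> / 2 * (b - a)"
      proof (cases "t < s")
        case True
        then show ?thesis using d1(2)[rule_format, OF s(1)] s(3) by (simp add: a_def b_def)
      next
        case False
        have "u t - u s - (t - s) *\<^sub>R v t = - (u s - u t - (s - t) *\<^sub>R v t)" by (simp add: algebra_simps)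
        then have "norm (u t - u s - (t - s) *\<^sub>R v t) = norm (u s - u t - (s - t) *\<^sub>R v t)"
          by (simp only: norm_minus_cancel)
        then show ?thesis using d1(2)[rule_format, OF s(1)] s(3) False by (simp add: a_def b_def)
      qed
      then have "inverse (b - a) * norm (u b - u a - (b - a) *\<^sub>R v t) \<le> inverse (b - a) * (\<epsilon> / 2 * (b - a))"
        using ab by (intro mult_left_mono) auto
      also have "\<dots> = \<epsilon> / 2" using ab by (simp add: field_simps)
      also have "inverse (b - a) * norm (u b - u a - (b - a) *\<^sub>R v t) = norm (inverse (b - a) *\<^sub>R (u b - u a - (b - a) *\<^sub>R v t))"
        using ab by simp
      also have "inverse (b - a) *\<^sub>R (u b - u a - (b - a) *\<^sub>R v t) = x - v t"
        using ab by (simp add: x_def scaleR_right_diff_distrib)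
      finally have "dist (v t) x \<le> \<epsilon> / 2" by (simp add: dist_norm norm_minus_commute)
      then show ?thesis using 1 infdist_triangle[of "v t" "\<Gamma> t" x] by linarith
    qed
    then have "infdist (v t) (\<Gamma> t) \<le> 0" by (rule field_le_epsilon)
    then have "infdist (v t) (\<Gamma> t) = 0" using infdist_nonneg[of "v t" "\<Gamma> t"] by linarith
    then show ?thesis
      using in_closed_iff_infdist_zero[OF cwk_closed[OF \<Gamma>[OF t01]] cwk_nonempty[OF \<Gamma>[OF t01]]] by blast
  qed
  define f where "f = (\<lambda>t. if t \<in> {0..1} - N then v t else SOME x. x \<in> \<Gamma> t)"
  have f: "f t \<in> \<Gamma> t" if "t \<in> {0..1}" for t
  proof (cases "t \<in> {0..1} - N")
    case True
    show ?thesis unfolding f_def if_P[OF True] by (rule vin[OF True])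
  next
    case False
    have "(SOME x. x \<in> \<Gamma> t) \<in> \<Gamma> t" using cwk_nonempty[OF \<Gamma>[OF that]] by (simp add: some_in_eq)
    then show ?thesis unfolding f_def if_not_P[OF False] .
  qed
  have prim: "vH_primitive (\<lambda>I. {u (Sup I) - u (Inf I)}) (\<lambda>t. {f t})"
  proof (rule vH_derivative_of_selection[OF \<Phi> \<Gamma> small u N f])
    fix t \<epsilon> :: real assume t: "t \<in> {0..1} - N" and "\<epsilon> > 0"
    then have "t \<in> {0..1} - N1" by (auto simp: N_def)
    moreover have "f t = v t" using t by (simp add: f_def)
    ultimately show "\<exists>d>0. \<forall>s\<in>{0..1}. \<bar>s - t\<bar> < d \<longrightarrow> norm (u s - u t - (s - t) *\<^sub>R f t) \<le> \<epsilon> * \<bar>s - t\<bar>"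
      using N1(2)[OF _ \<open>\<epsilon> > 0\<close>] by simp
  qed
  have "f \<in> S_vH \<Gamma>"
    unfolding S_vH_def
  proof (intro CollectI conjI ballI f)
    show "scalarly_measurable f" by (rule vH_primitive_scalarly_measurable[OF prim])
    show "vH_integrable_fun f" unfolding vH_integrable_fun_def using prim by (intro exI)
  qed
  then show ?thesis by blast
qed

section \<open>Subtracting a selection\<close>

lemma variationally_small_le_add:
  assumes e1: "variationally_small e1" and e2: "variationally_small e2"
    and le: "\<And>t a b. 0 \<le> a \<Longrightarrow> a \<le> t \<Longrightarrow> t \<le> b \<Longrightarrow> b \<le> 1 \<Longrightarrow> e t {a..b} \<le> e1 t {a..b} + e2 t {a..b}"
  shows "variationally_small e"
  unfolding variationally_small_def
proof (intro allI impI)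
  fix \<epsilon> :: real assume "\<epsilon> > 0"
  then have h: "\<epsilon> / 2 > 0" by simp
  obtain \<delta>1 where \<delta>1: "\<forall>t\<in>{0..1}. \<delta>1 t > 0"
    "\<And>p. p tagged_division_of {0..1} \<Longrightarrow> around \<delta>1 fine p \<Longrightarrow> (\<Sum>(t, I)\<in>p. e1 t I) < \<epsilon> / 2"
    by (rule variationally_smallE[OF e1 h]) (rule that, assumption, assumption)
  obtain \<delta>2 where \<delta>2: "\<forall>t\<in>{0..1}. \<delta>2 t > 0"
    "\<And>p. p tagged_division_of {0..1} \<Longrightarrow> around \<delta>2 fine p \<Longrightarrow> (\<Sum>(t, I)\<in>p. e2 t I) < \<epsilon> / 2"
    by (rule variationally_smallE[OF e2 h]) (rule that, assumption, assumption)
  define \<delta> where "\<delta> = (\<lambda>t. min (\<delta>1 t) (\<delta>2 t))"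
  show "\<exists>\<delta>. (\<forall>t\<in>{0..1}. 0 < \<delta> t) \<and> (\<forall>p. p tagged_division_of {0..1} \<and> around \<delta> fine p \<longrightarrow> (\<Sum>(t, I)\<in>p. e t I) < \<epsilon>)"
  proof (intro exI[of _ \<delta>] conjI allI impI)
    show "\<forall>t\<in>{0..1}. 0 < \<delta> t" using \<delta>1(1) \<delta>2(1) by (simp add: \<delta>_def)
    fix p assume "p tagged_division_of {0..1} \<and> around \<delta> fine p"
    then have p: "p tagged_division_of {0..1}" "around \<delta> fine p" by auto
    have fine: "around \<delta>1 fine p" "around \<delta>2 fine p"
      using p(2) by (force simp: fine_def \<delta>_def)+
    have "(\<Sum>(t, I)\<in>p. e t I) \<le> (\<Sum>(t, I)\<in>p. e1 t I + e2 t I)"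
    proof (rule sum_mono, clarify)
      fix t I assume "(t, I) \<in> p"
      then obtain a b where "I = {a..b}" "0 \<le> a" "a \<le> t" "t \<le> b" "b \<le> 1"
        by (rule tagged_division_interval[OF p(1)])
      then show "e t I \<le> e1 t I + e2 t I" using le by simp
    qed
    also have "\<dots> = (\<Sum>(t, I)\<in>p. e1 t I) + (\<Sum>(t, I)\<in>p. e2 t I)"
      by (simp add: case_prod_beta sum.distrib)
    also have "\<dots> < \<epsilon>" using \<delta>1(2)[OF p(1) fine(1)] \<delta>2(2)[OF p(1) fine(2)] by linarith
    finally show "(\<Sum>(t, I)\<in>p. e t I) < \<epsilon>" .
  qed
qed

text \<open>Translating two sets changes their Hausdorff distance by at most the distance of the translation vectors, here
  the error of the primitive of \<open>f\<close>.\<close>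

lemma nonneg_vH_translate:
  fixes \<Gamma> :: "real \<Rightarrow> 'a::real_normed_vector set"
  assumes \<Phi>: "\<And>I. I \<in> subintervals \<Longrightarrow> \<Phi> I \<in> convex_bounded" and \<Gamma>: "\<And>t. t \<in> {0..1} \<Longrightarrow> \<Gamma> t \<in> convex_bounded"
    and prim: "vH_primitive \<Phi> \<Gamma>" and fprim: "vH_primitive (\<lambda>I. {\<phi> I}) (\<lambda>t. {f t})"
    and f: "\<And>t. t \<in> {0..1} \<Longrightarrow> f t \<in> \<Gamma> t" and G: "\<And>t. t \<in> {0..1} \<Longrightarrow> G t = \<Gamma> t + {- f t}"
  shows "nonneg_vH_multifunction G (\<lambda>I. \<Phi> I + {- \<phi> I})"
proof
  show "\<Phi> I + {- \<phi> I} \<in> convex_bounded" if "I \<in> subintervals" for I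
    using that by (intro convex_bounded_plus \<Phi> convex_bounded_singleton)
  show Gb: "G t \<in> convex_bounded" if "t \<in> {0..1}" for t
    using that by (simp only: G) (intro convex_bounded_plus \<Gamma> convex_bounded_singleton)
  show "0 \<in> G t" if "t \<in> {0..1}" for t
    using set_plus_intro[OF f[OF that], of "- f t" "{- f t}"] by (simp add: G[OF that])
  show "finitely_additive (\<lambda>I. \<Phi> I + {- \<phi> I})"
    unfolding finitely_additive_def
  proof (intro ballI impI)
    fix I J assume IJ: "I \<in> subintervals" "J \<in> subintervals" "I \<union> J \<in> subintervals \<and> interior I \<inter> interior J = {}"
    have 1: "\<Phi> (I \<union> J) = \<Phi> I + \<Phi> J"
      using prim IJ unfolding vH_primitive_def finitely_additive_def by blast
    have "{\<phi> (I \<union> J)} = {\<phi> I} + {\<phi> J}"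
      using fprim IJ unfolding vH_primitive_def finitely_additive_def by blast
    then have "\<phi> (I \<union> J) = \<phi> I + \<phi> J" by (simp add: set_plus_def)
    then have "{- \<phi> (I \<union> J)} = {- \<phi> I} + {- \<phi> J}" by (simp add: set_plus_def)
    with 1 show "\<Phi> (I \<union> J) + {- \<phi> (I \<union> J)} = (\<Phi> I + {- \<phi> I}) + (\<Phi> J + {- \<phi> J})"
      by (simp add: ac_simps)
  qed
  show "variationally_small (\<lambda>t I. hausdorff_distance (\<Phi> I + {- \<phi> I}) (measure lebesgue I *\<^sub>S G t))"
  proof (rule variationally_small_le_add)
    show "variationally_small (\<lambda>t I. hausdorff_distance (\<Phi> I) (measure lebesgue I *\<^sub>S \<Gamma> t))"
      using prim by (simp add: vH_primitive_iff)
    show "variationally_small (\<lambda>t I. hausdorff_distance {\<phi> I} (measure lebesgue I *\<^sub>S {f t}))"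
      using fprim by (simp add: vH_primitive_iff)
    fix t a b :: real assume ab: "0 \<le> a" "a \<le> t" "t \<le> b" "b \<le> 1"
    define I where "I = {a..b}"
    define c where "c = measure lebesgue I"
    have I: "I \<in> subintervals" and t: "t \<in> {0..1}" using ab by (auto simp: I_def intro: subintervalsI)
    have "c *\<^sub>S G t = c *\<^sub>S \<Gamma> t + {- (c *\<^sub>R f t)}"
      unfolding G[OF t] set_plus_singleton image_image by (simp add: scaleR_right_diff_distrib)
    then have "hausdorff_distance (\<Phi> I + {- \<phi> I}) (c *\<^sub>S G t) \<le>
        hausdorff_distance (\<Phi> I) (c *\<^sub>S \<Gamma> t) + hausdorff_distance {- \<phi> I} {- (c *\<^sub>R f t)}"
      by (simp only:) (intro hausdorff_plus_le \<Phi>[OF I] convex_bounded_singleton convex_bounded_scale \<Gamma>[OF t])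
    also have "hausdorff_distance {- \<phi> I} {- (c *\<^sub>R f t)} = hausdorff_distance {\<phi> I} (c *\<^sub>S {f t})"
      by (simp add: dist_minus)
    finally show "hausdorff_distance (\<Phi> {a..b} + {- \<phi> {a..b}}) (measure lebesgue {a..b} *\<^sub>S G t) \<le>
        hausdorff_distance (\<Phi> {a..b}) (measure lebesgue {a..b} *\<^sub>S \<Gamma> t) +
        hausdorff_distance {\<phi> {a..b}} (measure lebesgue {a..b} *\<^sub>S {f t})"
      unfolding c_def I_def .
  qed
qed

theorem theorem4p2:
  fixes \<Gamma> :: "real \<Rightarrow> 'a::banach set"
  assumes "\<forall>t\<in>{0..1}. \<Gamma> t \<in> cwk"
    and "vH_integrable \<Gamma>"
  shows "(S_vH \<Gamma> \<noteq> {} \<longrightarrow>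
            (\<forall>f\<in>S_vH \<Gamma>. \<forall>G. (\<forall>t\<in>{0..1}. \<Gamma> t = G t + {f t}) \<longrightarrow>
               (\<forall>t\<in>{0..1}. G t \<in> cwk) \<and> birkhoff_integrable G))
       \<and> (radon_nikodym_property TYPE('a) \<longrightarrow> S_vH \<Gamma> \<noteq> {})"
proof (intro conjI impI)
  show "S_vH \<Gamma> \<noteq> {}" if "radon_nikodym_property TYPE('a)"
    using rnp_vH_selection_exists[OF that _ assms(2)] assms(1) by blast
  show "\<forall>f\<in>S_vH \<Gamma>. \<forall>G. (\<forall>t\<in>{0..1}. \<Gamma> t = G t + {f t}) \<longrightarrow>
      (\<forall>t\<in>{0..1}. G t \<in> cwk) \<and> birkhoff_integrable G"
  proof (intro ballI allI impI)
    fix f G assume fS: "f \<in> S_vH \<Gamma>" and G: "\<forall>t\<in>{0..1}. \<Gamma> t = G t + {f t}"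
    have \<Gamma>: "\<Gamma> t \<in> cwk" if "t \<in> {0..1}" for t using assms(1) that by blast
    have f: "f t \<in> \<Gamma> t" if "t \<in> {0..1}" for t using fS that by (simp add: S_vH_def)
    have G': "G t = \<Gamma> t + {- f t}" if "t \<in> {0..1}" for t
    proof -
      have "\<Gamma> t + {- f t} = G t + {f t} + {- f t}" using G that by simp
      also have "\<dots> = G t" by (simp only: set_plus_singleton image_image) simp
      finally show ?thesis by simp
    qed
    have Gcwk: "G t \<in> cwk" if "t \<in> {0..1}" for t
      unfolding G'[OF that] by (rule cwk_plus_singleton[OF \<Gamma>[OF that]])
    obtain \<Phi> where \<Phi>: "\<And>I. I \<in> subintervals \<Longrightarrow> \<Phi> I \<in> cwk" and prim: "vH_primitive \<Phi> \<Gamma>"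
      using assms(2) unfolding vH_integrable_def by blast
    obtain \<phi> where fprim: "vH_primitive (\<lambda>I. {\<phi> I}) (\<lambda>t. {f t})"
      using fS unfolding S_vH_def vH_integrable_fun_def by blast
    have "nonneg_vH_multifunction G (\<lambda>I. \<Phi> I + {- \<phi> I})"
      by (rule nonneg_vH_translate[OF cwk_convex_bounded[OF \<Phi>] cwk_convex_bounded[OF \<Gamma>] prim fprim f G'])
    moreover have "\<Phi> {0..1} + {- \<phi> {0..1}} \<in> cwk"
      by (intro cwk_plus_singleton \<Phi> subintervalsI) auto
    ultimately have "birkhoff_integrable G"
      using Gcwk by (rule nonneg_vH_birkhoff_integrable)
    with Gcwk show "(\<forall>t\<in>{0..1}. G t \<in> cwk) \<and> birkhoff_integrable G" by blast
  qed
qed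

end
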